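(* The space $\operatorname{Proj}_{E}\big(\mathcal{L} \cap (D_0 \oplus N_0)\big)$ is the null space of the sesquilinear form $q[G,F] := \langle G, P_R \Lambda P_R F\rangle$ restricted to $\mathcal{F}_0 := D_0\cap \operatorname{Ker} P_D$, i.e. it equals $\{F\in\mathcal{F}_0 : q[G,F]=0 \text{ for all } G\in\mathcal{F}_0\}$. In particular, the uniformly shrinking graph operator $H_\epsilon$ has no exotic eigenvalues if and only if $$\dim \operatorname{Proj}_{E}\big(\mathcal{L} \cap (D_0 \oplus N_0)\big) = 0.$$
   Context: Let $\mathcal{E}$ be a finite set (of edges), and let $\ell_e>0$, $e\in\mathcal{E}$, be fixed. Each edge $e$ has two endpoints, denoted $e^-$ and $e^+$. Let $E \simeq \mathbb{C}^{2|\mathcal{E}|}$ be the space of boundary values and $E' \simeq \mathbb{C}^{2|\mathcal{E}|}$ the space of boundary derivative values, both with coordinates indexed by the endpoints $e^\pm$, $e\in\mathcal{E}$ (in the same order), with the standard Hermitian inner product $\langle\cdot,\cdot\rangle$; $E$ and $E'$ are identified in the natural way. For $\epsilon>0$ and $f=(f_e)_{e\in\mathcal{E}} \in \bigoplus_{e\in\mathcal{E}} H^2(0,\epsilon\ell_e)$ set $$f_{e^-} = f_e(0),\quad f_{e^+} = f_e(\epsilon\ell_e),\quad \partial f_{e^-} = f_e'(0),\quad \partial f_{e^+} = -f_e'(\epsilon\ell_e),$$ and $F := (f_{e^\pm})_{e\in\mathcal{E}} \in E$, $F' := (\partial f_{e^\pm})_{e\in\mathcal{E}} \in E'$. Let $P_D,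 P_N, P_R$ be orthogonal projectors on $\mathbb{C}^{2|\mathcal{E}|}$ with $P_D+P_N+P_R=I$ (so they are mutually orthogonal), and let $\Lambda$ be an invertible self-adjoint operator on the space $P_R E$. All of these are fixed, independent of $\epsilon$. The operator $H_\epsilon$ is the self-adjoint operator in $\bigoplus_{e\in\mathcal{E}} L_2(0,\epsilon\ell_e)$ (complex-valued functions) acting as $-d^2/dx^2$ on each edge, whose domain is the set of $f\in\bigoplus_{e\in\mathcal{E}} H^2(0,\epsilon\ell_e)$ satisfying $$P_D F = 0,\qquad P_N F' = 0,\qquad P_R F' = \Lambda P_R F.$$ Its eigenvalues $\lambda_1(\epsilon)\le\lambda_2(\epsilon)\le\cdots$ are numbered in non-decreasing order with multiplicity. An eigenvalue $\lambda_n(\epsilon)$ is called exotic if it tends to a finite limit as $\epsilon\to0^+$ (with $n$ fixed). Let $$D_0 := \{F \in E : F_{e^-} = F_{e^+} \text{ for all } e\in\mathcal{E}\},\qquad N_0 := \{F' \in E' : F'_{e^-} = -F'_{e^+} \text{ for all } e\in\mathcal{E}\},$$ $$\mathcal{L} := \{(F,F')\in E\oplus E' : P_D F=0,\ P_N F'=0,\ P_R F'=\Lambda P_R F\}.$$ $\operatorname{Proj}_E$ denotes the projection $E\oplus E'\to E$, $(F,F')\mapsto F$. *)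

theory Defs
  imports "HOL-Analysis.Analysis" "HOL-Library.Function_Algebras"
begin

section \<open>Boundary values and vertex conditions\<close>

text \<open>
  \<open>Start e\<close> and \<open>End e\<close> are the endpoints written $e^-$ and $e^+$. The type \<open>'e\<close> is the finite set
  of edges, and both $E$ and $E'$ are \<open>complex ^ 'e endpoint\<close>.
\<close>

datatype 'e endpoint = Start 'e | End 'e

instance endpoint :: (finite) finite
proof
  have "x \<in> range Start \<union> range End" for x :: "'a endpoint"
    by (cases x) auto
  then have "(UNIV :: 'a endpoint set) \<subseteq> range Start \<union> range End"
    by (rule subsetI)
  then show "finite (UNIV :: 'a endpoint set)"
    by (rule finite_subset) simp
qed

definition cinner :: "complex ^ 'n \<Rightarrow> complex ^ 'n \<Rightarrow> complex" where
  "cinner G F = (\<Sum>i\<in>UNIV. cnj (G $ i) * F $ i)"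

definition orth_projector :: "complex ^ 'n ^ 'n \<Rightarrow> bool" where
  "orth_projector P \<longleftrightarrow> P ** P = P \<and> (\<forall>x y. cinner (P *v x) y = cinner x (P *v y))"

text \<open>
  The operator on \<open>W\<close> is given by a total function, about whose values outside \<open>W\<close> nothing is said.
\<close>

definition invertible_selfadjoint_on :: "(complex ^ 'n) set \<Rightarrow> (complex ^ 'n \<Rightarrow> complex ^ 'n) \<Rightarrow> bool" where
  "invertible_selfadjoint_on W \<Lambda> \<longleftrightarrow>
     bij_betw \<Lambda> W W \<and>
     (\<forall>x\<in>W. \<forall>y\<in>W. \<Lambda> (x + y) = \<Lambda> x + \<Lambda> y) \<and>
     (\<forall>c. \<forall>x\<in>W. \<Lambda> (c *s x) = c *s \<Lambda> x) \<and>
     (\<forall>x\<in>W. \<forall>y\<in>W. cinner (\<Lambda> x) y = cinner x (\<Lambda> y))"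

definition D0 :: "(complex ^ 'e::finite endpoint) set" where
  "D0 = {F. \<forall>e. F $ Start e = F $ End e}"

definition N0 :: "(complex ^ 'e::finite endpoint) set" where
  "N0 = {F'. \<forall>e. F' $ Start e = - (F' $ End e)}"

definition vertex_conditions ::
  "complex ^ 'n ^ 'n \<Rightarrow> complex ^ 'n ^ 'n \<Rightarrow> complex ^ 'n ^ 'n \<Rightarrow> (complex ^ 'n \<Rightarrow> complex ^ 'n)
    \<Rightarrow> ((complex ^ 'n) \<times> (complex ^ 'n)) set" where
  "vertex_conditions PD PN PR \<Lambda> =
     {(F, F'). PD *v F = 0 \<and> PN *v F' = 0 \<and> PR *v F' = \<Lambda> (PR *v F)}"

definition ProjE :: "((complex ^ 'n) \<times> (complex ^ 'n)) set \<Rightarrow> (complex ^ 'n) set" where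
  "ProjE S = fst ` S"

definition F0 :: "complex ^ 'e::finite endpoint ^ 'e endpoint \<Rightarrow> (complex ^ 'e endpoint) set" where
  "F0 PD = D0 \<inter> {F. PD *v F = 0}"

definition qform ::
  "complex ^ 'n ^ 'n \<Rightarrow> (complex ^ 'n \<Rightarrow> complex ^ 'n) \<Rightarrow> complex ^ 'n \<Rightarrow> complex ^ 'n \<Rightarrow> complex" where
  "qform PR \<Lambda> G F = cinner G (PR *v (\<Lambda> (PR *v F)))"


section \<open>The shrinking graph operator\<close>

definition square_integrable :: "real \<Rightarrow> (real \<Rightarrow> complex) \<Rightarrow> bool" where
  "square_integrable L g \<longleftrightarrow>
     set_borel_measurable lborel {0..L} g \<and> set_integrable lborel {0..L} (\<lambda>x. (cmod (g x))\<^sup>2)"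

definition deriv_on :: "real \<Rightarrow> (real \<Rightarrow> complex) \<Rightarrow> real \<Rightarrow> complex" where
  "deriv_on L f x = vector_derivative f (at x within {0..L})"

text \<open>
  \<open>g\<close> represents the $L_2$ function $f''$: the function \<open>f\<close> is differentiable on $[0,L]$, one-sidedly
  at the ends, and $f'$ is absolutely continuous with almost everywhere derivative \<open>g\<close>.
\<close>

definition second_derivative :: "real \<Rightarrow> (real \<Rightarrow> complex) \<Rightarrow> (real \<Rightarrow> complex) \<Rightarrow> bool" where
  "second_derivative L f g \<longleftrightarrow>
     (\<forall>x\<in>{0..L}. f differentiable (at x within {0..L})) \<and>
     square_integrable L g \<and>
     (\<forall>x\<in>{0..L}. deriv_on L f x = deriv_on L f 0 + (LINT t:{0..x}|lborel. g t))"

text \<open>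
  The Sobolev space $H^2(0,L)$. Each class is represented by its $C^1$ representative on $[0,L]$,
  for which the boundary values below make sense, set to zero outside $[0,L]$. Distinct functions
  are thus distinct classes, and linear dimension has its usual meaning.
\<close>

definition H2 :: "real \<Rightarrow> (real \<Rightarrow> complex) set" where
  "H2 L = {f. (\<forall>x. x \<notin> {0..L} \<longrightarrow> f x = 0) \<and> (\<exists>g. second_derivative L f g)}"

text \<open>In the following, \<open>L e\<close> is the length of the edge \<open>e\<close>.\<close>

definition bvalue :: "('e::finite \<Rightarrow> real) \<Rightarrow> ('e \<Rightarrow> real \<Rightarrow> complex) \<Rightarrow> complex ^ 'e endpoint" where
  "bvalue L f = (\<chi> v. case v of Start e \<Rightarrow> f e 0 | End e \<Rightarrow> f e (L e))"

definition bderiv :: "('e::finite \<Rightarrow> real) \<Rightarrow> ('e \<Rightarrow> real \<Rightarrow> complex) \<Rightarrow> complex ^ 'e endpoint" where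
  "bderiv L f = (\<chi> v. case v of Start e \<Rightarrow> deriv_on (L e) (f e) 0
                              | End e \<Rightarrow> - deriv_on (L e) (f e) (L e))"

definition graph_domain ::
  "('e::finite \<Rightarrow> real) \<Rightarrow> ((complex ^ 'e endpoint) \<times> (complex ^ 'e endpoint)) set
    \<Rightarrow> ('e \<Rightarrow> real \<Rightarrow> complex) set" where
  "graph_domain L \<L> = {f. (\<forall>e. f e \<in> H2 (L e)) \<and> (bvalue L f, bderiv L f) \<in> \<L>}"

text \<open>
  The operator as a relation: \<open>(f, h)\<close> is in it iff \<open>f\<close> is in the domain and \<open>h\<close> is a representative
  of the $L_2$ function $-f''$.
\<close>

definition graph_operator ::
  "('e::finite \<Rightarrow> real) \<Rightarrow> ((complex ^ 'e endpoint) \<times> (complex ^ 'e endpoint)) set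
    \<Rightarrow> (('e \<Rightarrow> real \<Rightarrow> complex) \<times> ('e \<Rightarrow> real \<Rightarrow> complex)) set" where
  "graph_operator L \<L> =
     {(f, h). f \<in> graph_domain L \<L> \<and> (\<forall>e. second_derivative (L e) (f e) (\<lambda>x. - h e x))}"

definition shrinking_graph_operator ::
  "('e::finite \<Rightarrow> real) \<Rightarrow> complex ^ 'e endpoint ^ 'e endpoint \<Rightarrow> complex ^ 'e endpoint ^ 'e endpoint
    \<Rightarrow> complex ^ 'e endpoint ^ 'e endpoint \<Rightarrow> (complex ^ 'e endpoint \<Rightarrow> complex ^ 'e endpoint)
    \<Rightarrow> real \<Rightarrow> (('e \<Rightarrow> real \<Rightarrow> complex) \<times> ('e \<Rightarrow> real \<Rightarrow> complex)) set" where
  "shrinking_graph_operator len PD PN PR \<Lambda> \<epsilon> =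
     graph_operator (\<lambda>e. \<epsilon> * len e) (vertex_conditions PD PN PR \<Lambda>)"


section \<open>Eigenvalues in non-decreasing order\<close>

definition fscale :: "complex \<Rightarrow> ('e \<Rightarrow> real \<Rightarrow> complex) \<Rightarrow> 'e \<Rightarrow> real \<Rightarrow> complex" where
  "fscale c f = (\<lambda>e x. c * f e x)"

lemma vector_space_fscale: "vector_space fscale"
  by unfold_locales (auto simp: fscale_def fun_eq_iff algebra_simps)

definition eigenspace ::
  "(('e \<Rightarrow> real \<Rightarrow> complex) \<times> ('e \<Rightarrow> real \<Rightarrow> complex)) set \<Rightarrow> complex \<Rightarrow> ('e \<Rightarrow> real \<Rightarrow> complex) set" where
  "eigenspace H \<mu> = {f. (f, fscale \<mu> f) \<in> H}"

text \<open>Only real eigenvalues are considered, as the operators of interest are self-adjoint.\<close>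

definition eigenvalues :: "(('e \<Rightarrow> real \<Rightarrow> complex) \<times> ('e \<Rightarrow> real \<Rightarrow> complex)) set \<Rightarrow> real set" where
  "eigenvalues H = {\<mu>. \<exists>f \<in> eigenspace H (complex_of_real \<mu>). f \<noteq> 0}"

definition eigenvalue_mult :: "(('e \<Rightarrow> real \<Rightarrow> complex) \<times> ('e \<Rightarrow> real \<Rightarrow> complex)) set \<Rightarrow> real \<Rightarrow> nat" where
  "eigenvalue_mult H \<mu> = vector_space.dim fscale (eigenspace H (complex_of_real \<mu>))"

text \<open>
  $\mu = \lambda_n$, counting from 1 and with multiplicity. As a relation this says that $\lambda_n$
  exists; the finiteness condition prevents the sums from defaulting to zero.
\<close>

definition is_nth_eigenvalue ::
  "(('e \<Rightarrow> real \<Rightarrow> complex) \<times> ('e \<Rightarrow> real \<Rightarrow> complex)) set \<Rightarrow> nat \<Rightarrow> real \<Rightarrow> bool" where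
  "is_nth_eigenvalue H n \<mu> \<longleftrightarrow>
     \<mu> \<in> eigenvalues H \<and> finite (eigenvalues H \<inter> {..\<mu>}) \<and>
     (\<Sum>\<nu>\<in>eigenvalues H \<inter> {..<\<mu>}. eigenvalue_mult H \<nu>) < n \<and>
     n \<le> (\<Sum>\<nu>\<in>eigenvalues H \<inter> {..\<mu>}. eigenvalue_mult H \<nu>)"

text \<open>The \<open>n\<close>-th eigenvalue of \<open>H \<epsilon>\<close> tends to a finite limit as $\epsilon \to 0^+$.\<close>

definition exotic :: "(real \<Rightarrow> (('e \<Rightarrow> real \<Rightarrow> complex) \<times> ('e \<Rightarrow> real \<Rightarrow> complex)) set) \<Rightarrow> nat \<Rightarrow> bool" where
  "exotic H n \<longleftrightarrow>
     (\<exists>(lam :: real \<Rightarrow> real) l. (\<forall>\<^sub>F \<epsilon> in at_right 0. is_nth_eigenvalue (H \<epsilon>) n (lam \<epsilon>)) \<and>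
        (lam \<longlongrightarrow> l) (at_right 0))"

end

theory Submission
  imports Defs
begin

text \<open>
  Both claims come from replacing the spectral problem by one about Hermitian forms on boundary
  values.

  The identity for the null space is duality. In weak form the vertex conditions say that
  \<open>P\<^sub>D F = 0\<close> and $\langle G, F'\rangle = q[G,F]$ for all $G \in \mathrm{Ker}\,P_D$
  (\<open>vertex_conditions_iff\<close>). A suitable $F' \in N_0$ exists as soon as $P_R \Lambda P_R F$ lies in
  $N_0 + \mathrm{Ran}\,P_D$, which is the orthogonal complement of $D_0 \cap \mathrm{Ker}\,P_D$
  (\<open>ProjE_eq\<close>).

  For the spectral claim, fix \<open>\<mu>\<close> below the lowest Dirichlet eigenvalue of every edge. A solution of
  $-f'' = \mu f$ on an edge is then determined by its end values, so eigenfunctions correspond to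
  the null vectors on $\mathrm{Ker}\,P_D$ of the form
  $Q_{\epsilon,\mu}(G,F) = q[G,F] - \langle G, F'\rangle$, where $F'$ is the Dirichlet-to-Neumann
  image of $F$ (\<open>eigenspace_eq_edge_solutions\<close>). This form decreases strictly in \<open>\<mu>\<close> and is positive
  definite for very negative \<open>\<mu>\<close>. Hence the eigenvalues below \<open>\<mu>\<close>, with multiplicity, are as many as
  the dimension of a maximal negative subspace (\<open>sum_mult_le_codim\<close>, \<open>negative_dim_le_sum_mult\<close>).

  It remains to find that dimension as the edges shrink. Write $u_e$ and $v_e$ for half the sum and
  half the difference of the two end values. The edge part of $Q_{\epsilon,\mu}$ is
  $\sum_e 2 A_e |u_e|^2 + 2 B_e |v_e|^2$ with $A_e \approx -\mu\epsilon\ell_e/2$ and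
  $B_e \approx 2/(\epsilon\ell_e)$. Split $\mathcal{F}_0 = C \oplus K$, where $K$ is the null space of
  $q$ on $\mathcal{F}_0$, and $\mathrm{Ker}\,P_D = \mathcal{F}_0 \oplus X$. After scaling the three
  components in $C$, $K$, $X$ by $\sqrt\epsilon$, $1$, $\epsilon$, the form $\epsilon^{-1}Q_{\epsilon,\mu}$
  converges (\<open>scaled_form_tendsto\<close>) to
  \[ q[w,w] + 2\,\mathrm{Re}\,q[n,x] + \sum_e \frac{4}{\ell_e}|v_e(x)|^2 - \mu \sum_e \ell_e |u_e(n)|^2 ,
     \qquad w \in C,\ n \in K,\ x \in X. \]
  If $K = 0$, the limit does not involve \<open>\<mu>\<close>; the number of eigenvalues below \<open>\<mu>\<close> is then eventually
  the same for any two values of \<open>\<mu>\<close>, so that no eigenvalue stays bounded. If $K \ne 0$, the two middle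
  terms have a finite infimum $l$ relative to $\sum_e \ell_e |u_e(n)|^2$. Eventually the count equals the
  negative dimension $m$ of $q$ on $C$ for $\mu < l$ and exceeds it for $\mu > l$, so that
  $\lambda_{m+1}(\epsilon) \to l$ (\<open>exotic_first\<close>).
\<close>

section \<open>Hermitian forms on complex coordinate spaces\<close>

definition hermitian_form :: "(complex ^ 'n \<Rightarrow> complex ^ 'n \<Rightarrow> complex) \<Rightarrow> bool" where
  "hermitian_form q \<longleftrightarrow>
     (\<forall>G F F'. q G (F + F') = q G F + q G F') \<and>
     (\<forall>c G F. q G (c *s F) = c * q G F) \<and>
     (\<forall>G F. q F G = cnj (q G F))"

definition positive_on :: "(complex ^ 'n) set \<Rightarrow> (complex ^ 'n \<Rightarrow> complex ^ 'n \<Rightarrow> complex) \<Rightarrow> bool" where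
  "positive_on U q \<longleftrightarrow> (\<forall>F\<in>U. F \<noteq> 0 \<longrightarrow> 0 < Re (q F F))"

definition null_space :: "(complex ^ 'n) set \<Rightarrow> (complex ^ 'n \<Rightarrow> complex ^ 'n \<Rightarrow> complex) \<Rightarrow> (complex ^ 'n) set" where
  "null_space U q = {F \<in> U. \<forall>G\<in>U. q G F = 0}"

definition subspace_sum :: "(complex ^ 'n) set \<Rightarrow> (complex ^ 'n) set \<Rightarrow> (complex ^ 'n) set" where
  "subspace_sum U W = {x + y | x y. x \<in> U \<and> y \<in> W}"

lemma hermitian_formI:
  assumes "\<And>G F F'. q G (F + F') = q G F + q G F'" "\<And>c G F. q G (c *s F) = c * q G F"
    "\<And>G F. q F G = cnj (q G F)"
  shows "hermitian_form q"
  using assms unfolding hermitian_form_def by blast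

lemma hermitian_form_simps:
  assumes "hermitian_form q"
  shows "q G (F + F') = q G F + q G F'" "q (F + F') G = q F G + q F' G"
    "q G (c *s F) = c * q G F" "q (c *s F) G = cnj c * q F G" "q G 0 = 0" "q 0 G = 0"
proof -
  note h = assms[unfolded hermitian_form_def]
  show a: "q G (F + F') = q G F + q G F'" and b: "q G (c *s F) = c * q G F" for G F F' c
    using h by blast+
  have c: "q F G = cnj (q G F)" for F G using h by blast
  show "q (F + F') G = q F G + q F' G" "q (c *s F) G = cnj c * q F G"
    using c[of "F + F'" G] c[of F G] c[of F' G] c[of "c *s F" G] a b by auto
  show z: "q G 0 = 0" for G using b[of G 0 0] by simp
  show "q 0 G = 0" using c[of 0 G] z by simp
qed

lemma hermitian_form_diff:
  assumes "hermitian_form q"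
  shows "q G (F - F') = q G F - q G F'" "q (F - F') G = q F G - q F' G"
proof -
  have "F - F' = F + (-1) *s F'" by (simp add: vec_eq_iff)
  then show "q G (F - F') = q G F - q G F'" "q (F - F') G = q F G - q F' G"
    by (simp_all only: hermitian_form_simps[OF assms]) simp_all
qed

lemma hermitian_form_cnj: "hermitian_form q \<Longrightarrow> q F G = cnj (q G F)"
  unfolding hermitian_form_def by blast

lemma hermitian_form_diag_real: "hermitian_form q \<Longrightarrow> q F F = of_real (Re (q F F))"
proof -
  assume "hermitian_form q"
  then have "cnj (q F F) = q F F" by (rule hermitian_form_cnj[symmetric])
  then show ?thesis by (simp add: complex_eq_iff)
qed

lemma hermitian_form_add:
  "\<lbrakk>hermitian_form p; hermitian_form q\<rbrakk> \<Longrightarrow> hermitian_form (\<lambda>G F. p G F + q G F)"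
  by (rule hermitian_formI)
    (simp_all add: hermitian_form_simps algebra_simps, metis hermitian_form_cnj)

lemma hermitian_form_uminus: "hermitian_form q \<Longrightarrow> hermitian_form (\<lambda>G F. - q G F)"
  by (rule hermitian_formI)
    (simp_all add: hermitian_form_simps algebra_simps, metis hermitian_form_cnj)

lemma hermitian_form_scale: "hermitian_form q \<Longrightarrow> hermitian_form (\<lambda>G F. of_real r * q G F)"
  by (rule hermitian_formI)
    (simp_all add: hermitian_form_simps algebra_simps, metis hermitian_form_cnj)

lemma hermitian_form_expand_right:
  assumes q: "hermitian_form q"
  shows "q G F = (\<Sum>j\<in>UNIV. F $ j * q G (axis j 1))"
proof -
  have s: "q G (\<Sum>j\<in>S. F $ j *s axis j 1) = (\<Sum>j\<in>S. F $ j * q G (axis j 1))" if "finite S" for S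
    using that by induction (simp_all add: hermitian_form_simps[OF q])
  show ?thesis using s[of UNIV] by (simp add: basis_expansion)
qed

lemma hermitian_form_expand:
  assumes q: "hermitian_form q"
  shows "q G F = (\<Sum>j\<in>UNIV. F $ j * (\<Sum>i\<in>UNIV. cnj (G $ i) * q (axis i 1) (axis j 1)))"
proof -
  have "q G (axis j 1) = (\<Sum>i\<in>UNIV. cnj (G $ i) * q (axis i 1) (axis j 1))" for j
  proof -
    have "q G (axis j 1) = cnj (q (axis j 1) G)" by (rule hermitian_form_cnj[OF q])
    also have "\<dots> = (\<Sum>i\<in>UNIV. cnj (G $ i) * cnj (q (axis j 1) (axis i 1)))"
      by (subst hermitian_form_expand_right[OF q]) simp
    also have "\<dots> = (\<Sum>i\<in>UNIV. cnj (G $ i) * q (axis i 1) (axis j 1))"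
      by (simp only: hermitian_form_cnj[OF q, symmetric])
    finally show ?thesis .
  qed
  then show ?thesis by (subst hermitian_form_expand_right[OF q]) simp
qed

lemma hermitian_form_tendsto:
  assumes q: "\<forall>\<^sub>F t in T. hermitian_form (q t)" and p: "hermitian_form p"
    and lim: "\<And>i j. ((\<lambda>t. q t (axis i 1) (axis j 1)) \<longlongrightarrow> p (axis i 1) (axis j 1)) T"
    and G: "(G \<longlongrightarrow> G1) T" and F: "(F \<longlongrightarrow> F1) T"
  shows "((\<lambda>t. q t (G t) (F t)) \<longlongrightarrow> p G1 F1) T"
proof -
  have "((\<lambda>t. \<Sum>j\<in>UNIV. F t $ j * (\<Sum>i\<in>UNIV. cnj (G t $ i) * q t (axis i 1) (axis j 1)))
    \<longlongrightarrow> (\<Sum>j\<in>UNIV. F1 $ j * (\<Sum>i\<in>UNIV. cnj (G1 $ i) * p (axis i 1) (axis j 1)))) T"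
    by (intro tendsto_intros lim G F)
  then show ?thesis
    unfolding hermitian_form_expand[OF p, symmetric]
    by (rule Lim_transform_eventually)
      (use q in eventually_elim, simp add: hermitian_form_expand)
qed

lemma scaleR_eq_vector_smult: "r *\<^sub>R (F :: complex ^ 'n) = of_real r *s F"
  by (simp add: vec_eq_iff scaleR_conv_of_real[where 'a=complex])

lemma subspace_of_vec_subspace: "vec.subspace U \<Longrightarrow> subspace (U :: (complex ^ 'n) set)"
  by (auto simp: subspace_def vec.subspace_def scaleR_eq_vector_smult)

lemma Re_hermitian_form_scaleR:
  assumes "hermitian_form q"
  shows "Re (q (r *\<^sub>R F) (r *\<^sub>R F)) = r\<^sup>2 * Re (q F F)"
  by (simp add: scaleR_eq_vector_smult hermitian_form_simps[OF assms] power2_eq_square)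

text \<open>
  Positivity on a subspace is decided on its unit sphere. The limit form has a positive minimum
  there by compactness, and convergence of finitely many matrix entries makes the difference
  of the forms uniformly smaller than that minimum.
\<close>
lemma positive_on_stable:
  assumes q: "\<forall>\<^sub>F t in T. hermitian_form (q t)" and p: "hermitian_form p"
    and lim: "\<And>i j. ((\<lambda>t. q t (axis i 1) (axis j 1)) \<longlongrightarrow> p (axis i 1) (axis j 1)) T"
    and U: "vec.subspace U" and pos: "positive_on U p"
  shows "\<forall>\<^sub>F t in T. positive_on U (q t)"
proof (cases "U \<subseteq> {0}")
  case True
  then show ?thesis by (auto simp: positive_on_def intro!: always_eventually)
next
  case False
  define S where "S = U \<inter> sphere 0 1"
  have sub: "subspace U" by (rule subspace_of_vec_subspace[OF U])
  have "compact S"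
    unfolding S_def using closed_subspace[OF sub] compact_sphere by (simp add: closed_Int_compact)
  moreover have "S \<noteq> {}"
  proof -
    from False obtain F where F: "F \<in> U" "F \<noteq> 0" by auto
    then have "(1 / norm F) *\<^sub>R F \<in> S" using sub by (simp add: S_def subspace_scale)
    then show ?thesis by auto
  qed
  moreover have "continuous_on S (\<lambda>F. Re (p F F))"
    unfolding continuous_on_def
  proof (intro ballI tendsto_Re)
    fix F
    show "((\<lambda>F. p F F) \<longlongrightarrow> p F F) (at F within S)"
      by (rule hermitian_form_tendsto[where q="\<lambda>_. p", OF always_eventually p])
        (simp_all add: p)
  qed
  ultimately obtain F where F: "F \<in> S" and min: "\<And>G. G \<in> S \<Longrightarrow> Re (p F F) \<le> Re (p G G)"
    using continuous_attains_inf[of S] by blast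
  have "norm F = 1" "F \<in> U" using F by (auto simp: S_def)
  then have m: "0 < Re (p F F)" using pos unfolding positive_on_def by force
  define d where "d t = (\<Sum>j\<in>UNIV. \<Sum>i\<in>UNIV. cmod (q t (axis i 1) (axis j 1) - p (axis i 1) (axis j 1)))" for t
  have "(d \<longlongrightarrow> (\<Sum>j\<in>(UNIV::'b set). \<Sum>i\<in>(UNIV::'b set). cmod 0)) T"
    unfolding d_def by (intro tendsto_intros) (use lim in \<open>simp add: LIM_zero\<close>)
  then have "(d \<longlongrightarrow> 0) T" by simp
  then have "\<forall>\<^sub>F t in T. d t < Re (p F F)" using m by (simp add: order_tendsto_iff)
  with q show ?thesis
  proof eventually_elim
    case (elim t)
    have sphere_pos: "0 < Re (q t G G)" if G: "G \<in> S" for G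
    proof -
      have n1: "cmod (G $ i) \<le> 1" for i
        using G Finite_Cartesian_Product.norm_nth_le[of G i] by (simp add: S_def)
      have "q t G G - p G G =
        (\<Sum>j\<in>UNIV. G $ j * (\<Sum>i\<in>UNIV. cnj (G $ i) * (q t (axis i 1) (axis j 1) - p (axis i 1) (axis j 1))))"
        unfolding hermitian_form_expand[OF elim(1), of G G] hermitian_form_expand[OF p, of G G]
        by (simp add: sum_subtractf algebra_simps)
      also have "cmod \<dots> \<le> d t"
        unfolding d_def
      proof (intro sum_norm_le)
        fix j
        have "cmod (G $ j * (\<Sum>i\<in>UNIV. cnj (G $ i) * (q t (axis i 1) (axis j 1) - p (axis i 1) (axis j 1))))
          \<le> 1 * (\<Sum>i\<in>UNIV. cmod (q t (axis i 1) (axis j 1) - p (axis i 1) (axis j 1)))"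
          unfolding norm_mult
        proof (intro mult_mono n1 sum_norm_le)
          fix i
          show "cmod (cnj (G $ i) * (q t (axis i 1) (axis j 1) - p (axis i 1) (axis j 1)))
            \<le> cmod (q t (axis i 1) (axis j 1) - p (axis i 1) (axis j 1))"
            using n1[of i] by (simp add: norm_mult mult_left_le_one_le)
        qed auto
        then show "cmod (G $ j * (\<Sum>i\<in>UNIV. cnj (G $ i) * (q t (axis i 1) (axis j 1) - p (axis i 1) (axis j 1))))
          \<le> (\<Sum>i\<in>UNIV. cmod (q t (axis i 1) (axis j 1) - p (axis i 1) (axis j 1)))" by simp
      qed
      finally have "\<bar>Re (q t G G - p G G)\<bar> \<le> d t" using abs_Re_le_cmod order_trans by blast
      moreover have "Re (p F F) \<le> Re (p G G)" by (rule min[OF G])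
      ultimately show ?thesis using elim(2) by simp
    qed
    show ?case unfolding positive_on_def
    proof (intro ballI impI)
      fix G assume G: "G \<in> U" "G \<noteq> 0"
      have "(1 / norm G) *\<^sub>R G \<in> S" using G sub by (simp add: S_def subspace_scale)
      from sphere_pos[OF this] show "0 < Re (q t G G)"
        using G by (simp add: Re_hermitian_form_scaleR[OF elim(1)] zero_less_mult_iff)
    qed
  qed
qed

lemma vec_subspace_sum: "vec.subspace U \<Longrightarrow> vec.subspace W \<Longrightarrow> vec.subspace (subspace_sum U W)"
  unfolding subspace_sum_def by (rule vec.subspace_sums)

lemma dim_subspace_sum:
  assumes "vec.subspace U" "vec.subspace W" "U \<inter> W = {0}"
  shows "vec.dim (subspace_sum U W) = vec.dim U + vec.dim W"
  using vec.dim_sums_Int[OF assms(1,2)] assms(3) unfolding subspace_sum_def by simp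

lemma dim_add_le_if_disjoint:
  fixes U :: "(complex ^ 'n) set"
  assumes "vec.subspace U" "vec.subspace W" "U \<inter> W \<subseteq> {0}" "U \<subseteq> V" "W \<subseteq> V" "vec.subspace V"
  shows "vec.dim U + vec.dim W \<le> vec.dim V"
proof -
  have "U \<inter> W = {0}" using assms by (auto simp: vec.subspace_0)
  moreover have "subspace_sum U W \<subseteq> V"
    unfolding subspace_sum_def using assms by (auto intro: vec.subspace_add)
  ultimately show ?thesis
    using dim_subspace_sum[of U W] assms vec.dim_subset by metis
qed

lemma vec_projection_exists:
  fixes A :: "(complex ^ 'n) set"
  assumes "vec.subspace A"
  obtains \<pi> where "Vector_Spaces.linear (*s) (*s) \<pi>" "\<And>x. \<pi> x \<in> A" "\<And>x. x \<in> A \<Longrightarrow> \<pi> x = x"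
  using vec.linear_exists_left_inverse_on[OF vec.linear_id assms] by auto

lemma vec_subspace_null_space:
  assumes q: "hermitian_form q" and U: "vec.subspace U"
  shows "vec.subspace (null_space U q)"
  using U by (auto simp: null_space_def vec.subspace_def hermitian_form_simps[OF q])

text \<open>
  The equality case of the Cauchy--Schwarz inequality: if \<open>q G F\<close> were nonzero, moving from
  \<open>G\<close> along a suitable multiple of the isotropic vector \<open>F\<close> would change the value of the form linearly and
  eventually make it negative.
\<close>
lemma semidefinite_null:
  assumes q: "hermitian_form q" and U: "vec.subspace U"
    and nonneg: "\<And>F. F \<in> U \<Longrightarrow> 0 \<le> Re (q F F)" and F: "F \<in> U" "Re (q F F) = 0" and G: "G \<in> U"
  shows "q G F = 0"
proof (rule ccontr)
  assume nz: "q G F \<noteq> 0"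
  define b where "b = (cmod (q G F))\<^sup>2"
  have b: "b > 0" using nz by (simp add: b_def)
  define c where "c = Re (q G G)"
  have ineq: "0 \<le> c + 2 * t * b" for t :: real
  proof -
    define s where "s = of_real t * q F G"
    have "G + s *s F \<in> U" using F G U by (simp add: vec.subspace_add vec.subspace_scale)
    from nonneg[OF this] have "0 \<le> Re (q (G + s *s F) (G + s *s F))" .
    also have "q (G + s *s F) (G + s *s F) = q G G + s * q G F + cnj (s * q G F)"
      using F(2) hermitian_form_diag_real[OF q, of F] hermitian_form_cnj[OF q, of F G]
      by (simp add: hermitian_form_simps[OF q])
    also have "s * q G F = of_real (t * b)"
      unfolding s_def b_def hermitian_form_cnj[OF q, of F G]
      by (simp only: of_real_mult complex_norm_square mult_ac)
    finally show ?thesis by (simp add: c_def mult_ac add_ac)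
  qed
  from ineq[of "- (c + 1) / (2 * b)"] show False using b by (simp add: field_simps)
qed

text \<open>
  Peel off one negative vector \<open>u\<close> at a time: the subspace is the direct sum of the line through \<open>u\<close>
  and the \<open>q\<close>-orthogonal complement of \<open>u\<close>, whose dimension is smaller.
\<close>
lemma sylvester_splitting:
  assumes q: "hermitian_form q" and U: "vec.subspace U"
  shows "\<exists>W Z. vec.subspace W \<and> vec.subspace Z \<and> W \<inter> Z = {0} \<and> subspace_sum W Z = U \<and>
    positive_on W (\<lambda>G F. - q G F) \<and> (\<forall>F\<in>Z. 0 \<le> Re (q F F)) \<and> (\<forall>w\<in>W. \<forall>z\<in>Z. q w z = 0)"
  using U
proof (induction "vec.dim U" arbitrary: U rule: less_induct)
  case less
  show ?case
  proof (cases "\<forall>F\<in>U. 0 \<le> Re (q F F)")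
    case True
    then show ?thesis
      using less.prems vec.subspace_0[OF less.prems]
      by (intro exI[of _ "{0}"] exI[of _ U])
        (auto simp: subspace_sum_def positive_on_def hermitian_form_simps[OF q] vec.subspace_single_0)
  next
    case False
    then obtain u where u: "u \<in> U" "Re (q u u) < 0" by force
    define U' where "U' = {F \<in> U. q u F = 0}"
    have U': "vec.subspace U'"
      using less.prems unfolding U'_def vec.subspace_def by (auto simp: hermitian_form_simps[OF q])
    have quu: "q u u \<noteq> 0" using u(2) by auto
    have "u \<notin> U'" using quu by (simp add: U'_def)
    then have "U' \<subset> U" using u by (auto simp: U'_def)
    then have "vec.dim U' < vec.dim U"
      using vec.dim_psubset[of U' U] U' less.prems by (simp add: vec.span_eq_iff[THEN iffD2])
    from less.hyps[OF this U'] obtain W Z where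
      WZ: "vec.subspace W" "vec.subspace Z" "W \<inter> Z = {0}" "subspace_sum W Z = U'"
        "positive_on W (\<lambda>G F. - q G F)" "\<forall>F\<in>Z. 0 \<le> Re (q F F)" "\<forall>w\<in>W. \<forall>z\<in>Z. q w z = 0" by blast
    have WU: "W \<subseteq> U'" and ZU: "Z \<subseteq> U'"
      using WZ(4) vec.subspace_0[OF WZ(1)] vec.subspace_0[OF WZ(2)] unfolding subspace_sum_def by force+
    define W' where "W' = subspace_sum (range (\<lambda>c. c *s u)) W"
    have line: "vec.subspace (range (\<lambda>c. c *s u))"
      using vec.subspace_span[of "{u}"] by (simp add: vec.span_singleton)
    have W': "vec.subspace W'" unfolding W'_def by (intro vec_subspace_sum line WZ)
    have orth: "q w u = 0" if "w \<in> U'" for w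
      using that hermitian_form_cnj[OF q, of w u] by (simp add: U'_def)
    have val: "q (c *s u + w) (c *s u + w) = of_real ((cmod c)\<^sup>2) * q u u + q w w" if "w \<in> W" for c w
      using that WU orth[of w] unfolding U'_def
      by (auto simp: hermitian_form_simps[OF q] complex_norm_square mult_ac simp del: of_real_power)
    have neg: "positive_on W' (\<lambda>G F. - q G F)"
      unfolding positive_on_def
    proof (intro ballI impI)
      fix F assume F: "F \<in> W'" "F \<noteq> 0"
      then obtain c w where cw: "F = c *s u + w" "w \<in> W" by (auto simp: W'_def subspace_sum_def)
      have "Re (q w w) < 0" if "w \<noteq> 0" using WZ(5) cw(2) that by (auto simp: positive_on_def)
      moreover have "(cmod c)\<^sup>2 * Re (q u u) < 0" if "c \<noteq> 0" using u(2) that by (simp add: mult_pos_neg)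
      moreover have "w \<noteq> 0 \<or> c \<noteq> 0" using F cw by auto
      ultimately show "0 < Re (- q F F)"
        unfolding cw(1) val[OF cw(2)]
        by (cases "c = 0"; cases "w = 0") (auto simp: hermitian_form_simps[OF q] simp del: of_real_power)
    qed
    have sum: "subspace_sum W' Z = U"
    proof (intro equalityI subsetI)
      fix F assume "F \<in> subspace_sum W' Z"
      then show "F \<in> U"
        using WU ZU u less.prems unfolding subspace_sum_def W'_def U'_def
        by (force intro!: vec.subspace_add vec.subspace_scale)
    next
      fix F assume F: "F \<in> U"
      define c where "c = q u F / q u u"
      have "F - c *s u \<in> U'"
        using F u less.prems quu unfolding U'_def c_def
        by (auto simp: hermitian_form_simps[OF q] hermitian_form_diff[OF q]
            intro!: vec.subspace_diff vec.subspace_scale)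
      then obtain w z where wz: "F - c *s u = w + z" "w \<in> W" "z \<in> Z"
        using WZ(4) by (auto simp: subspace_sum_def)
      then have "F = (c *s u + w) + z"
        by (simp add: algebra_simps)
      then show "F \<in> subspace_sum W' Z" using wz unfolding subspace_sum_def W'_def by blast
    qed
    have "q w' z = 0" if "w' \<in> W'" "z \<in> Z" for w' z
      using that WZ(7) ZU unfolding W'_def subspace_sum_def U'_def
      by (auto simp: hermitian_form_simps[OF q] subset_iff)
    moreover have "W' \<inter> Z = {0}"
    proof -
      have "F = 0" if "F \<in> W'" "F \<in> Z" for F
        using neg WZ(6) that unfolding positive_on_def by force
      then show ?thesis using W' WZ(2) by (auto simp: vec.subspace_0)
    qed
    ultimately show ?thesis using W' WZ(2,6) neg sum by blast
  qed
qed

text \<open>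
  Sylvester's law of inertia, in the form needed for counting: the three dimensions exhaust that of
  \<open>V\<close>. The null space sits inside the semidefinite summand as its set of isotropic vectors, so any
  complement of it there is positive.
\<close>
lemma sylvester_inertia:
  assumes q: "hermitian_form q" and V: "vec.subspace V"
  obtains W Z where "vec.subspace W" "vec.subspace Z" "W \<subseteq> V" "Z \<subseteq> V"
    "positive_on W (\<lambda>G F. - q G F)" "positive_on Z q"
    "vec.dim W + vec.dim (null_space V q) + vec.dim Z = vec.dim V"
proof -
  obtain W N where WN: "vec.subspace W" "vec.subspace N" "W \<inter> N = {0}" "subspace_sum W N = V"
     "positive_on W (\<lambda>G F. - q G F)" "\<forall>F\<in>N. 0 \<le> Re (q F F)" "\<forall>w\<in>W. \<forall>z\<in>N. q w z = 0"
    using sylvester_splitting[OF q V] by blast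
  have NV: "N \<subseteq> V" and WV: "W \<subseteq> V"
    using WN(4) vec.subspace_0[OF WN(1)] vec.subspace_0[OF WN(2)] unfolding subspace_sum_def by force+
  let ?K = "null_space V q"
  have null: "F \<in> ?K \<longleftrightarrow> F \<in> N \<and> Re (q F F) = 0" for F
  proof
    assume F: "F \<in> ?K"
    then obtain w n where wn: "F = w + n" "w \<in> W" "n \<in> N"
      using WN(4) unfolding null_space_def subspace_sum_def by blast
    have "q w F = 0" using F wn WV by (auto simp: null_space_def)
    then have "q w w = 0" using wn WN(7) by (auto simp: hermitian_form_simps[OF q])
    then have "w = 0" using WN(5) wn(2) unfolding positive_on_def by force
    then show "F \<in> N \<and> Re (q F F) = 0" using F wn by (auto simp: null_space_def)
  next
    assume F: "F \<in> N \<and> Re (q F F) = 0"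
    have "q G F = 0" if G: "G \<in> V" for G
    proof -
      obtain w n where wn: "G = w + n" "w \<in> W" "n \<in> N" using G unfolding WN(4)[symmetric] subspace_sum_def by blast
      have "q n F = 0" using semidefinite_null[OF q WN(2), of F n] F wn WN(6) by blast
      then show ?thesis using wn WN(7) F by (auto simp: hermitian_form_simps[OF q])
    qed
    then show "F \<in> ?K" using F NV by (auto simp: null_space_def)
  qed
  have K: "vec.subspace ?K" by (rule vec_subspace_null_space[OF q V])
  obtain \<pi> where \<pi>: "Vector_Spaces.linear (*s) (*s) \<pi>" "\<And>x. \<pi> x \<in> ?K" "\<And>x. x \<in> ?K \<Longrightarrow> \<pi> x = x"
    using vec_projection_exists[OF K] by metis
  define Z where "Z = {z \<in> N. \<pi> z = 0}"
  interpret l: Vector_Spaces.linear "(*s)" "(*s)" \<pi> by (rule \<pi>(1))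
  have Z: "vec.subspace Z"
    using WN(2) unfolding Z_def vec.subspace_def by (auto simp: l.add l.scale l.zero)
  have KZ: "?K \<inter> Z = {0}" using \<pi>(3) vec.subspace_0[OF K] vec.subspace_0[OF Z] by (auto simp: Z_def)
  have "subspace_sum ?K Z = N"
  proof (intro equalityI subsetI)
    fix F assume "F \<in> subspace_sum ?K Z"
    then show "F \<in> N" unfolding subspace_sum_def Z_def using null WN(2) by (auto intro: vec.subspace_add)
  next
    fix F assume F: "F \<in> N"
    have "F - \<pi> F \<in> Z" using F null \<pi>(2,3) WN(2) by (auto simp: Z_def l.diff intro!: vec.subspace_diff)
    then show "F \<in> subspace_sum ?K Z" unfolding subspace_sum_def
      using \<pi>(2) by (intro CollectI exI[of _ "\<pi> F"] exI[of _ "F - \<pi> F"]) auto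
  qed
  then have "vec.dim N = vec.dim ?K + vec.dim Z" using dim_subspace_sum[OF K Z KZ] by simp
  moreover have "vec.dim V = vec.dim W + vec.dim N" using dim_subspace_sum[OF WN(1,2,3)] WN(4) by simp
  moreover have "positive_on Z q"
    unfolding positive_on_def
  proof (intro ballI impI)
    fix F assume F: "F \<in> Z" "F \<noteq> 0"
    then have "F \<notin> ?K" using KZ by auto
    then show "0 < Re (q F F)" using null[of F] F WN(6) unfolding Z_def by force
  qed
  moreover have "Z \<subseteq> V" using NV by (auto simp: Z_def)
  ultimately show thesis using that[OF WN(1) Z WV _ WN(5)] by simp
qed

section \<open>Null vectors of decreasing families of forms\<close>

text \<open>
  A family of forms that descends from a positive one: as \<open>\<mu>\<close> grows, the negative dimension never
  drops, and it rises past a parameter by exactly the nullity there.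
  The parameter stays below \<open>\<tau>\<close>; for the boundary forms of a graph this is where the first
  Dirichlet eigenvalue of an edge produces a pole.
\<close>
locale decreasing_pencil =
  fixes V :: "(complex ^ 'n) set" and Q :: "real \<Rightarrow> complex ^ 'n \<Rightarrow> complex ^ 'n \<Rightarrow> complex"
    and \<tau> \<mu>\<^sub>0 :: real
  assumes V: "vec.subspace V"
    and herm: "\<mu> < \<tau> \<Longrightarrow> hermitian_form (Q \<mu>)"
    and decreasing: "\<mu> < \<nu> \<Longrightarrow> \<nu> < \<tau> \<Longrightarrow> F \<noteq> 0 \<Longrightarrow> Re (Q \<nu> F F) < Re (Q \<mu> F F)"
    and continuous: "\<mu> < \<tau> \<Longrightarrow> ((\<lambda>\<nu>. Q \<nu> G F) \<longlongrightarrow> Q \<mu> G F) (at \<mu>)"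
    and start: "\<mu>\<^sub>0 < \<tau>" "positive_on V (Q \<mu>\<^sub>0)"
begin

definition mult :: "real \<Rightarrow> nat" where
  "mult \<mu> = vec.dim (null_space V (Q \<mu>))"

definition spectrum :: "real set" where
  "spectrum = {\<mu>. \<mu> < \<tau> \<and> 0 < mult \<mu>}"

lemma decreasing_le: "\<mu> \<le> \<nu> \<Longrightarrow> \<nu> < \<tau> \<Longrightarrow> Re (Q \<nu> F F) \<le> Re (Q \<mu> F F)"
proof (cases "F = 0")
  case True
  assume "\<mu> \<le> \<nu>" "\<nu> < \<tau>"
  then show ?thesis using True by (simp add: hermitian_form_simps[OF herm])
next
  case False
  assume "\<mu> \<le> \<nu>" "\<nu> < \<tau>"
  then show ?thesis using decreasing[of \<mu> \<nu> F] False by (cases "\<mu> = \<nu>") auto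
qed

text \<open>
  The null spaces for different parameters may overlap, so their plain sum is of no use. Passing
  through the parameters in increasing order avoids this: what has been collected
  so far is strictly negative at the next parameter and therefore meets the new null space only in zero.
\<close>
lemma nonpositive_subspace_exists:
  assumes "finite S" "S \<subseteq> {..a}" "a < \<tau>"
  shows "\<exists>U. vec.subspace U \<and> U \<subseteq> V \<and> vec.dim U = sum mult S \<and> (\<forall>F\<in>U. Re (Q a F F) \<le> 0)"
  using assms
proof (induction S arbitrary: a rule: finite_linorder_max_induct)
  case empty
  then show ?case
    using vec.subspace_0[OF V]
    by (intro exI[of _ "{0}"]) (auto simp: hermitian_form_simps[OF herm] vec.subspace_single_0)
next
  case (insert b A)
  have b: "b \<le> a" "b < \<tau>" using insert.prems by auto
  obtain c where c: "A \<subseteq> {..c}" "c < b"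
  proof (cases "A = {}")
    case True
    then show ?thesis using that[of "b - 1"] by auto
  next
    case False
    have "A \<subseteq> {..Max A}" using Max_ge[OF insert.hyps(1)] by blast
    moreover have "Max A < b" using False insert.hyps by simp
    ultimately show ?thesis by (rule that)
  qed
  obtain U where U: "vec.subspace U" "U \<subseteq> V" "vec.dim U = sum mult A"
      "\<And>F. F \<in> U \<Longrightarrow> Re (Q c F F) \<le> 0"
    using insert.IH[OF c(1)] c(2) b by auto
  define N where "N = null_space V (Q b)"
  have N: "vec.subspace N" unfolding N_def by (rule vec_subspace_null_space[OF herm[OF b(2)] V])
  have neg: "Re (Q b F F) < 0" if "F \<in> U" "F \<noteq> 0" for F
    using U(4)[OF that(1)] decreasing[OF c(2) b(2) that(2)] by simp
  have null: "Q b G F = 0" if "F \<in> N" "G \<in> V" for F G using that by (auto simp: N_def null_space_def)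
  have NV: "N \<subseteq> V" by (auto simp: N_def null_space_def)
  have "F = 0" if "F \<in> U" "F \<in> N" for F using neg[of F] null[of F F] that U(2) by force
  then have "U \<inter> N = {0}" using U(1) N by (auto simp: vec.subspace_0)
  then have "vec.dim (subspace_sum U N) = sum mult A + mult b"
    using dim_subspace_sum[OF U(1) N] U(3) by (simp add: mult_def N_def)
  moreover have "b \<notin> A" using insert.hyps by auto
  moreover have "Re (Q a F F) \<le> 0" if "F \<in> subspace_sum U N" for F
  proof -
    obtain u n where F: "F = u + n" "u \<in> U" "n \<in> N" using \<open>F \<in> subspace_sum U N\<close> by (auto simp: subspace_sum_def)
    have "u \<in> V" "n \<in> V" using F U(2) NV by auto
    have "Q b n u = 0" using null[OF F(3) \<open>u \<in> V\<close>] hermitian_form_cnj[OF herm[OF b(2)], of n u] by simp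
    then have "Q b F F = Q b u u"
      using null[OF F(3)] \<open>u \<in> V\<close> \<open>n \<in> V\<close> F by (simp add: hermitian_form_simps[OF herm[OF b(2)]])
    moreover have "Re (Q b u u) \<le> 0"
      using neg[OF F(2)] by (cases "u = 0") (auto simp: hermitian_form_simps[OF herm[OF b(2)]])
    ultimately show ?thesis using decreasing_le[OF b(1) insert.prems(2), of F] by simp
  qed
  moreover have "subspace_sum U N \<subseteq> V"
    unfolding subspace_sum_def using U(2) NV V by (auto intro: vec.subspace_add)
  ultimately show ?case
    using insert.hyps vec_subspace_sum[OF U(1) N] by (intro exI[of _ "subspace_sum U N"]) simp
qed

text \<open>
  The upper bound for the count: the nonpositive subspace just constructed cannot meet a positive one.
\<close>
lemma sum_mult_le_codim:
  assumes "finite S" "S \<subseteq> {..a}" "a < \<tau>" "vec.subspace Z" "Z \<subseteq> V" "positive_on Z (Q a)"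
  shows "sum mult S + vec.dim Z \<le> vec.dim V"
proof -
  obtain U where U: "vec.subspace U" "U \<subseteq> V" "vec.dim U = sum mult S"
      "\<And>F. F \<in> U \<Longrightarrow> Re (Q a F F) \<le> 0"
    using nonpositive_subspace_exists[OF assms(1-3)] by auto
  have "U \<inter> Z \<subseteq> {0}" using U(4) assms(6) by (force simp: positive_on_def)
  then show ?thesis using dim_add_le_if_disjoint[OF U(1) assms(4) _ U(2) assms(5) V] U(3) by simp
qed

lemma finite_spectrum:
  assumes "a < \<tau>" shows "finite (spectrum \<inter> {..a})"
proof (rule finite_if_finite_subsets_card_bdd[THEN conjunct1])
  fix S assume S: "S \<subseteq> spectrum \<inter> {..a}" "finite S"
  have "card S = sum (\<lambda>_. 1) S" by simp
  also have "\<dots> \<le> sum mult S" using S by (intro sum_mono) (force simp: spectrum_def)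
  also have "\<dots> \<le> vec.dim V"
    using sum_mult_le_codim[of S a "{0}"] S assms vec.subspace_0[OF V]
    by (auto simp: positive_on_def vec.subspace_single_0)
  finally show "card S \<le> vec.dim V" .
qed

text \<open>
  The lower bound for the count. Call a parameter bad if it has a negative subspace of dimension larger
  than the number of null vectors met before, and let \<open>s\<close> be the infimum of the bad parameters. It is
  not bad itself, since the subspace would have been negative slightly earlier already. Nor are there
  bad parameters immediately after \<open>s\<close>, since the positive part at \<open>s\<close> persists and leaves
  room for the null space at \<open>s\<close> only.
\<close>
lemma negative_dim_le_sum_mult:
  assumes a: "a < \<tau>" and U: "vec.subspace U" "U \<subseteq> V" "positive_on U (\<lambda>G F. - Q a G F)"
  shows "vec.dim U \<le> sum mult (spectrum \<inter> {..<a})"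
proof (rule ccontr)
  assume less: "\<not> vec.dim U \<le> sum mult (spectrum \<inter> {..<a})"
  define g where "g b = sum mult (spectrum \<inter> {..<b})" for b
  define neg where "neg b U \<longleftrightarrow> vec.subspace U \<and> U \<subseteq> V \<and> positive_on U (\<lambda>G F. - Q b G F)" for b U
  define B where "B = {b. b \<le> a \<and> (\<exists>U. neg b U \<and> g b < vec.dim U)}"
  have fin: "finite (spectrum \<inter> {..<b})" if "b \<le> a" for b
    by (rule finite_subset[OF _ finite_spectrum[OF a]]) (use that in auto)
  have "a \<in> B" using U less by (auto simp: B_def g_def neg_def not_le)
  have lower: "\<mu>\<^sub>0 \<le> b" if bB: "b \<in> B" for b
  proof (rule ccontr)
    assume "\<not> \<mu>\<^sub>0 \<le> b"
    then have b: "b \<le> \<mu>\<^sub>0" by simp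
    obtain U where U: "neg b U" "g b < vec.dim U" using bB by (auto simp: B_def)
    have "U \<subseteq> {0}"
    proof
      fix F assume F: "F \<in> U"
      show "F \<in> {0}"
      proof (rule ccontr)
        assume nz: "F \<notin> {0}"
        then have "Re (Q b F F) < 0" "0 < Re (Q \<mu>\<^sub>0 F F)"
          using F U start(2) by (auto simp: neg_def positive_on_def)
        then show False using decreasing_le[OF b start(1), of F] by simp
      qed
    qed
    then have "vec.dim U = 0" by simp
    then show False using U(2) by linarith
  qed
  have bdd: "bdd_below B" by (rule bdd_belowI) (rule lower)
  define s where "s = Inf B"
  have s_le: "s \<le> b" if "b \<in> B" for b unfolding s_def by (rule cInf_lower[OF that bdd])
  have sa: "s \<le> a" using s_le \<open>a \<in> B\<close> .
  then have st: "s < \<tau>" using a by simp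
  have herm_ev: "\<forall>\<^sub>F b in at s. hermitian_form (Q b)"
    using order_tendstoD(2)[OF tendsto_ident_at st] by eventually_elim (rule herm)
  show False
  proof (cases "s \<in> B")
    case True
    \<comment> \<open>Negativity is an open condition, so a bad \<open>s\<close> has bad parameters to its left.\<close>
    then obtain U where U: "neg s U" "g s < vec.dim U" by (auto simp: B_def)
    have "\<forall>\<^sub>F b in at s. positive_on U (\<lambda>G F. - Q b G F)"
    proof (rule positive_on_stable[where p = "\<lambda>G F. - Q s G F"])
      show "\<forall>\<^sub>F b in at s. hermitian_form (\<lambda>G F. - Q b G F)"
        using herm_ev by eventually_elim (rule hermitian_form_uminus)
    qed (use U st in \<open>auto simp: neg_def intro!: hermitian_form_uminus herm tendsto_intros continuous\<close>)
    then have "\<forall>\<^sub>F b in at_left s. positive_on U (\<lambda>G F. - Q b G F)"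
      by (rule filter_leD[rotated]) (simp add: at_le)
    moreover have "\<forall>\<^sub>F b in at_left s. b < s" by (simp add: eventually_at_filter)
    ultimately have "\<forall>\<^sub>F b in at_left s. b < s \<and> positive_on U (\<lambda>G F. - Q b G F)"
      by eventually_elim simp
    then obtain b where b: "b < s" "positive_on U (\<lambda>G F. - Q b G F)"
      using eventually_happens trivial_limit_at_left_real by blast
    have "g b \<le> g s" unfolding g_def using b(1) by (intro sum_mono2 fin sa) auto
    then have "b \<in> B" using U b sa unfolding B_def neg_def by force
    then show False using s_le b(1) by force
  next
    case False
    \<comment> \<open>Immediately to the right of \<open>s\<close> the dimension can grow by at most the nullity at \<open>s\<close>.\<close>
    obtain W Z where WZ: "vec.subspace W" "vec.subspace Z" "W \<subseteq> V" "Z \<subseteq> V"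
      "positive_on W (\<lambda>G F. - Q s G F)" "positive_on Z (Q s)"
      "vec.dim W + vec.dim (null_space V (Q s)) + vec.dim Z = vec.dim V"
      by (rule sylvester_inertia[OF herm[OF st] V])
    have W: "vec.dim W \<le> g s" using False WZ sa unfolding B_def neg_def by force
    have "\<forall>\<^sub>F b in at s. positive_on Z (Q b)"
      by (rule positive_on_stable[OF herm_ev herm[OF st] continuous[OF st] WZ(2,6)])
    then have "\<forall>\<^sub>F b in at_right s. positive_on Z (Q b)"
      by (rule filter_leD[rotated]) (simp add: at_le)
    then obtain c where c: "c > s" "\<And>b. s < b \<Longrightarrow> b < c \<Longrightarrow> positive_on Z (Q b)"
      unfolding eventually_at_right_field by blast
    obtain b where b: "b \<in> B" "b < c"
      using cInf_lessD[of B c] c(1) \<open>a \<in> B\<close> unfolding s_def by blast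
    have sb: "s < b" using s_le[OF b(1)] b(1) False by (cases "s = b") auto
    obtain U where U: "neg b U" "g b < vec.dim U" and ba: "b \<le> a" using b(1) by (auto simp: B_def)
    have "U \<inter> Z \<subseteq> {0}"
      using c(2)[OF sb b(2)] U(1) unfolding positive_on_def neg_def by force
    then have "vec.dim U + vec.dim Z \<le> vec.dim V"
      using U(1) WZ(2,4) V by (intro dim_add_le_if_disjoint) (auto simp: neg_def)
    then have "vec.dim U \<le> g s + mult s" using W WZ(7) by (simp add: mult_def)
    also have "\<dots> = sum mult (insert s (spectrum \<inter> {..<s}))"
      using fin[OF sa] by (simp add: g_def)
    also have "\<dots> = sum mult ((spectrum \<inter> {..<s}) \<union> (if s \<in> spectrum then {s} else {}))"
      using st fin[OF sa] by (auto simp: spectrum_def)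
    also have "\<dots> \<le> g b"
      unfolding g_def using sb by (intro sum_mono2 fin ba) auto
    finally show False using U(2) by simp
  qed
qed

end

section \<open>The equation $y'' = -\mu y$ and its boundary response\<close>

text \<open>
  The solutions of $y'' = -\mu y$ with initial data $(1,0)$ and $(0,1)$. They are entire in \<open>\<mu>\<close>, being
  $\cos(\sqrt\mu x)$ and $\sin(\sqrt\mu x)/\sqrt\mu$; the case distinction keeps them real-valued.
\<close>
definition osc_cos :: "real \<Rightarrow> real \<Rightarrow> real" where
  "osc_cos \<mu> x = (if \<mu> > 0 then cos (sqrt \<mu> * x) else if \<mu> = 0 then 1 else cosh (sqrt (- \<mu>) * x))"

definition osc_sin :: "real \<Rightarrow> real \<Rightarrow> real" where
  "osc_sin \<mu> x = (if \<mu> > 0 then sin (sqrt \<mu> * x) / sqrt \<mu> else if \<mu> = 0 then x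
     else sinh (sqrt (- \<mu>) * x) / sqrt (- \<mu>))"

lemma osc_0 [simp]: "osc_cos \<mu> 0 = 1" "osc_sin \<mu> 0 = 0"
  by (simp_all add: osc_cos_def osc_sin_def)

lemma osc_minus [simp]: "osc_cos \<mu> (- x) = osc_cos \<mu> x" "osc_sin \<mu> (- x) = - osc_sin \<mu> x"
  by (simp_all add: osc_cos_def osc_sin_def)

lemma osc_cos_deriv: "(osc_cos \<mu> has_real_derivative - \<mu> * osc_sin \<mu> x) (at x)"
proof -
  consider "\<mu> > 0" | "\<mu> = 0" | "\<mu> < 0" by linarith
  then show ?thesis
  proof cases
    case 1
    have "((\<lambda>x. cos (sqrt \<mu> * x)) has_real_derivative - \<mu> * (sin (sqrt \<mu> * x) / sqrt \<mu>)) (at x)"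
      by (rule derivative_eq_intros refl)+ (use 1 in \<open>simp add: field_simps\<close>)
    then show ?thesis using 1 by (simp add: osc_cos_def[abs_def] osc_sin_def[abs_def])
  next
    case 2
    then show ?thesis by (simp add: osc_cos_def[abs_def])
  next
    case 3
    define k where "k = sqrt (- \<mu>)"
    have k: "k > 0" "- \<mu> = k * k" using 3 by (simp_all add: k_def)
    have "((\<lambda>x. cosh (k * x)) has_real_derivative - \<mu> * (sinh (k * x) / k)) (at x)"
      unfolding k(2) by (rule derivative_eq_intros refl)+ (use k(1) in simp)
    then show ?thesis using 3 by (simp add: osc_cos_def[abs_def] osc_sin_def[abs_def] k_def)
  qed
qed

lemma osc_sin_deriv: "(osc_sin \<mu> has_real_derivative osc_cos \<mu> x) (at x)"
proof -
  consider "\<mu> > 0" | "\<mu> = 0" | "\<mu> < 0" by linarith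
  then show ?thesis
  proof cases
    case 1
    have "((\<lambda>x. sin (sqrt \<mu> * x) / sqrt \<mu>) has_real_derivative cos (sqrt \<mu> * x)) (at x)"
      by (rule derivative_eq_intros refl)+ (use 1 in \<open>simp_all add: field_simps\<close>)
    then show ?thesis using 1 by (simp add: osc_cos_def[abs_def] osc_sin_def[abs_def])
  next
    case 2
    then show ?thesis by (simp add: osc_cos_def[abs_def] osc_sin_def[abs_def])
  next
    case 3
    define k where "k = sqrt (- \<mu>)"
    have k: "k > 0" using 3 by (simp add: k_def)
    have "((\<lambda>x. sinh (k * x) / k) has_real_derivative cosh (k * x)) (at x)"
      by (rule derivative_eq_intros refl)+ (use k in simp_all)
    then show ?thesis using 3 by (simp add: osc_cos_def[abs_def] osc_sin_def[abs_def] k_def)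
  qed
qed

lemmas osc_derivs [derivative_intros] =
  DERIV_chain2[OF osc_cos_deriv] DERIV_chain2[OF osc_sin_deriv]

lemma osc_pythagoras: "(osc_cos \<mu> x)\<^sup>2 + \<mu> * (osc_sin \<mu> x)\<^sup>2 = 1"
  using cosh_square_eq[of "sqrt (- \<mu>) * x"]
  by (auto simp: osc_cos_def osc_sin_def power_divide field_simps)

lemma osc_cos_pos:
  assumes h: "\<mu> * h\<^sup>2 < (pi / 2)\<^sup>2" and x: "\<bar>x\<bar> \<le> h"
  shows "0 < osc_cos \<mu> x"
proof (cases "\<mu> > 0")
  case True
  have "sqrt \<mu> * h = sqrt (\<mu> * h\<^sup>2)" using x by (simp add: real_sqrt_mult)
  also have "\<dots> < pi / 2" using h by (intro real_less_lsqrt) auto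
  finally have "sqrt \<mu> * h < pi / 2" .
  moreover have "sqrt \<mu> * \<bar>x\<bar> \<le> sqrt \<mu> * h" using x True by (simp add: mult_left_mono)
  moreover have "\<bar>sqrt \<mu> * x\<bar> = sqrt \<mu> * \<bar>x\<bar>" using True by (simp add: abs_mult)
  ultimately have "\<bar>sqrt \<mu> * x\<bar> < pi / 2" by linarith
  then show ?thesis using True by (auto simp: osc_cos_def intro!: cos_gt_zero_pi)
qed (auto simp: osc_cos_def)

lemma osc_sin_strict_mono:
  assumes h: "\<mu> * h\<^sup>2 < (pi / 2)\<^sup>2" and x: "0 \<le> x" "x < y" "y \<le> h"
  shows "osc_sin \<mu> x < osc_sin \<mu> y"
  by (rule DERIV_pos_imp_increasing[OF x(2)])
    (use x h in \<open>auto intro!: exI osc_sin_deriv osc_cos_pos[where h=h]\<close>)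

lemma osc_sin_pos:
  assumes "\<mu> * h\<^sup>2 < (pi / 2)\<^sup>2" "0 < x" "x \<le> h"
  shows "0 < osc_sin \<mu> x"
  using osc_sin_strict_mono[OF assms(1), of 0 x] assms by simp

text \<open>
  On the interval $[-h,h]$, the solutions that are even or odd about the midpoint diagonalise the
  Dirichlet-to-Neumann map. For boundary values $(1,1)$ and $(-1,1)$ respectively, the
  outward derivative at $h$ is \<open>even_dtn \<mu> h\<close> or \<open>odd_dtn \<mu> h\<close>.
\<close>
definition even_dtn :: "real \<Rightarrow> real \<Rightarrow> real" where
  "even_dtn \<mu> h = - \<mu> * osc_sin \<mu> h / osc_cos \<mu> h"

definition odd_dtn :: "real \<Rightarrow> real \<Rightarrow> real" where
  "odd_dtn \<mu> h = osc_cos \<mu> h / osc_sin \<mu> h"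

lemma odd_dtn_pos:
  assumes "0 < h" "\<mu> * h\<^sup>2 < (pi / 2)\<^sup>2" shows "0 < odd_dtn \<mu> h"
  using osc_sin_pos[OF assms(2)] osc_cos_pos[OF assms(2), of h] assms(1) by (simp add: odd_dtn_def)

lemma even_dtn_eq: "even_dtn \<mu> h = - \<mu> / odd_dtn \<mu> h"
  by (simp add: even_dtn_def odd_dtn_def)

text \<open>
  The difference of the two quotients is the Wronskian of the odd solutions divided by the product of
  their end values, and the derivative of the Wronskian is
  $(\nu-\mu)$ times the product of these positive, increasing solutions. The mean value theorem gives
  both the sign and the Lipschitz constant $h$. The latter yields continuity in the
  parameter and, by comparison with $\mu = 0$, the asymptotics for short edges.
\<close>
lemma odd_dtn_diff_bounds:
  assumes h: "0 < h" and \<mu>\<nu>: "\<mu> < \<nu>" "\<nu> * h\<^sup>2 < (pi / 2)\<^sup>2"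
  shows "odd_dtn \<nu> h < odd_dtn \<mu> h" "odd_dtn \<mu> h - odd_dtn \<nu> h \<le> (\<nu> - \<mu>) * h"
proof -
  have \<mu>: "\<mu> * h\<^sup>2 < (pi / 2)\<^sup>2" using \<mu>\<nu> h by (smt (verit) mult_right_mono zero_le_power2)
  define W where "W x = osc_cos \<mu> x * osc_sin \<nu> x - osc_sin \<mu> x * osc_cos \<nu> x" for x
  have W': "(W has_real_derivative (\<nu> - \<mu>) * (osc_sin \<mu> x * osc_sin \<nu> x)) (at x)" for x
    unfolding W_def
    by (rule derivative_eq_intros refl)+ (simp add: algebra_simps)
  obtain z where z: "0 < z" "z < h" "W h - W 0 = (h - 0) * ((\<nu> - \<mu>) * (osc_sin \<mu> z * osc_sin \<nu> z))"
    using MVT2[OF h W'] by blast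
  define S where "S = osc_sin \<mu> h * osc_sin \<nu> h"
  have pos: "0 < osc_sin \<mu> z" "0 < osc_sin \<nu> z" "0 < osc_sin \<mu> h" "0 < osc_sin \<nu> h"
    using z h by (auto intro!: osc_sin_pos[OF \<mu>] osc_sin_pos[OF \<mu>\<nu>(2)])
  then have S: "0 < S" by (simp add: S_def)
  have le: "osc_sin \<mu> z * osc_sin \<nu> z \<le> S"
    unfolding S_def using z pos
    by (intro mult_mono less_imp_le[OF osc_sin_strict_mono[OF \<mu>]] less_imp_le[OF osc_sin_strict_mono[OF \<mu>\<nu>(2)]]) auto
  have diff: "odd_dtn \<mu> h - odd_dtn \<nu> h = W h / S"
    using pos by (simp add: odd_dtn_def W_def S_def field_simps)
  have W0: "W 0 = 0" by (simp add: W_def)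
  have "0 < W h" using z W0 h \<mu>\<nu> pos by simp
  then have "0 < W h / S" using S by simp
  then show "odd_dtn \<nu> h < odd_dtn \<mu> h" using diff by linarith
  have "W h \<le> h * ((\<nu> - \<mu>) * S)"
    using z(3) W0 le h \<mu>\<nu> by (simp add: mult_left_mono)
  then show "odd_dtn \<mu> h - odd_dtn \<nu> h \<le> (\<nu> - \<mu>) * h"
    unfolding diff using S by (simp add: field_simps)
qed

text \<open>
  The Wronskian argument again, now for the even solutions, which are positive on $[0,h]$.
\<close>
lemma even_dtn_strict_antimono:
  assumes h: "0 < h" and \<mu>\<nu>: "\<mu> < \<nu>" "\<nu> * h\<^sup>2 < (pi / 2)\<^sup>2"
  shows "even_dtn \<nu> h < even_dtn \<mu> h"
proof -
  have \<mu>: "\<mu> * h\<^sup>2 < (pi / 2)\<^sup>2" using \<mu>\<nu> h by (smt (verit) mult_right_mono zero_le_power2)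
  define W where "W x = \<nu> * (osc_sin \<nu> x * osc_cos \<mu> x) - \<mu> * (osc_sin \<mu> x * osc_cos \<nu> x)" for x
  have W': "(W has_real_derivative (\<nu> - \<mu>) * (osc_cos \<mu> x * osc_cos \<nu> x)) (at x)" for x
    unfolding W_def
    by (rule derivative_eq_intros refl)+ (simp add: algebra_simps)
  have cpos: "0 < osc_cos \<mu> x" "0 < osc_cos \<nu> x" if "0 \<le> x" "x \<le> h" for x
    using that osc_cos_pos[OF \<mu>, of x] osc_cos_pos[OF \<mu>\<nu>(2), of x] by auto
  have "W 0 < W h"
    by (rule DERIV_pos_imp_increasing[OF h]) (use W' cpos \<mu>\<nu> in \<open>auto intro!: exI\<close>)
  then show ?thesis using cpos[of h] h by (simp add: W_def even_dtn_def field_simps)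
qed

lemma odd_dtn_tendsto:
  assumes h: "0 < h" and \<mu>: "\<mu> * h\<^sup>2 < (pi / 2)\<^sup>2"
  shows "((\<lambda>\<nu>. odd_dtn \<nu> h) \<longlongrightarrow> odd_dtn \<mu> h) (at \<mu>)"
proof -
  have "((\<lambda>\<nu>. \<nu> * h\<^sup>2) \<longlongrightarrow> \<mu> * h\<^sup>2) (at \<mu>)" by (intro tendsto_intros)
  then have "\<forall>\<^sub>F \<nu> in at \<mu>. \<nu> * h\<^sup>2 < (pi / 2)\<^sup>2" using \<mu> by (rule order_tendstoD(2))
  then have "\<forall>\<^sub>F \<nu> in at \<mu>. norm (odd_dtn \<nu> h - odd_dtn \<mu> h) \<le> \<bar>\<nu> - \<mu>\<bar> * h"
  proof eventually_elim
    case (elim \<nu>)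
    show ?case
      using odd_dtn_diff_bounds[OF h, of \<mu> \<nu>] odd_dtn_diff_bounds[OF h, of \<nu> \<mu>] elim \<mu>
      by (cases \<mu> \<nu> rule: linorder_cases) auto
  qed
  moreover
  have "((\<lambda>\<nu>. \<bar>\<nu> - \<mu>\<bar> * h) \<longlongrightarrow> \<bar>\<mu> - \<mu>\<bar> * h) (at \<mu>)" by (intro tendsto_intros)
  then have "((\<lambda>\<nu>. \<bar>\<nu> - \<mu>\<bar> * h) \<longlongrightarrow> 0) (at \<mu>)" by simp
  ultimately have "((\<lambda>\<nu>. odd_dtn \<nu> h - odd_dtn \<mu> h) \<longlongrightarrow> 0) (at \<mu>)"
    by (rule Lim_null_comparison)
  then show ?thesis by (rule LIM_zero_cancel)
qed

lemma even_dtn_tendsto: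
  assumes h: "0 < h" and \<mu>: "\<mu> * h\<^sup>2 < (pi / 2)\<^sup>2"
  shows "((\<lambda>\<nu>. even_dtn \<nu> h) \<longlongrightarrow> even_dtn \<mu> h) (at \<mu>)"
  unfolding even_dtn_eq using odd_dtn_pos[OF assms]
  by (intro tendsto_intros odd_dtn_tendsto[OF assms]) auto

lemma odd_dtn_0: "odd_dtn 0 h = 1 / h"
  by (simp add: odd_dtn_def osc_cos_def osc_sin_def)

lemma eventually_small_window:
  fixes k :: real
  shows "\<forall>\<^sub>F \<epsilon> in at_right 0. \<mu> * (\<epsilon> * k)\<^sup>2 < (pi / 2)\<^sup>2"
proof -
  have "((\<lambda>\<epsilon>. \<mu> * (\<epsilon> * k)\<^sup>2) \<longlongrightarrow> \<mu> * (0 * k)\<^sup>2) (at_right 0)" by (intro tendsto_intros)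
  then show ?thesis by (rule order_tendstoD(2)) simp
qed

text \<open>
  The comparison value is $1/(\epsilon k)$, the response of the linear solution at $\mu = 0$.
\<close>
lemma odd_dtn_asymptotics:
  assumes k: "0 < k"
  shows "((\<lambda>\<epsilon>. \<epsilon> * odd_dtn \<mu> (\<epsilon> * k)) \<longlongrightarrow> 1 / k) (at_right 0)"
proof -
  have "\<forall>\<^sub>F \<epsilon> in at_right 0. norm (\<epsilon> * odd_dtn \<mu> (\<epsilon> * k) - 1 / k) \<le> \<epsilon> * (\<bar>\<mu>\<bar> * (\<epsilon> * k))"
    using eventually_small_window[of \<mu> k] eventually_at_right_less[of 0]
  proof eventually_elim
    case (elim \<epsilon>)
    define h where "h = \<epsilon> * k"
    have h: "0 < h" using elim k by (simp add: h_def)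
    have "\<bar>odd_dtn \<mu> h - 1 / h\<bar> \<le> \<bar>\<mu>\<bar> * h"
      using odd_dtn_diff_bounds[OF h, of \<mu> 0] odd_dtn_diff_bounds[OF h, of 0 \<mu>] elim h
      unfolding odd_dtn_0 h_def[symmetric]
      by (cases \<mu> "0 :: real" rule: linorder_cases) (auto simp: odd_dtn_0)
    moreover have "\<epsilon> * odd_dtn \<mu> h - 1 / k = \<epsilon> * (odd_dtn \<mu> h - 1 / h)"
      using elim k by (simp add: h_def field_simps)
    ultimately show ?case using elim by (simp add: h_def[symmetric] abs_mult)
  qed
  moreover
  have "((\<lambda>\<epsilon>. \<epsilon> * (\<bar>\<mu>\<bar> * (\<epsilon> * k))) \<longlongrightarrow> 0 * (\<bar>\<mu>\<bar> * (0 * k))) (at_right 0)"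
    by (intro tendsto_intros)
  then have "((\<lambda>\<epsilon>. \<epsilon> * (\<bar>\<mu>\<bar> * (\<epsilon> * k))) \<longlongrightarrow> 0) (at_right 0)" by simp
  ultimately have "((\<lambda>\<epsilon>. \<epsilon> * odd_dtn \<mu> (\<epsilon> * k) - 1 / k) \<longlongrightarrow> 0) (at_right 0)"
    by (rule Lim_null_comparison)
  then show ?thesis by (rule LIM_zero_cancel)
qed

lemma even_dtn_asymptotics:
  assumes k: "0 < k"
  shows "((\<lambda>\<epsilon>. even_dtn \<mu> (\<epsilon> * k) / \<epsilon>) \<longlongrightarrow> - \<mu> * k) (at_right 0)"
proof -
  have "((\<lambda>\<epsilon>. - \<mu> / (\<epsilon> * odd_dtn \<mu> (\<epsilon> * k))) \<longlongrightarrow> - \<mu> / (1 / k)) (at_right 0)"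
    using k by (intro tendsto_intros odd_dtn_asymptotics) auto
  then show ?thesis by (simp add: even_dtn_eq mult.commute)
qed

lemma even_dtn_at_bot:
  assumes h: "0 < h" shows "filterlim (\<lambda>\<mu>. even_dtn \<mu> h) at_top at_bot"
proof -
  have s: "filterlim (\<lambda>\<mu>. sqrt (- \<mu>)) at_top at_bot"
    by (intro filterlim_compose[OF sqrt_at_top] filterlim_uminus_at_top_at_bot)
  have "filterlim (\<lambda>\<mu>. sqrt (- \<mu>) * h) at_top at_bot"
    using s h by (subst mult.commute, intro filterlim_tendsto_pos_mult_at_top[OF tendsto_const h])
  then have "((\<lambda>\<mu>. tanh (sqrt (- \<mu>) * h)) \<longlongrightarrow> 1) at_bot"
    by (rule filterlim_compose[OF tanh_real_at_top])
  then have "filterlim (\<lambda>\<mu>. tanh (sqrt (- \<mu>) * h) * sqrt (- \<mu>)) at_top at_bot"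
    by (rule filterlim_tendsto_pos_mult_at_top[OF _ _ s]) simp
  then show ?thesis
  proof (rule filterlim_mono_eventually)
    show "\<forall>\<^sub>F \<mu> in at_bot. tanh (sqrt (- \<mu>) * h) * sqrt (- \<mu>) = even_dtn \<mu> h"
      using eventually_gt_at_bot[of 0]
    proof eventually_elim
      case (elim \<mu>)
      define k where "k = sqrt (- \<mu>)"
      have k: "k > 0" "- \<mu> = k * k" using elim by (simp_all add: k_def)
      have "even_dtn \<mu> h = - \<mu> * (sinh (k * h) / k) / cosh (k * h)"
        using elim by (simp add: even_dtn_def osc_cos_def osc_sin_def k_def)
      also have "\<dots> = tanh (k * h) * k"
        unfolding k(2) using k(1) by (simp add: tanh_def)
      finally show ?case by (simp add: k_def)
    qed
  qed auto
qed

text \<open>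
  By this, a lower bound for the even coefficients is one for all coefficients, so that only the even
  one has to be followed to $\mu \to -\infty$.
\<close>
lemma even_dtn_less_odd_dtn:
  assumes h: "0 < h" and \<mu>: "\<mu> * h\<^sup>2 < (pi / 2)\<^sup>2"
  shows "even_dtn \<mu> h < odd_dtn \<mu> h"
proof -
  have "odd_dtn \<mu> h - even_dtn \<mu> h = 1 / (osc_sin \<mu> h * osc_cos \<mu> h)"
    using osc_sin_pos[OF \<mu> h] osc_cos_pos[OF \<mu>, of h] h osc_pythagoras[of \<mu> h]
    by (simp add: odd_dtn_def even_dtn_def field_simps power2_eq_square)
  also have "\<dots> > 0" using osc_sin_pos[OF \<mu> h] osc_cos_pos[OF \<mu>, of h] h by simp
  finally show ?thesis by simp
qed

section \<open>Solutions on a single edge\<close>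

text \<open>
  The edge is centred at $h$, so that \<open>u\<close> and \<open>v\<close> are half the sum and half the difference of the
  values at its right and left ends. Outside the edge the function vanishes, as for every
  element of \<open>H2\<close>.
\<close>
definition edge_solution :: "real \<Rightarrow> real \<Rightarrow> complex \<Rightarrow> complex \<Rightarrow> real \<Rightarrow> complex" where
  "edge_solution \<mu> h u v x = (if x \<in> {0..2 * h} then
     u * of_real (osc_cos \<mu> (x - h) / osc_cos \<mu> h) + v * of_real (osc_sin \<mu> (x - h) / osc_sin \<mu> h) else 0)"

definition edge_solution_deriv :: "real \<Rightarrow> real \<Rightarrow> complex \<Rightarrow> complex \<Rightarrow> real \<Rightarrow> complex" where
  "edge_solution_deriv \<mu> h u v x =
     u * of_real (- \<mu> * osc_sin \<mu> (x - h) / osc_cos \<mu> h) + v * of_real (osc_cos \<mu> (x - h) / osc_sin \<mu> h)"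

lemma has_vector_derivative_of_real_within:
  assumes "(f has_real_derivative f') (at x)"
  shows "((\<lambda>x. of_real (f x) :: complex) has_vector_derivative of_real f') (at x within S)"
  by (rule has_vector_derivative_of_real[OF has_field_derivative_at_within[OF assms]])

lemma osc_cos_vector_derivative:
  "((\<lambda>x. of_real (osc_cos \<mu> (x - h)) :: complex) has_vector_derivative of_real (- \<mu> * osc_sin \<mu> (x - h))) (at x within S)"
  by (rule has_vector_derivative_of_real_within) (auto intro!: derivative_eq_intros)

lemma osc_sin_vector_derivative:
  "((\<lambda>x. of_real (osc_sin \<mu> (x - h)) :: complex) has_vector_derivative of_real (osc_cos \<mu> (x - h))) (at x within S)"
  by (rule has_vector_derivative_of_real_within) (auto intro!: derivative_eq_intros)

lemma deriv_on_eqI: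
  assumes "0 < L" "x \<in> {0..L}" "(f has_vector_derivative D) (at x within {0..L})"
  shows "deriv_on L f x = D"
  unfolding deriv_on_def
  using vector_derivative_within_cbox[of 0 L x f D] assms by simp

lemma set_lebesgue_integral_eq_integral_continuous:
  fixes g :: "real \<Rightarrow> complex"
  assumes "continuous_on {a..b} g"
  shows "(LINT t:{a..b}|lborel. g t) = integral {a..b} g"
  by (rule set_borel_integral_eq_integral(2)[OF borel_integrable_atLeastAtMost'[OF assms]])

lemma square_integrable_continuous:
  assumes "continuous_on {0..L} g" shows "square_integrable L g"
  unfolding square_integrable_def
proof
  show "set_borel_measurable lborel {0..L} g"
    using borel_integrable_atLeastAtMost'[OF assms]
    unfolding set_borel_measurable_def set_integrable_def by (rule borel_measurable_integrable)
  show "set_integrable lborel {0..L} (\<lambda>x. (cmod (g x))\<^sup>2)"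
    by (intro borel_integrable_atLeastAtMost' continuous_intros assms)
qed

context
  fixes \<mu> h L :: real
  assumes h: "0 < h" and window: "\<mu> * h\<^sup>2 < (pi / 2)\<^sup>2" and L: "L = 2 * h"
begin

lemma osc_nonzero: "osc_cos \<mu> h \<noteq> 0" "osc_sin \<mu> h \<noteq> 0"
  using osc_cos_pos[OF window, of h] osc_sin_pos[OF window, of h] h by auto

lemma edge_solution_boundary:
  "edge_solution \<mu> h u v 0 = u - v" "edge_solution \<mu> h u v L = u + v"
  using h osc_nonzero by (simp_all add: edge_solution_def L)

lemma edge_solution_has_vector_derivative:
  assumes "x \<in> {0..L}"
  shows "(edge_solution \<mu> h u v has_vector_derivative edge_solution_deriv \<mu> h u v x) (at x within {0..L})"
proof -
  have "((\<lambda>x. (u / of_real (osc_cos \<mu> h)) * of_real (osc_cos \<mu> (x - h)) + (v / of_real (osc_sin \<mu> h)) * of_real (osc_sin \<mu> (x - h)))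
    has_vector_derivative
     ((u / of_real (osc_cos \<mu> h)) * of_real (- \<mu> * osc_sin \<mu> (x - h)) + (v / of_real (osc_sin \<mu> h)) * of_real (osc_cos \<mu> (x - h)))) (at x within {0..L})"
    by (intro has_vector_derivative_add has_vector_derivative_mult_right osc_cos_vector_derivative osc_sin_vector_derivative)
  then have "((\<lambda>x. (u / of_real (osc_cos \<mu> h)) * of_real (osc_cos \<mu> (x - h)) + (v / of_real (osc_sin \<mu> h)) * of_real (osc_sin \<mu> (x - h)))
    has_vector_derivative edge_solution_deriv \<mu> h u v x) (at x within {0..L})"
    by (simp add: edge_solution_deriv_def)
  then show ?thesis
    by (rule has_vector_derivative_transform[rotated 2]) (use assms in \<open>auto simp: edge_solution_def L\<close>)
qed

lemma edge_solution_deriv_boundary: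
  "deriv_on L (edge_solution \<mu> h u v) 0 = - of_real (even_dtn \<mu> h) * u + of_real (odd_dtn \<mu> h) * v"
  "deriv_on L (edge_solution \<mu> h u v) L = of_real (even_dtn \<mu> h) * u + of_real (odd_dtn \<mu> h) * v"
proof -
  have "deriv_on L (edge_solution \<mu> h u v) x = edge_solution_deriv \<mu> h u v x" if "x \<in> {0..L}" for x
    using h L that by (intro deriv_on_eqI edge_solution_has_vector_derivative) auto
  then show
    "deriv_on L (edge_solution \<mu> h u v) 0 = - of_real (even_dtn \<mu> h) * u + of_real (odd_dtn \<mu> h) * v"
    "deriv_on L (edge_solution \<mu> h u v) L = of_real (even_dtn \<mu> h) * u + of_real (odd_dtn \<mu> h) * v"
    using h L by (simp_all add: edge_solution_deriv_def even_dtn_def odd_dtn_def mult_ac)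
qed

lemma continuous_on_edge_solution: "continuous_on {0..L} (edge_solution \<mu> h u v)"
  by (rule continuous_on_vector_derivative[OF edge_solution_has_vector_derivative])

lemma edge_solution_second_derivative:
  "second_derivative L (edge_solution \<mu> h u v) (\<lambda>x. - (of_real \<mu> * edge_solution \<mu> h u v x))"
  unfolding second_derivative_def
proof (intro conjI ballI)
  let ?f = "edge_solution \<mu> h u v" and ?g = "\<lambda>x. - (of_real \<mu> * edge_solution \<mu> h u v x)"
  have L0: "0 < L" using h L by simp
  have cont: "continuous_on {0..L} ?g"
    by (intro continuous_intros continuous_on_edge_solution)
  show "square_integrable L ?g" by (rule square_integrable_continuous[OF cont])
  fix x assume x: "x \<in> {0..L}"
  show "?f differentiable at x within {0..L}"
    using edge_solution_has_vector_derivative[OF x] by (rule differentiableI_vector)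
  have sub: "{0..x} \<subseteq> {0..L}" using x by auto
  have "(?g has_integral edge_solution_deriv \<mu> h u v x - edge_solution_deriv \<mu> h u v 0) {0..x}"
  proof (rule fundamental_theorem_of_calculus)
    fix y assume y: "y \<in> {0..x}"
    have "((\<lambda>x. - (u * of_real \<mu> / of_real (osc_cos \<mu> h)) * of_real (osc_sin \<mu> (x - h)) + (v / of_real (osc_sin \<mu> h)) * of_real (osc_cos \<mu> (x - h)))
      has_vector_derivative
       - (u * of_real \<mu> / of_real (osc_cos \<mu> h)) * of_real (osc_cos \<mu> (y - h)) + (v / of_real (osc_sin \<mu> h)) * of_real (- \<mu> * osc_sin \<mu> (y - h))) (at y within {0..x})"
      by (intro has_vector_derivative_add has_vector_derivative_mult_right osc_cos_vector_derivative osc_sin_vector_derivative)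
    moreover have "y \<in> {0..2 * h}" using y x L by auto
    ultimately show "(edge_solution_deriv \<mu> h u v has_vector_derivative ?g y) (at y within {0..x})"
      by (simp add: edge_solution_def edge_solution_deriv_def[abs_def] algebra_simps)
  qed (use x in auto)
  then have "integral {0..x} ?g = edge_solution_deriv \<mu> h u v x - edge_solution_deriv \<mu> h u v 0"
    by (rule integral_unique)
  moreover have "deriv_on L ?f y = edge_solution_deriv \<mu> h u v y" if "y \<in> {0..L}" for y
    by (rule deriv_on_eqI[OF L0 that edge_solution_has_vector_derivative[OF that]])
  ultimately show "deriv_on L ?f x = deriv_on L ?f 0 + (LINT t:{0..x}|lborel. ?g t)"
    using x L0 set_lebesgue_integral_eq_integral_continuous[OF continuous_on_subset[OF cont sub]]
    by simp
qed

lemma edge_solution_H2: "edge_solution \<mu> h u v \<in> H2 L"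
  using edge_solution_second_derivative by (auto simp: H2_def edge_solution_def L)

text \<open>
  The Wronskians of \<open>f\<close> with the two basic solutions are constant, and Pythagoras' identity for the
  basic solutions recovers \<open>f\<close> from these constants. The end values then determine them.
\<close>
lemma edge_solution_unique:
  assumes f: "f \<in> H2 L" "second_derivative L f (\<lambda>x. - (of_real \<mu> * f x))"
    and boundary: "f 0 = u - v" "f L = u + v"
  shows "f = edge_solution \<mu> h u v"
proof -
  let ?I = "{0..L}"
  let ?c = "\<lambda>x. of_real (osc_cos \<mu> (x - h)) :: complex" and ?s = "\<lambda>x. of_real (osc_sin \<mu> (x - h)) :: complex"
  have L0: "0 < L" using h L by simp
  define D where "D = deriv_on L f"
  have f': "(f has_vector_derivative D x) (at x within ?I)" if "x \<in> ?I" for x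
    using f(2) that unfolding second_derivative_def D_def deriv_on_def vector_derivative_works by blast
  have cont: "continuous_on ?I (\<lambda>x. - (of_real \<mu> * f x))"
    by (intro continuous_intros continuous_on_vector_derivative[OF f'])
  have D: "D x = D 0 + integral {0..x} (\<lambda>x. - (of_real \<mu> * f x))" if x: "x \<in> ?I" for x
  proof -
    have "continuous_on {0..x} (\<lambda>x. - (of_real \<mu> * f x))"
      by (rule continuous_on_subset[OF cont]) (use x in auto)
    note int = set_lebesgue_integral_eq_integral_continuous[OF this]
    show ?thesis
      using f(2) x unfolding second_derivative_def D_def int[symmetric] by blast
  qed
  have D': "(D has_vector_derivative - (of_real \<mu> * f x)) (at x within ?I)" if x: "x \<in> ?I" for x
  proof -
    have "((\<lambda>x. D 0 + integral {0..x} (\<lambda>x. - (of_real \<mu> * f x))) has_vector_derivative 0 + - (of_real \<mu> * f x)) (at x within ?I)"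
      by (intro has_vector_derivative_add has_vector_derivative_const integral_has_vector_derivative cont x)
    then have "((\<lambda>x. D 0 + integral {0..x} (\<lambda>x. - (of_real \<mu> * f x))) has_vector_derivative - (of_real \<mu> * f x)) (at x within ?I)"
      by simp
    then show ?thesis
      by (rule has_vector_derivative_transform[OF x, rotated]) (erule D)
  qed
  have "((\<lambda>x. D x * ?s x - f x * ?c x) has_vector_derivative 0) (at x within ?I)" if x: "x \<in> ?I" for x
    using has_vector_derivative_diff[OF has_vector_derivative_mult[OF D'[OF x] osc_sin_vector_derivative[of \<mu> h]]
      has_vector_derivative_mult[OF f'[OF x] osc_cos_vector_derivative[of \<mu> h]]]
    by (simp add: algebra_simps)
  then obtain U where U: "\<And>x. x \<in> ?I \<Longrightarrow> D x * ?s x - f x * ?c x = U"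
    using has_vector_derivative_zero_constant[of ?I "\<lambda>x. D x * ?s x - f x * ?c x"] by auto
  have "((\<lambda>x. D x * ?c x + of_real \<mu> * (f x * ?s x)) has_vector_derivative 0) (at x within ?I)" if x: "x \<in> ?I" for x
    using has_vector_derivative_add[OF has_vector_derivative_mult[OF D'[OF x] osc_cos_vector_derivative[of \<mu> h]]
      has_vector_derivative_mult_right[OF has_vector_derivative_mult[OF f'[OF x] osc_sin_vector_derivative[of \<mu> h]]], of "of_real \<mu>"]
    by (simp add: algebra_simps)
  then obtain W where W: "\<And>x. x \<in> ?I \<Longrightarrow> D x * ?c x + of_real \<mu> * (f x * ?s x) = W"
    using has_vector_derivative_zero_constant[of ?I "\<lambda>x. D x * ?c x + of_real \<mu> * (f x * ?s x)"] by auto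
  have sol: "f x = - U * ?c x + W * ?s x" if x: "x \<in> ?I" for x
  proof -
    have "- U * ?c x + W * ?s x = f x * of_real ((osc_cos \<mu> (x - h))\<^sup>2 + \<mu> * (osc_sin \<mu> (x - h))\<^sup>2)"
      unfolding U[OF x, symmetric] W[OF x, symmetric]
      by (simp add: algebra_simps power2_eq_square)
    then show ?thesis by (simp add: osc_pythagoras)
  qed
  have "u - v = - U * of_real (osc_cos \<mu> h) - W * of_real (osc_sin \<mu> h)"
    using sol[of 0] L0 boundary(1) by simp
  moreover have "u + v = - U * of_real (osc_cos \<mu> h) + W * of_real (osc_sin \<mu> h)"
    using sol[of L] L0 boundary(2) L by simp
  moreover have "u = ((u - v) + (u + v)) / 2" "v = ((u + v) - (u - v)) / 2" by simp_all
  ultimately have uv: "u = - U * of_real (osc_cos \<mu> h)" "v = W * of_real (osc_sin \<mu> h)" by simp_all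
  show ?thesis
  proof
    fix x show "f x = edge_solution \<mu> h u v x"
      using f(1) osc_nonzero sol[of x] unfolding uv
      by (auto simp: edge_solution_def H2_def L)
  qed
qed

end

section \<open>The vertex conditions in weak form\<close>

lemma hermitian_form_cinner: "hermitian_form cinner"
  by (rule hermitian_formI)
    (simp_all add: cinner_def sum.distrib sum_distrib_left algebra_simps)

lemmas cinner_simps = hermitian_form_simps[OF hermitian_form_cinner] hermitian_form_diff[OF hermitian_form_cinner]

lemma Re_cinner_self: "Re (cinner F F) = (norm F)\<^sup>2"
  unfolding cinner_def norm_vec_def L2_set_def
  by (simp add: sum_nonneg) (simp add: cmod_power2, simp add: power2_eq_square)

lemma cinner_self_eq_0: "cinner F F = 0 \<Longrightarrow> F = 0"
  using Re_cinner_self[of F] by simp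

lemma Re_cinner_eq_inner: "Re (cinner G F) = G \<bullet> F"
  unfolding cinner_def inner_vec_def by (simp add: inner_complex_def)

locale vertex_data =
  fixes PD PN PR :: "complex ^ 'n ^ 'n" and \<Lambda> :: "complex ^ 'n \<Rightarrow> complex ^ 'n"
  assumes proj: "orth_projector PD" "orth_projector PN" "orth_projector PR"
    and proj_sum: "PD + PN + PR = mat 1"
    and \<Lambda>: "invertible_selfadjoint_on (range ((*v) PR)) \<Lambda>"
begin

abbreviation "V \<equiv> {F. PD *v F = 0}"
abbreviation "q \<equiv> qform PR \<Lambda>"

lemma proj_idem: "PD *v (PD *v x) = PD *v x" "PN *v (PN *v x) = PN *v x" "PR *v (PR *v x) = PR *v x"
  using proj by (simp_all add: orth_projector_def matrix_vector_mul_assoc)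

lemma proj_adjoint:
  "cinner (PD *v x) y = cinner x (PD *v y)" "cinner (PN *v x) y = cinner x (PN *v y)"
  "cinner (PR *v x) y = cinner x (PR *v y)"
  using proj by (simp_all add: orth_projector_def)

lemma sum_of_projections: "x = PD *v x + PN *v x + PR *v x"
proof -
  have "(PD + PN + PR) *v x = x" by (simp add: proj_sum)
  then show ?thesis by (simp add: matrix_vector_mult_add_rdistrib)
qed

text \<open>
  Applied to vectors in the range of one projector, this Pythagorean identity makes the ranges
  mutually orthogonal.
\<close>
lemma norm_projections: "(norm x)\<^sup>2 = (norm (PD *v x))\<^sup>2 + (norm (PN *v x))\<^sup>2 + (norm (PR *v x))\<^sup>2"
proof -
  have "cinner x x = cinner x (PD *v x + PN *v x + PR *v x)" using sum_of_projections[of x] by simp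
  also have "\<dots> = cinner (PD *v x) (PD *v x) + cinner (PN *v x) (PN *v x) + cinner (PR *v x) (PR *v x)"
    by (simp add: cinner_simps proj_adjoint proj_idem)
  finally show ?thesis unfolding Re_cinner_self[symmetric] by simp
qed

lemma proj_orth: "PD *v (PN *v x) = 0" "PD *v (PR *v x) = 0" "PR *v (PN *v x) = 0"
  using norm_projections[of "PN *v x"] norm_projections[of "PR *v x"]
  by (simp_all add: proj_idem add_nonneg_eq_0_iff)

lemma vec_subspace_V: "vec.subspace V"
  by (auto simp: vec.subspace_def matrix_vector_right_distrib vector_scalar_commute)

lemma \<Lambda>_range: "PR *v (\<Lambda> (PR *v F)) = \<Lambda> (PR *v F)"
proof -
  have "\<Lambda> (PR *v F) \<in> range ((*v) PR)"
    using \<Lambda> unfolding invertible_selfadjoint_on_def bij_betw_def by blast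
  then show ?thesis by (auto simp: proj_idem)
qed

lemma hermitian_form_q: "hermitian_form q"
proof (rule hermitian_formI)
  note L = \<Lambda>[unfolded invertible_selfadjoint_on_def]
  fix G F F' :: "complex ^ 'n" and c
  have "\<Lambda> (PR *v (F + F')) = \<Lambda> (PR *v F) + \<Lambda> (PR *v F')"
    unfolding matrix_vector_right_distrib using L by blast
  then show "q G (F + F') = q G F + q G F'"
    by (simp add: qform_def matrix_vector_right_distrib cinner_simps)
  have "\<Lambda> (PR *v (c *s F)) = c *s \<Lambda> (PR *v F)"
    unfolding vector_scalar_commute using L by blast
  then show "q G (c *s F) = c * q G F"
    by (simp add: qform_def vector_scalar_commute cinner_simps)
  have "q F G = cinner (PR *v F) (\<Lambda> (PR *v G))" by (simp add: qform_def proj_adjoint)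
  also have "\<dots> = cinner (\<Lambda> (PR *v F)) (PR *v G)" using L by (metis rangeI)
  also have "\<dots> = cnj (cinner (PR *v G) (\<Lambda> (PR *v F)))" by (rule hermitian_form_cnj[OF hermitian_form_cinner])
  also have "\<dots> = cnj (q G F)" by (simp add: qform_def proj_adjoint)
  finally show "q F G = cnj (q G F)" .
qed

text \<open>
  Testing the weak identity with \<open>PN *v F'\<close> and with \<open>PR *v F' - \<Lambda> (PR *v F)\<close>, both in the kernel of
  \<open>PD\<close>, recovers the Neumann and Robin conditions.
\<close>
lemma vertex_conditions_iff:
  "(F, F') \<in> vertex_conditions PD PN PR \<Lambda> \<longleftrightarrow> F \<in> V \<and> (\<forall>G\<in>V. cinner G F' = q G F)"
proof
  assume "(F, F') \<in> vertex_conditions PD PN PR \<Lambda>"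
  then have *: "PD *v F = 0" "PN *v F' = 0" "PR *v F' = \<Lambda> (PR *v F)" by (auto simp: vertex_conditions_def)
  have "cinner G F' = q G F" if "G \<in> V" for G
  proof -
    have "cinner G F' = cinner G (PD *v F' + PN *v F' + PR *v F')" using sum_of_projections[of F'] by simp
    also have "\<dots> = cinner (PD *v G) F' + cinner G (PR *v F')" using * by (simp add: cinner_simps proj_adjoint)
    also have "\<dots> = q G F" using that * by (simp add: cinner_simps qform_def \<Lambda>_range)
    finally show ?thesis .
  qed
  then show "F \<in> V \<and> (\<forall>G\<in>V. cinner G F' = q G F)" using * by simp
next
  assume *: "F \<in> V \<and> (\<forall>G\<in>V. cinner G F' = q G F)"
  have "cinner (PN *v F') F' = q (PN *v F') F" using * by (simp add: proj_orth)
  also have "\<dots> = cinner (PR *v (PN *v F')) (\<Lambda> (PR *v F))" by (simp only: qform_def proj_adjoint(3))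
  also have "\<dots> = 0" by (simp add: proj_orth cinner_simps)
  finally have "cinner (PN *v F') (PN *v F') = 0" by (simp add: proj_adjoint proj_idem)
  then have N: "PN *v F' = 0" by (rule cinner_self_eq_0)
  define G where "G = PR *v F' - \<Lambda> (PR *v F)"
  have PRG: "PR *v G = G" by (simp add: G_def matrix_vector_mult_diff_distrib proj_idem \<Lambda>_range)
  have "PD *v G = 0" using proj_orth(2)[of G] PRG by simp
  then have "cinner G F' = q G F" using * by simp
  moreover have "cinner G F' = cinner G (PR *v F')" using proj_adjoint(3)[of G F'] PRG by simp
  ultimately have "cinner G G = 0" by (simp add: G_def[of] cinner_simps qform_def \<Lambda>_range)
  then have "G = 0" by (rule cinner_self_eq_0)
  then show "(F, F') \<in> vertex_conditions PD PN PR \<Lambda>" using N * by (simp add: vertex_conditions_def G_def)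
qed

end

lemma sum_endpoint:
  fixes f :: "'e::finite endpoint \<Rightarrow> 'a::comm_monoid_add"
  shows "(\<Sum>i\<in>UNIV. f i) = (\<Sum>e\<in>UNIV. f (Start e) + f (End e))"
proof -
  have "v \<in> range Start \<union> range End" for v :: "'e endpoint" by (cases v) auto
  then have U: "(UNIV :: 'e endpoint set) = range Start \<union> range End" by blast
  have "(\<Sum>i\<in>UNIV. f i) = sum f (range Start) + sum f (range End)"
    unfolding U by (rule sum.union_disjoint) auto
  then show ?thesis by (simp add: sum.reindex inj_def sum.distrib)
qed

lemma D0_orth_N0:
  assumes "F \<in> D0" "F' \<in> N0" shows "cinner F F' = 0"
  using assms unfolding cinner_def sum_endpoint by (simp add: D0_def N0_def)

lemma in_D0_if_orth_N0:
  fixes F :: "complex ^ 'e::finite endpoint"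
  assumes "\<And>F'. F' \<in> N0 \<Longrightarrow> F \<bullet> F' = 0" shows "F \<in> D0"
proof -
  define F' :: "complex ^ 'e endpoint" where
    "F' = (\<chi> v. case v of Start e \<Rightarrow> F $ Start e - F $ End e | End e \<Rightarrow> F $ End e - F $ Start e)"
  have "0 = F \<bullet> F'" by (rule assms[symmetric]) (simp add: F'_def N0_def)
  also have "\<dots> = (\<Sum>e\<in>UNIV. (F $ Start e - F $ End e) \<bullet> (F $ Start e - F $ End e))"
    unfolding inner_vec_def sum_endpoint by (simp add: F'_def algebra_simps inner_commute)
  finally show ?thesis by (simp add: D0_def sum_nonneg_eq_0_iff eq_commute[of 0])
qed

locale graph_vertex_data = vertex_data PD PN PR \<Lambda>
  for PD PN PR :: "complex ^ 'e::finite endpoint ^ 'e endpoint" and \<Lambda>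
begin

text \<open>
  One inclusion is the orthogonality of $D_0$ and $N_0$. For the other, decompose
  $y = P_R \Lambda P_R F$ along $N_0 + \mathrm{Ran}\,P_D$: the remainder lies in $\mathcal{F}_0$, where
  the hypothesis makes it orthogonal to $y$, so it is zero. The $N_0$ component of $y$ is the
  boundary derivative sought. Real orthogonality suffices throughout, because both summands are complex
  subspaces.
\<close>
lemma ProjE_eq:
  "ProjE (vertex_conditions PD PN PR \<Lambda> \<inter> (D0 \<times> N0)) = {F \<in> F0 PD. \<forall>G \<in> F0 PD. q G F = 0}"
proof (intro equalityI subsetI)
  fix F assume "F \<in> ProjE (vertex_conditions PD PN PR \<Lambda> \<inter> (D0 \<times> N0))"
  then obtain F' where F': "(F, F') \<in> vertex_conditions PD PN PR \<Lambda>" "F \<in> D0" "F' \<in> N0"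
    by (auto simp: ProjE_def)
  note v = F'(1)[unfolded vertex_conditions_iff]
  have "q G F = 0" if "G \<in> F0 PD" for G
    using that v D0_orth_N0[of G F'] F'(3) by (simp add: F0_def)
  then show "F \<in> {F \<in> F0 PD. \<forall>G \<in> F0 PD. q G F = 0}" using v F' by (simp add: F0_def)
next
  fix F assume F: "F \<in> {F \<in> F0 PD. \<forall>G \<in> F0 PD. q G F = 0}"
  define y where "y = PR *v (\<Lambda> (PR *v F))"
  define S where "S = {a + PD *v b | a b. a \<in> (N0 :: (complex ^ 'e endpoint) set)}"
  have "subspace S"
    unfolding subspace_def
  proof (intro conjI ballI allI)
    show "0 \<in> S" unfolding S_def by (rule CollectI, rule exI[of _ 0], rule exI[of _ 0]) (simp add: N0_def)
  next
    fix x y assume "x \<in> S" "y \<in> S"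
    then obtain a b a' b' where "x = a + PD *v b" "a \<in> N0" "y = a' + PD *v b'" "a' \<in> N0" by (auto simp: S_def)
    then show "x + y \<in> S" unfolding S_def
      by (intro CollectI exI[of _ "a + a'"] exI[of _ "b + b'"]) (simp add: matrix_vector_right_distrib N0_def)
  next
    fix c :: real and x assume "x \<in> S"
    then obtain a b where "x = a + PD *v b" "a \<in> N0" by (auto simp: S_def)
    then show "c *\<^sub>R x \<in> S" unfolding S_def
      by (intro CollectI exI[of _ "c *\<^sub>R a"] exI[of _ "c *\<^sub>R b"])
        (simp add: scaleR_eq_vector_smult vector_scalar_commute vec.scale_right_distrib N0_def)
  qed
  then have span: "span S = S" by simp
  obtain s z where sz: "s \<in> span S" "\<And>w. w \<in> span S \<Longrightarrow> orthogonal z w" "y = s + z"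
    using orthogonal_subspace_decomp_exists[of S y] by metis
  have orth: "z \<bullet> w = 0" if "w \<in> S" for w using sz(2) that by (auto simp: span orthogonal_def)
  obtain a b where ab: "s = a + PD *v b" "a \<in> N0" using sz(1) unfolding span by (auto simp: S_def)
  have "z \<in> D0"
  proof (rule in_D0_if_orth_N0)
    fix F' :: "complex ^ 'e endpoint" assume "F' \<in> N0"
    then have "F' \<in> S" unfolding S_def by (intro CollectI exI[of _ F'] exI[of _ 0]) simp
    then show "z \<bullet> F' = 0" by (rule orth)
  qed
  moreover have "PD *v z = 0"
  proof -
    have "0 + PD *v z \<in> S" unfolding S_def by (intro CollectI exI[of _ 0] exI[of _ z]) (simp add: N0_def)
    then have "Re (cinner z (PD *v z)) = 0" using orth by (simp add: Re_cinner_eq_inner)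
    also have "cinner z (PD *v z) = cinner (PD *v z) (PD *v z)" by (simp add: proj_adjoint proj_idem)
    finally show ?thesis by (simp add: Re_cinner_self)
  qed
  ultimately have z: "z \<in> F0 PD" by (simp add: F0_def)
  then have "z \<bullet> y = 0" using F by (simp add: qform_def y_def Re_cinner_eq_inner[symmetric])
  moreover have "z \<bullet> s = 0" using orth sz(1) by (simp add: span)
  ultimately have "z = 0" using sz(3) by (simp add: inner_add_right)
  then have y: "y = a + PD *v b" using sz(3) ab(1) by simp
  have "cinner G a = q G F" if "G \<in> V" for G
  proof -
    have "q G F = cinner G a + cinner (PD *v G) b"
      by (simp add: qform_def y_def[symmetric] y cinner_simps proj_adjoint)
    then show ?thesis using that by (simp add: cinner_simps)
  qed
  then have "(F, a) \<in> vertex_conditions PD PN PR \<Lambda>"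
    using F by (simp add: vertex_conditions_iff F0_def)
  then show "F \<in> ProjE (vertex_conditions PD PN PR \<Lambda> \<inter> (D0 \<times> N0))"
    using F ab(2) by (force simp: ProjE_def F0_def)
qed

end

section \<open>Eigenfunctions in terms of boundary values\<close>

definition even_part :: "complex ^ 'e::finite endpoint \<Rightarrow> 'e \<Rightarrow> complex" where
  "even_part F e = (F $ Start e + F $ End e) / 2"

definition odd_part :: "complex ^ 'e::finite endpoint \<Rightarrow> 'e \<Rightarrow> complex" where
  "odd_part F e = (F $ End e - F $ Start e) / 2"

lemma part_simps [simp]:
  "even_part (F + G) e = even_part F e + even_part G e" "odd_part (F + G) e = odd_part F e + odd_part G e"
  "even_part (c *s F) e = c * even_part F e" "odd_part (c *s F) e = c * odd_part F e"
  "even_part F e - odd_part F e = F $ Start e" "even_part F e + odd_part F e = F $ End e"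
  by (simp_all add: even_part_def odd_part_def field_simps)

text \<open>
  The general Hermitian form that is diagonal in the even and odd parts on each edge. The factor 2
  comes from summing over the two ends of the edge.
\<close>
definition edge_form :: "('e::finite \<Rightarrow> real) \<Rightarrow> ('e \<Rightarrow> real) \<Rightarrow> complex ^ 'e endpoint \<Rightarrow> complex ^ 'e endpoint \<Rightarrow> complex" where
  "edge_form a b G F = (\<Sum>e\<in>UNIV. of_real (2 * a e) * (cnj (even_part G e) * even_part F e) +
     of_real (2 * b e) * (cnj (odd_part G e) * odd_part F e))"

lemma hermitian_form_edge_form: "hermitian_form (edge_form a b)"
  by (rule hermitian_formI)
    (simp_all add: edge_form_def sum.distrib sum_distrib_left algebra_simps)

lemma Re_edge_form:
  "Re (edge_form a b F F) = (\<Sum>e\<in>UNIV. 2 * a e * (cmod (even_part F e))\<^sup>2 + 2 * b e * (cmod (odd_part F e))\<^sup>2)"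
  unfolding edge_form_def Re_sum
  by (intro sum.cong refl) (simp add: cmod_power2, simp add: power2_eq_square algebra_simps)

lemma even_odd_nonzero:
  fixes F :: "complex ^ 'e::finite endpoint"
  assumes "F \<noteq> 0" obtains e where "even_part F e \<noteq> 0 \<or> odd_part F e \<noteq> 0"
proof -
  have "F = 0" if "\<And>e. even_part F e = 0 \<and> odd_part F e = 0"
  proof (subst vec_eq_iff, rule allI)
    fix v show "F $ v = 0 $ v"
      using that[of "case v of Start e \<Rightarrow> e | End e \<Rightarrow> e"]
        part_simps(5,6)[of F "case v of Start e \<Rightarrow> e | End e \<Rightarrow> e"]
      by (cases v) (simp_all del: part_simps)
  qed
  then show thesis using assms that by blast
qed

lemma edge_form_strict_mono:
  assumes "F \<noteq> 0" "\<And>e. a e < a' e" "\<And>e. b e < b' e"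
  shows "Re (edge_form a b F F) < Re (edge_form a' b' F F)"
proof -
  obtain e where e: "even_part F e \<noteq> 0 \<or> odd_part F e \<noteq> 0" by (rule even_odd_nonzero[OF assms(1)])
  show ?thesis unfolding Re_edge_form
  proof (rule sum_strict_mono_ex1)
    show "\<forall>e\<in>UNIV. 2 * a e * (cmod (even_part F e))\<^sup>2 + 2 * b e * (cmod (odd_part F e))\<^sup>2
      \<le> 2 * a' e * (cmod (even_part F e))\<^sup>2 + 2 * b' e * (cmod (odd_part F e))\<^sup>2"
      using less_imp_le[OF assms(2)] less_imp_le[OF assms(3)]
      by (intro ballI add_mono mult_right_mono) auto
    have "2 * a e * (cmod (even_part F e))\<^sup>2 + 2 * b e * (cmod (odd_part F e))\<^sup>2
      < 2 * a' e * (cmod (even_part F e))\<^sup>2 + 2 * b' e * (cmod (odd_part F e))\<^sup>2"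
    proof (cases "even_part F e = 0")
      case True
      then show ?thesis using e assms(3)[of e] by simp
    next
      case False
      then show ?thesis
        using assms(2)[of e] less_imp_le[OF assms(3)[of e]]
        by (intro add_less_le_mono mult_strict_right_mono mult_right_mono) auto
    qed
    then show "\<exists>e\<in>UNIV. 2 * a e * (cmod (even_part F e))\<^sup>2 + 2 * b e * (cmod (odd_part F e))\<^sup>2
      < 2 * a' e * (cmod (even_part F e))\<^sup>2 + 2 * b' e * (cmod (odd_part F e))\<^sup>2" by blast
  qed simp
qed

definition edge_solutions :: "('e::finite \<Rightarrow> real) \<Rightarrow> real \<Rightarrow> complex ^ 'e endpoint \<Rightarrow> 'e \<Rightarrow> real \<Rightarrow> complex" where
  "edge_solutions h \<mu> F = (\<lambda>e. edge_solution \<mu> (h e) (even_part F e) (odd_part F e))"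

text \<open>
  The bound says that \<open>\<mu>\<close> lies below $(\pi/(2h_e))^2$, the first Dirichlet eigenvalue of an edge of
  length $2h_e$.
\<close>
definition window :: "('e::finite \<Rightarrow> real) \<Rightarrow> real \<Rightarrow> bool" where
  "window h \<mu> \<longleftrightarrow> (\<forall>e. 0 < h e \<and> \<mu> * (h e)\<^sup>2 < (pi / 2)\<^sup>2)"

lemma window_edge: "window h \<mu> \<Longrightarrow> 0 < h e" "window h \<mu> \<Longrightarrow> \<mu> * (h e)\<^sup>2 < (pi / 2)\<^sup>2"
  by (simp_all add: window_def)

definition dtn_form :: "('e::finite \<Rightarrow> real) \<Rightarrow> real \<Rightarrow> complex ^ 'e endpoint \<Rightarrow> complex ^ 'e endpoint \<Rightarrow> complex" where
  "dtn_form h \<mu> = edge_form (\<lambda>e. even_dtn \<mu> (h e)) (\<lambda>e. odd_dtn \<mu> (h e))"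

lemma bvalue_edge_solutions:
  assumes "window h \<mu>"
  shows "bvalue (\<lambda>e. 2 * h e) (edge_solutions h \<mu> F) = F"
proof (subst vec_eq_iff, rule allI)
  fix v show "bvalue (\<lambda>e. 2 * h e) (edge_solutions h \<mu> F) $ v = F $ v"
    by (cases v) (simp_all add: bvalue_def edge_solutions_def edge_solution_boundary[OF window_edge[OF assms] refl])
qed

lemma cinner_bderiv_edge_solutions:
  assumes "window h \<mu>"
  shows "cinner G (bderiv (\<lambda>e. 2 * h e) (edge_solutions h \<mu> F)) = - dtn_form h \<mu> G F"
  unfolding cinner_def sum_endpoint dtn_form_def edge_form_def sum_negf[symmetric]
proof (intro sum.cong refl)
  fix e
  have G: "G $ Start e = even_part G e - odd_part G e" "G $ End e = even_part G e + odd_part G e" by simp_all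
  show "cnj (G $ Start e) * bderiv (\<lambda>e. 2 * h e) (edge_solutions h \<mu> F) $ Start e +
     cnj (G $ End e) * bderiv (\<lambda>e. 2 * h e) (edge_solutions h \<mu> F) $ End e =
     - (of_real (2 * even_dtn \<mu> (h e)) * (cnj (even_part G e) * even_part F e) +
        of_real (2 * odd_dtn \<mu> (h e)) * (cnj (odd_part G e) * odd_part F e))"
    unfolding G
    by (simp add: bderiv_def edge_solutions_def edge_solution_deriv_boundary[OF window_edge[OF assms] refl]
        del: part_simps) (simp add: algebra_simps del: part_simps)
qed

lemma edge_solutions_linear:
  "edge_solutions h \<mu> (F + G) = edge_solutions h \<mu> F + edge_solutions h \<mu> G"
  "edge_solutions h \<mu> (c *s F) = fscale c (edge_solutions h \<mu> F)"
  by (auto simp: edge_solutions_def edge_solution_def fscale_def fun_eq_iff algebra_simps add_divide_distrib)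

context graph_vertex_data
begin

text \<open>
  This is $q[G,F] - \langle G, F'\rangle$ with $F'$ the boundary derivative of the solution with
  boundary values $F$, by \<open>cinner_bderiv_edge_solutions\<close>. Its vanishing for all $G$ in the kernel
  of $P_D$ is the weak form of the vertex conditions.
\<close>
definition boundary_form :: "('e \<Rightarrow> real) \<Rightarrow> real \<Rightarrow> complex ^ 'e endpoint \<Rightarrow> complex ^ 'e endpoint \<Rightarrow> complex" where
  "boundary_form h \<mu> G F = q G F + dtn_form h \<mu> G F"

lemma hermitian_form_boundary_form: "hermitian_form (boundary_form h \<mu>)"
  unfolding boundary_form_def[abs_def] dtn_form_def
  by (intro hermitian_form_add hermitian_form_q hermitian_form_edge_form)

lemma edge_solutions_in_eigenspace_iff:
  assumes w: "window h \<mu>"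
  shows "edge_solutions h \<mu> F \<in> eigenspace (graph_operator (\<lambda>e. 2 * h e) (vertex_conditions PD PN PR \<Lambda>)) (of_real \<mu>)
    \<longleftrightarrow> F \<in> null_space V (boundary_form h \<mu>)"
proof -
  let ?\<psi> = "edge_solutions h \<mu> F" and ?L = "\<lambda>e. 2 * h e"
  have "?\<psi> e \<in> H2 (?L e)" for e
    using edge_solution_H2[OF window_edge[OF w] refl] by (simp add: edge_solutions_def)
  moreover have "second_derivative (?L e) (?\<psi> e) (\<lambda>x. - fscale (of_real \<mu>) ?\<psi> e x)" for e
    using edge_solution_second_derivative[OF window_edge[OF w] refl] by (simp add: edge_solutions_def fscale_def)
  ultimately have "?\<psi> \<in> eigenspace (graph_operator ?L (vertex_conditions PD PN PR \<Lambda>)) (of_real \<mu>) \<longleftrightarrow>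
    (F, bderiv ?L ?\<psi>) \<in> vertex_conditions PD PN PR \<Lambda>"
    by (simp add: eigenspace_def graph_operator_def graph_domain_def bvalue_edge_solutions[OF w])
  also have "\<dots> \<longleftrightarrow> F \<in> null_space V (boundary_form h \<mu>)"
    unfolding vertex_conditions_iff cinner_bderiv_edge_solutions[OF w]
    by (auto simp: null_space_def boundary_form_def minus_equation_iff[of "dtn_form h \<mu> _ F"] add_eq_0_iff)
  finally show ?thesis .
qed

lemma eigenspace_eq_edge_solutions:
  assumes w: "window h \<mu>"
  shows "eigenspace (graph_operator (\<lambda>e. 2 * h e) (vertex_conditions PD PN PR \<Lambda>)) (of_real \<mu>) =
    edge_solutions h \<mu> ` null_space V (boundary_form h \<mu>)" (is "?E = _")
proof (intro equalityI subsetI)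
  fix f assume f: "f \<in> ?E"
  define F where "F = bvalue (\<lambda>e. 2 * h e) f"
  have "f = edge_solutions h \<mu> F"
  proof
    fix e
    have "f e \<in> H2 (2 * h e)" "second_derivative (2 * h e) (f e) (\<lambda>x. - (of_real \<mu> * f e x))"
      using f by (auto simp: eigenspace_def graph_operator_def graph_domain_def fscale_def)
    moreover have "f e 0 = even_part F e - odd_part F e" "f e (2 * h e) = even_part F e + odd_part F e"
      by (simp_all add: F_def bvalue_def)
    ultimately show "f e = edge_solutions h \<mu> F e"
      unfolding edge_solutions_def by (rule edge_solution_unique[OF window_edge[OF w] refl])
  qed
  then show "f \<in> edge_solutions h \<mu> ` null_space V (boundary_form h \<mu>)"
    using f edge_solutions_in_eigenspace_iff[OF w, of F] by auto
next
  fix f assume "f \<in> edge_solutions h \<mu> ` null_space V (boundary_form h \<mu>)"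
  then show "f \<in> ?E" using edge_solutions_in_eigenspace_iff[OF w] by auto
qed

lemma eigenvalue_mult_eq:
  assumes w: "window h \<mu>"
  shows "eigenvalue_mult (graph_operator (\<lambda>e. 2 * h e) (vertex_conditions PD PN PR \<Lambda>)) \<mu> =
    vec.dim (null_space V (boundary_form h \<mu>))"
proof -
  interpret fs: vector_space "fscale :: complex \<Rightarrow> ('e \<Rightarrow> real \<Rightarrow> complex) \<Rightarrow> _" by (rule vector_space_fscale)
  interpret fs: finite_dimensional_vector_space_pair_1 "(*s)" "cart_basis :: (complex ^ 'e endpoint) set"
    "fscale :: complex \<Rightarrow> ('e \<Rightarrow> real \<Rightarrow> complex) \<Rightarrow> _" ..
  have "Vector_Spaces.linear (*s) fscale (edge_solutions h \<mu>)"
    by unfold_locales (simp_all add: edge_solutions_linear)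
  moreover have "inj_on (edge_solutions h \<mu>) X" for X
    by (metis bvalue_edge_solutions[OF w] inj_onI)
  ultimately show ?thesis
    unfolding eigenvalue_mult_def eigenspace_eq_edge_solutions[OF w] by (rule fs.dim_image_eq)
qed

lemma eigenvalues_iff:
  assumes w: "window h \<mu>"
  shows "\<mu> \<in> eigenvalues (graph_operator (\<lambda>e. 2 * h e) (vertex_conditions PD PN PR \<Lambda>)) \<longleftrightarrow>
    (\<exists>F \<in> null_space V (boundary_form h \<mu>). F \<noteq> 0)"
proof -
  have "edge_solutions h \<mu> F = 0 \<longleftrightarrow> F = 0" for F
  proof
    assume "edge_solutions h \<mu> F = 0"
    then have "bvalue (\<lambda>e. 2 * h e) (edge_solutions h \<mu> F) = 0"
      by (simp add: bvalue_def vec_eq_iff split: endpoint.splits)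
    then show "F = 0" by (simp add: bvalue_edge_solutions[OF w])
  qed (auto simp: edge_solutions_def edge_solution_def fun_eq_iff even_part_def odd_part_def)
  then show ?thesis unfolding eigenvalues_def mem_Collect_eq eigenspace_eq_edge_solutions[OF w] by auto
qed

end

section \<open>Eigenvalue counts and limits of eigenvalues\<close>

text \<open>
  The constant comes from stability of positivity: for small \<open>t\<close> the form \<open>t q\<close> plus the unit edge form
  is still positive, and division by \<open>t\<close> gives the claim.
\<close>
lemma large_edge_form_dominates:
  fixes q :: "complex ^ 'e::finite endpoint \<Rightarrow> complex ^ 'e endpoint \<Rightarrow> complex"
  assumes q: "hermitian_form q"
  obtains C where "\<And>a b. (\<And>e. C < a e) \<Longrightarrow> (\<And>e. C < b e) \<Longrightarrow>
    positive_on UNIV (\<lambda>G F. q G F + edge_form a b G F)"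
proof -
  let ?I = "edge_form (\<lambda>_ :: 'e. 1) (\<lambda>_. 1)"
  have q': "hermitian_form (\<lambda>G F. of_real t * q G F + ?I G F)" for t
    by (intro hermitian_form_add hermitian_form_scale q hermitian_form_edge_form)
  have lim: "((\<lambda>t. of_real t * q G F + ?I G F) \<longlongrightarrow> ?I G F) (at_right 0)" for G F
    by (rule tendsto_eq_intros refl)+ auto
  have pos: "positive_on UNIV ?I"
    unfolding positive_on_def
  proof (intro ballI impI)
    fix F :: "complex ^ 'e endpoint" assume "F \<noteq> 0"
    then have "Re (edge_form (\<lambda>_. 0) (\<lambda>_. 0) F F) < Re (?I F F)" by (rule edge_form_strict_mono) auto
    then show "0 < Re (?I F F)" by (simp add: Re_edge_form)
  qed
  have "\<forall>\<^sub>F t in at_right 0. positive_on UNIV (\<lambda>G F. of_real t * q G F + ?I G F)"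
    by (rule positive_on_stable[OF always_eventually hermitian_form_edge_form lim vec.subspace_UNIV pos])
      (simp add: q')
  then have "\<forall>\<^sub>F t in at_right 0. 0 < t \<and> positive_on UNIV (\<lambda>G F. of_real t * q G F + ?I G F)"
    using eventually_at_right_less[of 0] by eventually_elim simp
  then obtain t :: real where t: "0 < t" "positive_on UNIV (\<lambda>G F. of_real t * q G F + ?I G F)"
    using eventually_happens trivial_limit_at_right_real by blast
  show thesis
  proof (rule that[of "1 / t"])
    fix a b :: "'e \<Rightarrow> real" assume ab: "\<And>e. 1 / t < a e" "\<And>e. 1 / t < b e"
    show "positive_on UNIV (\<lambda>G F. q G F + edge_form a b G F)"
      unfolding positive_on_def
    proof (intro ballI impI)
      fix F :: "complex ^ 'e endpoint" assume F: "F \<noteq> 0"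
      have "0 < Re (of_real t * q F F + ?I F F)" using t(2) F unfolding positive_on_def by blast
      also have "\<dots> = t * (Re (q F F) + Re (edge_form (\<lambda>_. 1 / t) (\<lambda>_. 1 / t) F F))"
        using t(1) by (simp add: Re_edge_form sum_distrib_left algebra_simps)
      finally have "0 < Re (q F F) + Re (edge_form (\<lambda>_. 1 / t) (\<lambda>_. 1 / t) F F)"
        using t(1) by (simp add: zero_less_mult_iff)
      also have "\<dots> < Re (q F F) + Re (edge_form a b F F)"
        using edge_form_strict_mono[OF F, of "\<lambda>_. 1 / t" a "\<lambda>_. 1 / t" b] ab by simp
      finally show "0 < Re (q F F + edge_form a b F F)" by simp
    qed
  qed
qed

lemma window_iff_less:
  obtains \<tau> where "\<And>\<mu>. window h \<mu> \<longleftrightarrow> (\<forall>e. 0 < h e) \<and> \<mu> < \<tau>"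
proof
  fix \<mu>
  have "\<mu> * (h e)\<^sup>2 < (pi / 2)\<^sup>2 \<longleftrightarrow> \<mu> < (pi / 2)\<^sup>2 / (h e)\<^sup>2" if "0 < h e" for e
    using that by (simp add: pos_less_divide_eq)
  then show "window h \<mu> \<longleftrightarrow> (\<forall>e. 0 < h e) \<and> \<mu> < Min (range (\<lambda>e. (pi / 2)\<^sup>2 / (h e)\<^sup>2))"
    unfolding window_def by (auto simp: Min_gr_iff)
qed

context graph_vertex_data
begin

lemma boundary_form_pencil:
  assumes h: "\<And>e. 0 < h e"
  obtains \<tau> \<mu>\<^sub>0 where "\<And>\<mu>. window h \<mu> \<longleftrightarrow> \<mu> < \<tau>" "decreasing_pencil V (boundary_form h) \<tau> \<mu>\<^sub>0"
proof -
  obtain \<tau> where \<tau>: "\<And>\<mu>. window h \<mu> \<longleftrightarrow> \<mu> < \<tau>" using window_iff_less[of h] h by metis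
  obtain C where C: "\<And>a b. (\<And>e. C < a e) \<Longrightarrow> (\<And>e. C < b e) \<Longrightarrow>
    positive_on UNIV (\<lambda>G F. q G F + edge_form a b G F)"
    using large_edge_form_dominates[OF hermitian_form_q] by blast
  have "\<forall>\<^sub>F \<mu> in at_bot. \<forall>e. C < even_dtn \<mu> (h e)"
    using filterlim_at_top_dense[THEN iffD1, OF even_dtn_at_bot[OF h]]
    by (intro eventually_all_finite) blast
  then have "\<forall>\<^sub>F \<mu> in at_bot. \<mu> < \<tau> \<and> (\<forall>e. C < even_dtn \<mu> (h e))"
    using eventually_gt_at_bot[of \<tau>] by eventually_elim simp
  then obtain \<mu>\<^sub>0 where \<mu>\<^sub>0: "\<mu>\<^sub>0 < \<tau>" "\<And>e. C < even_dtn \<mu>\<^sub>0 (h e)"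
    using eventually_happens trivial_limit_at_bot_linorder by blast
  have w0: "window h \<mu>\<^sub>0" using \<tau> \<mu>\<^sub>0 by simp
  have odd: "C < odd_dtn \<mu>\<^sub>0 (h e)" for e
    using \<mu>\<^sub>0(2)[of e] even_dtn_less_odd_dtn[OF window_edge[OF w0], of e] by simp
  have "decreasing_pencil V (boundary_form h) \<tau> \<mu>\<^sub>0"
  proof
    show "vec.subspace V" by (rule vec_subspace_V)
    show "\<mu>\<^sub>0 < \<tau>" by fact
    have "positive_on UNIV (boundary_form h \<mu>\<^sub>0)"
      unfolding boundary_form_def[abs_def] dtn_form_def by (rule C[OF \<mu>\<^sub>0(2) odd])
    then show "positive_on V (boundary_form h \<mu>\<^sub>0)" by (auto simp: positive_on_def)
    fix \<mu> assume "\<mu> < \<tau>"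
    then have w: "window h \<mu>" using \<tau> by simp
    show "hermitian_form (boundary_form h \<mu>)" by (rule hermitian_form_boundary_form)
    show "((\<lambda>\<nu>. boundary_form h \<nu> G F) \<longlongrightarrow> boundary_form h \<mu> G F) (at \<mu>)" for G F
      unfolding boundary_form_def dtn_form_def edge_form_def
      by (intro tendsto_intros even_dtn_tendsto odd_dtn_tendsto window_edge[OF w])
  next
    fix \<mu> \<nu> and F :: "complex ^ 'e endpoint" assume *: "\<mu> < \<nu>" "\<nu> < \<tau>" "F \<noteq> 0"
    then have w: "window h \<nu>" using \<tau> by simp
    show "Re (boundary_form h \<nu> F F) < Re (boundary_form h \<mu> F F)"
      unfolding boundary_form_def dtn_form_def
      using edge_form_strict_mono[OF *(3), OF even_dtn_strict_antimono[OF window_edge(1)[OF w] *(1) window_edge(2)[OF w]]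
         odd_dtn_diff_bounds(1)[OF window_edge(1)[OF w] *(1) window_edge(2)[OF w]]]
      by simp
  qed
  then show thesis using that \<tau> by blast
qed

context
  fixes h :: "'e \<Rightarrow> real" and a :: real and H
  assumes w: "window h a" and H: "H = graph_operator (\<lambda>e. 2 * h e) (vertex_conditions PD PN PR \<Lambda>)"
begin

text \<open>
  Negative and positive subspaces of the boundary form at level \<open>a\<close> bound the number of eigenvalues up to
  \<open>a\<close> from both sides. Together they compute it.
\<close>
lemma graph_eigenvalue_counts:
  shows "finite (eigenvalues H \<inter> {..a})"
    and "\<lbrakk>vec.subspace Z; Z \<subseteq> V; positive_on Z (boundary_form h a)\<rbrakk> \<Longrightarrow>
      sum (eigenvalue_mult H) (eigenvalues H \<inter> {..a}) + vec.dim Z \<le> vec.dim V"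
    and "\<lbrakk>vec.subspace U; U \<subseteq> V; positive_on U (\<lambda>G F. - boundary_form h a G F)\<rbrakk> \<Longrightarrow>
      vec.dim U \<le> sum (eigenvalue_mult H) (eigenvalues H \<inter> {..<a})"
proof -
  obtain \<tau> \<mu>\<^sub>0 where \<tau>: "\<And>\<mu>. window h \<mu> \<longleftrightarrow> \<mu> < \<tau>" and p: "decreasing_pencil V (boundary_form h) \<tau> \<mu>\<^sub>0"
    using boundary_form_pencil[of h] w by (auto simp: window_def)
  interpret decreasing_pencil V "boundary_form h" \<tau> \<mu>\<^sub>0 by (rule p)
  have a: "a < \<tau>" using w \<tau> by simp
  have mult: "eigenvalue_mult H \<mu> = mult \<mu>" if "\<mu> \<le> a" for \<mu>
    using eigenvalue_mult_eq[of h \<mu>] \<tau> that a by (simp add: H mult_def)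
  have spec: "\<mu> \<in> eigenvalues H \<longleftrightarrow> \<mu> \<in> spectrum" if "\<mu> \<le> a" for \<mu>
  proof -
    have "\<mu> < \<tau>" using that a by simp
    moreover have "0 < mult \<mu> \<longleftrightarrow> \<not> null_space V (boundary_form h \<mu>) \<subseteq> {0}"
      by (simp only: mult_def vec.dim_eq_0[symmetric] neq0_conv)
    ultimately show ?thesis
      using eigenvalues_iff[of h \<mu>] \<tau> unfolding H spectrum_def by auto
  qed
  have eq: "eigenvalues H \<inter> {..a} = spectrum \<inter> {..a}" "eigenvalues H \<inter> {..<a} = spectrum \<inter> {..<a}"
    using spec by auto
  have sums: "sum (eigenvalue_mult H) (eigenvalues H \<inter> {..a}) = sum mult (spectrum \<inter> {..a})"
    "sum (eigenvalue_mult H) (eigenvalues H \<inter> {..<a}) = sum mult (spectrum \<inter> {..<a})"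
    unfolding eq by (rule sum.cong; simp add: mult)+
  show fin: "finite (eigenvalues H \<inter> {..a})" unfolding eq by (rule finite_spectrum[OF a])
  show "sum (eigenvalue_mult H) (eigenvalues H \<inter> {..a}) + vec.dim Z \<le> vec.dim V"
    if "vec.subspace Z" "Z \<subseteq> V" "positive_on Z (boundary_form h a)"
    unfolding sums by (rule sum_mult_le_codim[OF finite_spectrum[OF a] _ a that]) simp
  show "vec.dim U \<le> sum (eigenvalue_mult H) (eigenvalues H \<inter> {..<a})"
    if "vec.subspace U" "U \<subseteq> V" "positive_on U (\<lambda>G F. - boundary_form h a G F)"
    unfolding sums by (rule negative_dim_le_sum_mult[OF a that])
qed

end

end

text \<open>
  A jump of the counting function past \<open>n\<close> that settles at \<open>l\<close> for every level on either side forces the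
  \<open>n\<close>-th eigenvalue to \<open>l\<close>.
\<close>
lemma exotic_if_counts:
  fixes H :: "real \<Rightarrow> (('e \<Rightarrow> real \<Rightarrow> complex) \<times> ('e \<Rightarrow> real \<Rightarrow> complex)) set"
  assumes fin: "\<And>a. \<forall>\<^sub>F \<epsilon> in at_right 0. finite (eigenvalues (H \<epsilon>) \<inter> {..a})"
    and below: "\<And>\<mu>. \<mu> < l \<Longrightarrow> \<forall>\<^sub>F \<epsilon> in at_right 0. sum (eigenvalue_mult (H \<epsilon>)) (eigenvalues (H \<epsilon>) \<inter> {..\<mu>}) < n"
    and above: "\<And>\<mu>. l < \<mu> \<Longrightarrow> \<forall>\<^sub>F \<epsilon> in at_right 0. n \<le> sum (eigenvalue_mult (H \<epsilon>)) (eigenvalues (H \<epsilon>) \<inter> {..<\<mu>})"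
  shows "exotic H n"
proof -
  let ?N = "\<lambda>\<epsilon> A. sum (eigenvalue_mult (H \<epsilon>)) (eigenvalues (H \<epsilon>) \<inter> A)"
  have ex: "\<exists>\<mu>. is_nth_eigenvalue (H \<epsilon>) n \<mu>"
    if f: "finite (eigenvalues (H \<epsilon>) \<inter> {..a})" and n: "n \<le> ?N \<epsilon> {..<a}" "0 < n" for \<epsilon> a
  proof -
    let ?E = "eigenvalues (H \<epsilon>) \<inter> {..a}"
    \<comment> \<open>The \<open>n\<close>-th eigenvalue is the least one at which the cumulative count reaches \<open>n\<close>.\<close>
    define S where "S = {\<nu> \<in> ?E. n \<le> ?N \<epsilon> {..\<nu>}}"
    have fS: "finite S" by (rule finite_subset[OF _ f]) (auto simp: S_def)
    have "?E \<noteq> {}"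
    proof
      assume "?E = {}"
      then have "eigenvalues (H \<epsilon>) \<inter> {..<a} = {}" by auto
      then show False using n by simp
    qed
    have max: "Max ?E \<in> ?E" using f \<open>?E \<noteq> {}\<close> by (rule Max_in)
    have "eigenvalues (H \<epsilon>) \<inter> {..<a} \<subseteq> eigenvalues (H \<epsilon>) \<inter> {..Max ?E}"
      using Max_ge[OF f] by auto
    moreover have "finite (eigenvalues (H \<epsilon>) \<inter> {..Max ?E})"
      by (rule finite_subset[OF _ f]) (use max in auto)
    ultimately have "?N \<epsilon> {..<a} \<le> ?N \<epsilon> {..Max ?E}" by (intro sum_mono2) auto
    then have "Max ?E \<in> S" using max n unfolding S_def by simp
    then have mS: "Min S \<in> S" using fS by (intro Min_in) auto
    define \<mu> where "\<mu> = Min S"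
    have \<mu>: "\<mu> \<in> ?E" "n \<le> ?N \<epsilon> {..\<mu>}" using mS by (simp_all add: S_def \<mu>_def)
    have fin': "finite (eigenvalues (H \<epsilon>) \<inter> {..\<mu>})" by (rule finite_subset[OF _ f]) (use \<mu> in auto)
    have "?N \<epsilon> {..<\<mu>} < n"
    proof (rule ccontr)
      assume no: "\<not> ?N \<epsilon> {..<\<mu>} < n"
      let ?E' = "eigenvalues (H \<epsilon>) \<inter> {..<\<mu>}"
      have f': "finite ?E'" by (rule finite_subset[OF _ fin']) auto
      have "?E' \<noteq> {}" using no n by auto
      then have max': "Max ?E' \<in> ?E'" by (rule Max_in[OF f'])
      have "eigenvalues (H \<epsilon>) \<inter> {..<\<mu>} \<subseteq> eigenvalues (H \<epsilon>) \<inter> {..Max ?E'}"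
        using Max_ge[OF f'] by auto
      moreover have "finite (eigenvalues (H \<epsilon>) \<inter> {..Max ?E'})"
        by (rule finite_subset[OF _ fin']) (use max' in auto)
      ultimately have "?N \<epsilon> {..<\<mu>} \<le> ?N \<epsilon> {..Max ?E'}" by (intro sum_mono2) auto
      then have "Max ?E' \<in> S" using max' no \<mu> unfolding S_def by auto
      then have "\<mu> \<le> Max ?E'" unfolding \<mu>_def by (rule Min_le[OF fS])
      then show False using max' by simp
    qed
    then show ?thesis using \<mu> fin' unfolding is_nth_eigenvalue_def by blast
  qed
  have n0: "0 < n"
  proof -
    have "\<forall>\<^sub>F \<epsilon> in at_right (0::real). 0 < n" 
      by (rule eventually_mono[OF below[of "l - 1"]]) auto
    then show ?thesis by (simp add: trivial_limit_at_right_real)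
  qed
  define lam where "lam \<epsilon> = (SOME \<mu>. is_nth_eigenvalue (H \<epsilon>) n \<mu>)" for \<epsilon>
  have nth: "\<forall>\<^sub>F \<epsilon> in at_right 0. is_nth_eigenvalue (H \<epsilon>) n (lam \<epsilon>)"
    using fin[of "l + 1"] above[of "l + 1", simplified]
  proof eventually_elim
    case (elim \<epsilon>)
    show ?case unfolding lam_def by (rule someI_ex) (rule ex[OF elim n0])
  qed
  have "(lam \<longlongrightarrow> l) (at_right 0)"
  proof (rule order_tendstoI)
    fix \<mu> assume "\<mu> < l"
    from below[OF this] fin[of \<mu>] nth show "\<forall>\<^sub>F \<epsilon> in at_right 0. \<mu> < lam \<epsilon>"
    proof eventually_elim
      case (elim \<epsilon>)
      show ?case
      proof (rule ccontr)
        assume "\<not> \<mu> < lam \<epsilon>"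
        then have "?N \<epsilon> {..lam \<epsilon>} \<le> ?N \<epsilon> {..\<mu>}" by (intro sum_mono2 elim(2)) auto
        then show False using elim by (simp add: is_nth_eigenvalue_def)
      qed
    qed
  next
    fix \<mu> assume "l < \<mu>"
    from above[OF this] nth show "\<forall>\<^sub>F \<epsilon> in at_right 0. lam \<epsilon> < \<mu>"
    proof eventually_elim
      case (elim \<epsilon>)
      show ?case
      proof (rule ccontr)
        assume no: "\<not> lam \<epsilon> < \<mu>"
        have "finite (eigenvalues (H \<epsilon>) \<inter> {..<lam \<epsilon>})"
          by (rule finite_subset[of _ "eigenvalues (H \<epsilon>) \<inter> {..lam \<epsilon>}"])
            (use elim in \<open>auto simp: is_nth_eigenvalue_def\<close>)
        then have "?N \<epsilon> {..<\<mu>} \<le> ?N \<epsilon> {..<lam \<epsilon>}" using no by (intro sum_mono2) auto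
        then show False using elim by (simp add: is_nth_eigenvalue_def)
      qed
    qed
  qed
  then show ?thesis using nth unfolding exotic_def by blast
qed

text \<open>
  If the count is eventually the same number at every level, no eigenvalue remains between two
  given levels.
\<close>
lemma not_exotic_if_counts:
  fixes H :: "real \<Rightarrow> (('e \<Rightarrow> real \<Rightarrow> complex) \<times> ('e \<Rightarrow> real \<Rightarrow> complex)) set"
  assumes fin: "\<And>a. \<forall>\<^sub>F \<epsilon> in at_right 0. finite (eigenvalues (H \<epsilon>) \<inter> {..a})"
    and le: "\<And>\<mu>. \<forall>\<^sub>F \<epsilon> in at_right 0. sum (eigenvalue_mult (H \<epsilon>)) (eigenvalues (H \<epsilon>) \<inter> {..\<mu>}) \<le> m"
    and ge: "\<And>\<mu>. \<forall>\<^sub>F \<epsilon> in at_right 0. m \<le> sum (eigenvalue_mult (H \<epsilon>)) (eigenvalues (H \<epsilon>) \<inter> {..<\<mu>})"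
  shows "\<not> exotic H n"
proof
  let ?N = "\<lambda>\<epsilon> A. sum (eigenvalue_mult (H \<epsilon>)) (eigenvalues (H \<epsilon>) \<inter> A)"
  assume "exotic H n"
  then obtain lam l where nth: "\<forall>\<^sub>F \<epsilon> in at_right 0. is_nth_eigenvalue (H \<epsilon>) n (lam \<epsilon>)"
    and lim: "(lam \<longlongrightarrow> l) (at_right 0)" unfolding exotic_def by blast
  have "\<forall>\<^sub>F \<epsilon> in at_right (0::real). False"
    using nth order_tendstoD(1)[OF lim, of "l - 1", simplified] order_tendstoD(2)[OF lim, of "l + 1", simplified]
      fin[of "l + 1"] le[of "l + 1"] ge[of "l - 1"]
  proof eventually_elim
    case (elim \<epsilon>)
    have "finite (eigenvalues (H \<epsilon>) \<inter> {..<lam \<epsilon>})"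
      by (rule finite_subset[OF _ elim(4)]) (use elim(3) in auto)
    then have "?N \<epsilon> {..<l - 1} \<le> ?N \<epsilon> {..<lam \<epsilon>}" using elim(2) by (intro sum_mono2) auto
    moreover have "?N \<epsilon> {..lam \<epsilon>} \<le> ?N \<epsilon> {..l + 1}" using elim(3) by (intro sum_mono2 elim(4)) auto
    ultimately show False using elim unfolding is_nth_eigenvalue_def by linarith
  qed
  then show False by (simp add: trivial_limit_at_right_real)
qed

section \<open>Rescaling as the edges shrink\<close>

lemma hermitian_form_compose:
  assumes q: "hermitian_form q" and A: "Vector_Spaces.linear (*s) (*s) A"
  shows "hermitian_form (\<lambda>G F. q (A G) (A F))"
proof -
  interpret A: Vector_Spaces.linear "(*s)" "(*s)" A by (rule A)
  show ?thesis
    by (rule hermitian_formI)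
      (simp_all add: A.add A.scale hermitian_form_simps[OF q], rule hermitian_form_cnj[OF q])
qed

lemma hermitian_form_cross:
  assumes q: "hermitian_form q" and A: "Vector_Spaces.linear (*s) (*s) A" and B: "Vector_Spaces.linear (*s) (*s) B"
  shows "hermitian_form (\<lambda>G F. q (A G) (B F) + q (B G) (A F))"
proof (rule hermitian_formI)
  interpret A: Vector_Spaces.linear "(*s)" "(*s)" A by (rule A)
  interpret B: Vector_Spaces.linear "(*s)" "(*s)" B by (rule B)
  fix G F F' c
  show "q (A G) (B (F + F')) + q (B G) (A (F + F')) = q (A G) (B F) + q (B G) (A F) + (q (A G) (B F') + q (B G) (A F'))"
    "q (A G) (B (c *s F)) + q (B G) (A (c *s F)) = c * (q (A G) (B F) + q (B G) (A F))"
    by (simp_all add: A.add A.scale B.add B.scale hermitian_form_simps[OF q] algebra_simps)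
  show "q (A F) (B G) + q (B F) (A G) = cnj (q (A G) (B F) + q (B G) (A F))"
    using hermitian_form_cnj[OF q, of "A F" "B G"] hermitian_form_cnj[OF q, of "B F" "A G"] by simp
qed

text \<open>
  The projections \<open>\<pi>\<close> and \<open>\<kappa>\<close>, onto $\mathcal{F}_0$ and onto the null space $K$ of $q$ on it,
  encode complements: $\mathrm{Ker}\,\kappa \cap \mathcal{F}_0$ complements $K$ in $\mathcal{F}_0$, and
  $\mathrm{Ker}\,\pi \cap \mathrm{Ker}\,P_D$ complements $\mathcal{F}_0$ in $\mathrm{Ker}\,P_D$. Any choice
  will do.
\<close>
locale scaled_splitting = graph_vertex_data PD PN PR \<Lambda>
  for PD PN PR :: "complex ^ 'e::finite endpoint ^ 'e endpoint" and \<Lambda> +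
  fixes len :: "'e \<Rightarrow> real" and \<pi> \<kappa> :: "complex ^ 'e endpoint \<Rightarrow> complex ^ 'e endpoint"
  assumes len: "\<And>e. 0 < len e"
    and \<pi>: "Vector_Spaces.linear (*s) (*s) \<pi>" "\<And>x. \<pi> x \<in> F0 PD" "\<And>x. x \<in> F0 PD \<Longrightarrow> \<pi> x = x"
    and \<kappa>: "Vector_Spaces.linear (*s) (*s) \<kappa>" "\<And>x. \<kappa> x \<in> null_space (F0 PD) q"
      "\<And>x. x \<in> null_space (F0 PD) q \<Longrightarrow> \<kappa> x = x"
begin

sublocale \<pi>: Vector_Spaces.linear "(*s)" "(*s)" \<pi> by (rule \<pi>(1))
sublocale \<kappa>: Vector_Spaces.linear "(*s)" "(*s)" \<kappa> by (rule \<kappa>(1))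

abbreviation "K \<equiv> null_space (F0 PD) q"

text \<open>
  The components in $C$, $K$ and $X$. On $K$ both $q$ and the penalty for unequal end
  values vanish, so the boundary form is small of order $\epsilon$ there; hence the name \<open>slow\<close>.
\<close>
definition "core F = \<pi> F - \<kappa> (\<pi> F)"
definition "slow F = \<kappa> (\<pi> F)"
definition "rest F = F - \<pi> F"

lemma F0_V: "F0 PD \<subseteq> V" by (auto simp: F0_def)

lemma K_F0: "K \<subseteq> F0 PD" by (auto simp: null_space_def)

lemma vec_subspace_F0: "vec.subspace (F0 PD)"
  using vec_subspace_V by (auto simp: F0_def D0_def vec.subspace_def)

lemma vec_subspace_K: "vec.subspace K"
  by (rule vec_subspace_null_space[OF hermitian_form_q vec_subspace_F0])

lemma linear_parts:
  "Vector_Spaces.linear (*s) (*s) core" "Vector_Spaces.linear (*s) (*s) slow" "Vector_Spaces.linear (*s) (*s) rest"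
  by (unfold_locales; simp add: core_def slow_def rest_def \<pi>.add \<pi>.scale \<kappa>.add \<kappa>.scale vec.scale_right_diff_distrib)+

sublocale core: Vector_Spaces.linear "(*s)" "(*s)" core by (rule linear_parts)
sublocale slow: Vector_Spaces.linear "(*s)" "(*s)" slow by (rule linear_parts)
sublocale rest: Vector_Spaces.linear "(*s)" "(*s)" rest by (rule linear_parts)

lemma parts_sum: "core F + slow F + rest F = F"
  by (simp add: core_def slow_def rest_def)

lemma slow_K: "slow F \<in> K" by (simp add: slow_def \<kappa>(2))

lemma core_F0: "core F \<in> F0 PD"
  unfolding core_def using \<pi>(2) \<kappa>(2) K_F0 by (auto intro: vec.subspace_diff[OF vec_subspace_F0])

lemma rest_V: "F \<in> V \<Longrightarrow> rest F \<in> V"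
  unfolding rest_def using \<pi>(2) F0_V vec.subspace_diff[OF vec_subspace_V] by blast

lemma \<pi>_parts: "\<pi> (core F) = core F" "\<pi> (slow F) = slow F" "\<pi> (rest F) = 0"
  using core_F0 slow_K K_F0 \<pi>(2,3) by (auto simp: rest_def \<pi>.diff subset_iff)

lemma \<kappa>_parts: "\<kappa> (core F) = 0" "\<kappa> (slow F) = slow F"
  using \<kappa>(2,3) by (auto simp: core_def slow_def \<kappa>.diff)

lemma q_K_F0: "G \<in> F0 PD \<Longrightarrow> F \<in> K \<Longrightarrow> q G F = 0" "G \<in> F0 PD \<Longrightarrow> F \<in> K \<Longrightarrow> q F G = 0"
  using hermitian_form_cnj[OF hermitian_form_q, of F G] by (auto simp: null_space_def)

lemma odd_part_F0: "F \<in> F0 PD \<Longrightarrow> odd_part F e = 0"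
  by (simp add: F0_def D0_def odd_part_def)

text \<open>
  The exponents balance the terms of the boundary form. Each of $q$ on the core part, the coupling of
  the slow to the remaining part, the penalty of order $1/\epsilon$ on the latter, and the mass
  term $\mu\epsilon$ on the slow part becomes of exact order $\epsilon$.
\<close>
definition rescale :: "real \<Rightarrow> complex ^ 'e endpoint \<Rightarrow> complex ^ 'e endpoint" where
  "rescale \<epsilon> F = of_real (sqrt \<epsilon>) *s core F + slow F + of_real \<epsilon> *s rest F"

lemma linear_rescale: "Vector_Spaces.linear (*s) (*s) (rescale \<epsilon>)"
  by unfold_locales
    (simp_all add: rescale_def core.add core.scale slow.add slow.scale rest.add rest.scale
      vec.scale_right_distrib mult_ac)

lemma rescale_V: "F \<in> V \<Longrightarrow> rescale \<epsilon> F \<in> V"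
  unfolding rescale_def using core_F0 slow_K K_F0 F0_V rest_V
  by (intro vec.subspace_add[OF vec_subspace_V] vec.subspace_scale[OF vec_subspace_V]) auto

lemma rescale_eq_0:
  assumes "0 < \<epsilon>" "rescale \<epsilon> F = 0" shows "F = 0"
proof -
  have 1: "of_real (sqrt \<epsilon>) *s core F + slow F = 0"
    using arg_cong[OF assms(2), of \<pi>]
    by (simp add: rescale_def \<pi>.add \<pi>.scale \<pi>_parts \<pi>.zero)
  have "slow F = \<kappa> (of_real (sqrt \<epsilon>) *s core F + slow F)"
    by (simp only: \<kappa>.add \<kappa>.scale \<kappa>_parts vec.scale_zero_right add_0)
  also have "\<dots> = 0" unfolding 1 by (rule \<kappa>.zero)
  finally have 2: "slow F = 0" .
  have 3: "core F = 0" using 2 1 assms(1) by simp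
  then have "rest F = 0" using assms 2 by (simp add: rescale_def)
  then show ?thesis using parts_sum[of F] 2 3 by simp
qed

definition limit_form :: "real \<Rightarrow> complex ^ 'e endpoint \<Rightarrow> complex ^ 'e endpoint \<Rightarrow> complex" where
  "limit_form \<mu> G F = q (core G) (core F) + (q (slow G) (rest F) + q (rest G) (slow F)) +
     edge_form (\<lambda>e. - \<mu> * (len e / 2)) (\<lambda>_. 0) (slow G) (slow F) +
     edge_form (\<lambda>_. 0) (\<lambda>e. 1 / (len e / 2)) (rest G) (rest F)"

lemma hermitian_form_limit_form: "hermitian_form (limit_form \<mu>)"
  unfolding limit_form_def[abs_def]
  by (rule hermitian_form_add hermitian_form_compose[OF hermitian_form_q linear_parts(1)]
      hermitian_form_cross[OF hermitian_form_q linear_parts(2,3)]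
      hermitian_form_compose[OF hermitian_form_edge_form linear_parts(2)]
      hermitian_form_compose[OF hermitian_form_edge_form linear_parts(3)])+

abbreviation "half \<epsilon> \<equiv> (\<lambda>e. \<epsilon> * (len e / 2))"

definition scaled_form :: "real \<Rightarrow> real \<Rightarrow> complex ^ 'e endpoint \<Rightarrow> complex ^ 'e endpoint \<Rightarrow> complex" where
  "scaled_form \<mu> \<epsilon> G F = of_real (1 / \<epsilon>) * boundary_form (half \<epsilon>) \<mu> (rescale \<epsilon> G) (rescale \<epsilon> F)"

lemma hermitian_form_scaled_form: "hermitian_form (scaled_form \<mu> \<epsilon>)"
  unfolding scaled_form_def[abs_def]
  by (rule hermitian_form_scale[OF hermitian_form_compose[OF hermitian_form_boundary_form linear_rescale]])

text \<open>
  The singular terms drop out: $q$ between the slow part and all of $\mathcal{F}_0$ is zero by definition of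
  $K$, and elements of $\mathcal{F}_0$ have no odd part.
\<close>
lemma scaled_form_expand:
  assumes \<epsilon>: "0 < \<epsilon>"
  shows "scaled_form \<mu> \<epsilon> G F =
    q (core G) (core F) + of_real (sqrt \<epsilon>) * (q (core G) (rest F) + q (rest G) (core F)) +
    (q (slow G) (rest F) + q (rest G) (slow F)) + of_real \<epsilon> * q (rest G) (rest F) +
    (\<Sum>e\<in>UNIV. of_real (2 * (even_dtn \<mu> (half \<epsilon> e) / \<epsilon>)) *
        (cnj (of_real (sqrt \<epsilon>) * even_part (core G) e + even_part (slow G) e + of_real \<epsilon> * even_part (rest G) e) *
         (of_real (sqrt \<epsilon>) * even_part (core F) e + even_part (slow F) e + of_real \<epsilon> * even_part (rest F) e)) +
      of_real (2 * (\<epsilon> * odd_dtn \<mu> (half \<epsilon> e))) * (cnj (odd_part (rest G) e) * odd_part (rest F) e))"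
proof -
  have s: "of_real (sqrt \<epsilon>) * of_real (sqrt \<epsilon>) = (of_real \<epsilon> :: complex)"
    using \<epsilon> by (simp flip: of_real_mult)
  have "q (rescale \<epsilon> G) (rescale \<epsilon> F) =
      of_real (sqrt \<epsilon>) * of_real (sqrt \<epsilon>) * q (core G) (core F) +
      of_real (sqrt \<epsilon>) * of_real \<epsilon> * (q (core G) (rest F) + q (rest G) (core F)) +
      of_real \<epsilon> * (q (slow G) (rest F) + q (rest G) (slow F)) + of_real \<epsilon> * of_real \<epsilon> * q (rest G) (rest F)"
    using q_K_F0[OF core_F0 slow_K] q_K_F0[OF subsetD[OF K_F0 slow_K] slow_K]
    by (simp add: rescale_def hermitian_form_simps[OF hermitian_form_q] algebra_simps)
  then have 1: "of_real (1 / \<epsilon>) * q (rescale \<epsilon> G) (rescale \<epsilon> F) =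
      q (core G) (core F) + of_real (sqrt \<epsilon>) * (q (core G) (rest F) + q (rest G) (core F)) +
      (q (slow G) (rest F) + q (rest G) (slow F)) + of_real \<epsilon> * q (rest G) (rest F)"
    unfolding s using \<epsilon> by (simp add: field_simps)
  have odd: "odd_part (rescale \<epsilon> F) e = of_real \<epsilon> * odd_part (rest F) e" for F e
    using odd_part_F0[OF core_F0] odd_part_F0[OF subsetD[OF K_F0 slow_K]] by (simp add: rescale_def)
  have even: "even_part (rescale \<epsilon> F) e =
      of_real (sqrt \<epsilon>) * even_part (core F) e + even_part (slow F) e + of_real \<epsilon> * even_part (rest F) e" for F e
    by (simp add: rescale_def)
  have 2: "of_real (1 / \<epsilon>) * dtn_form (half \<epsilon>) \<mu> (rescale \<epsilon> G) (rescale \<epsilon> F) =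
    (\<Sum>e\<in>UNIV. of_real (2 * (even_dtn \<mu> (half \<epsilon> e) / \<epsilon>)) *
        (cnj (of_real (sqrt \<epsilon>) * even_part (core G) e + even_part (slow G) e + of_real \<epsilon> * even_part (rest G) e) *
         (of_real (sqrt \<epsilon>) * even_part (core F) e + even_part (slow F) e + of_real \<epsilon> * even_part (rest F) e)) +
      of_real (2 * (\<epsilon> * odd_dtn \<mu> (half \<epsilon> e))) * (cnj (odd_part (rest G) e) * odd_part (rest F) e))"
    unfolding dtn_form_def edge_form_def sum_distrib_left even odd
    by (intro sum.cong refl) (use \<epsilon> in \<open>simp add: distrib_left\<close>)
  show ?thesis unfolding scaled_form_def boundary_form_def distrib_left 1 2 by (simp add: add_ac)
qed

lemma scaled_form_tendsto: "((\<lambda>\<epsilon>. scaled_form \<mu> \<epsilon> G F) \<longlongrightarrow> limit_form \<mu> G F) (at_right 0)"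
proof -
  have id: "((\<lambda>\<epsilon>. \<epsilon>) \<longlongrightarrow> 0) (at_right (0::real))" by simp
  have sq: "((\<lambda>\<epsilon>. sqrt \<epsilon>) \<longlongrightarrow> 0) (at_right 0)" using tendsto_real_sqrt[OF id] by simp
  have k: "0 < len e / 2" for e using len by simp
  have lim: "((\<lambda>\<epsilon>. q (core G) (core F) + of_real (sqrt \<epsilon>) * (q (core G) (rest F) + q (rest G) (core F)) +
    (q (slow G) (rest F) + q (rest G) (slow F)) + of_real \<epsilon> * q (rest G) (rest F) +
    (\<Sum>e\<in>UNIV. of_real (2 * (even_dtn \<mu> (half \<epsilon> e) / \<epsilon>)) *
        (cnj (of_real (sqrt \<epsilon>) * even_part (core G) e + even_part (slow G) e + of_real \<epsilon> * even_part (rest G) e) *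
         (of_real (sqrt \<epsilon>) * even_part (core F) e + even_part (slow F) e + of_real \<epsilon> * even_part (rest F) e)) +
      of_real (2 * (\<epsilon> * odd_dtn \<mu> (half \<epsilon> e))) * (cnj (odd_part (rest G) e) * odd_part (rest F) e)))
    \<longlongrightarrow>
    q (core G) (core F) + of_real 0 * (q (core G) (rest F) + q (rest G) (core F)) +
    (q (slow G) (rest F) + q (rest G) (slow F)) + of_real 0 * q (rest G) (rest F) +
    (\<Sum>e\<in>UNIV. of_real (2 * (- \<mu> * (len e / 2))) *
        (cnj (of_real 0 * even_part (core G) e + even_part (slow G) e + of_real 0 * even_part (rest G) e) *
         (of_real 0 * even_part (core F) e + even_part (slow F) e + of_real 0 * even_part (rest F) e)) +
      of_real (2 * (1 / (len e / 2))) * (cnj (odd_part (rest G) e) * odd_part (rest F) e))) (at_right 0)"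
    by (intro tendsto_add tendsto_mult tendsto_const tendsto_of_real tendsto_sum tendsto_cnj
        id sq even_dtn_asymptotics odd_dtn_asymptotics k)
  have eq: "q (core G) (core F) + of_real 0 * (q (core G) (rest F) + q (rest G) (core F)) +
    (q (slow G) (rest F) + q (rest G) (slow F)) + of_real 0 * q (rest G) (rest F) +
    (\<Sum>e\<in>UNIV. of_real (2 * (- \<mu> * (len e / 2))) *
        (cnj (of_real 0 * even_part (core G) e + even_part (slow G) e + of_real 0 * even_part (rest G) e) *
         (of_real 0 * even_part (core F) e + even_part (slow F) e + of_real 0 * even_part (rest F) e)) +
      of_real (2 * (1 / (len e / 2))) * (cnj (odd_part (rest G) e) * odd_part (rest F) e))
    = limit_form \<mu> G F"
    unfolding limit_form_def edge_form_def by (simp add: sum.distrib[symmetric])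
  show ?thesis
    by (rule Lim_transform_eventually[OF lim[unfolded eq]],
        rule eventually_mono[OF eventually_at_right_less[of 0]], rule scaled_form_expand[symmetric])
qed

abbreviation "H \<equiv> shrinking_graph_operator len PD PN PR \<Lambda>"

lemma H_eq: "H \<epsilon> = graph_operator (\<lambda>e. 2 * half \<epsilon> e) (vertex_conditions PD PN PR \<Lambda>)"
  by (simp add: shrinking_graph_operator_def)

lemma eventually_window: "\<forall>\<^sub>F \<epsilon> in at_right 0. window (half \<epsilon>) a"
proof -
  have "\<forall>\<^sub>F \<epsilon> in at_right 0. \<forall>e. a * (half \<epsilon> e)\<^sup>2 < (pi / 2)\<^sup>2"
    by (intro eventually_all_finite eventually_small_window)
  then show ?thesis
    using eventually_at_right_less[of 0] by eventually_elim (use len in \<open>simp add: window_def\<close>)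
qed

lemma eventually_finite_eigenvalues: "\<forall>\<^sub>F \<epsilon> in at_right 0. finite (eigenvalues (H \<epsilon>) \<inter> {..a})"
  using eventually_window[of a] by eventually_elim (rule graph_eigenvalue_counts(1)[OF _ H_eq])

lemma rescale_image:
  assumes \<epsilon>: "0 < \<epsilon>" and U: "vec.subspace U" "U \<subseteq> V"
  shows "vec.subspace (rescale \<epsilon> ` U)" "rescale \<epsilon> ` U \<subseteq> V" "vec.dim (rescale \<epsilon> ` U) = vec.dim U"
proof -
  interpret r: Vector_Spaces.linear "(*s)" "(*s)" "rescale \<epsilon>" by (rule linear_rescale)
  show "vec.subspace (rescale \<epsilon> ` U)" by (rule r.subspace_image[OF U(1)])
  show "rescale \<epsilon> ` U \<subseteq> V" using rescale_V U(2) by blast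
  have "inj_on (rescale \<epsilon>) (vec.span U)"
  proof (rule inj_onI)
    fix x y assume "rescale \<epsilon> x = rescale \<epsilon> y"
    then have "rescale \<epsilon> (x - y) = 0" by (simp add: r.diff)
    then show "x = y" using rescale_eq_0[OF \<epsilon>] by force
  qed
  then show "vec.dim (rescale \<epsilon> ` U) = vec.dim U" by (rule vec.dim_image_eq[OF linear_rescale])
qed

lemma positive_on_rescale_image:
  assumes \<epsilon>: "0 < \<epsilon>" and pos: "positive_on U (\<lambda>G F. of_real s * scaled_form \<mu> \<epsilon> G F)"
  shows "positive_on (rescale \<epsilon> ` U) (\<lambda>G F. of_real s * boundary_form (half \<epsilon>) \<mu> G F)"
  unfolding positive_on_def
proof (intro ballI impI)
  interpret r: Vector_Spaces.linear "(*s)" "(*s)" "rescale \<epsilon>" by (rule linear_rescale)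
  fix F assume F: "F \<in> rescale \<epsilon> ` U" "F \<noteq> 0"
  then obtain x where x: "x \<in> U" "F = rescale \<epsilon> x" by blast
  then have "x \<noteq> 0" using F(2) r.zero by blast
  then have "0 < Re (of_real s * scaled_form \<mu> \<epsilon> x x)" using pos x(1) unfolding positive_on_def by blast
  also have "\<dots> = (1 / \<epsilon>) * Re (of_real s * boundary_form (half \<epsilon>) \<mu> F F)"
    by (simp add: scaled_form_def x(2))
  finally show "0 < Re (of_real s * boundary_form (half \<epsilon>) \<mu> F F)" using \<epsilon> by (simp add: zero_less_divide_iff)
qed

text \<open>
  The factor \<open>s\<close> is a sign; with $s = -1$ this is the corresponding statement for negative subspaces.
\<close>
lemma eventually_positive_boundary_form:
  assumes U: "vec.subspace U" and pos: "positive_on U (\<lambda>G F. of_real s * limit_form \<mu> G F)"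
  shows "\<forall>\<^sub>F \<epsilon> in at_right 0. positive_on (rescale \<epsilon> ` U) (\<lambda>G F. of_real s * boundary_form (half \<epsilon>) \<mu> G F)"
proof -
  have "\<forall>\<^sub>F \<epsilon> in at_right 0. positive_on U (\<lambda>G F. of_real s * scaled_form \<mu> \<epsilon> G F)"
    by (rule positive_on_stable[OF always_eventually hermitian_form_scale[OF hermitian_form_limit_form]
          tendsto_mult[OF tendsto_const scaled_form_tendsto] U pos])
      (simp add: hermitian_form_scale hermitian_form_scaled_form)
  then show ?thesis
    using eventually_at_right_less[of 0] by eventually_elim (rule positive_on_rescale_image)
qed

lemma eventually_count_le:
  assumes Z: "vec.subspace Z" "Z \<subseteq> V" and pos: "positive_on Z (limit_form \<mu>)"
  shows "\<forall>\<^sub>F \<epsilon> in at_right 0.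
    sum (eigenvalue_mult (H \<epsilon>)) (eigenvalues (H \<epsilon>) \<inter> {..\<mu>}) + vec.dim Z \<le> vec.dim V"
proof -
  have "\<forall>\<^sub>F \<epsilon> in at_right 0. positive_on (rescale \<epsilon> ` Z) (\<lambda>G F. of_real 1 * boundary_form (half \<epsilon>) \<mu> G F)"
    by (rule eventually_positive_boundary_form[OF Z(1)]) (use pos in simp)
  then show ?thesis
    using eventually_window[of \<mu>] eventually_at_right_less[of 0]
  proof eventually_elim
    case (elim \<epsilon>)
    note im = rescale_image[OF elim(3) Z]
    show ?case
      using graph_eigenvalue_counts(2)[OF elim(2) H_eq im(1,2)] elim(1) im(3) by simp
  qed
qed

lemma eventually_count_ge:
  assumes U: "vec.subspace U" "U \<subseteq> V" and neg: "positive_on U (\<lambda>G F. - limit_form \<mu> G F)"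
  shows "\<forall>\<^sub>F \<epsilon> in at_right 0.
    vec.dim U \<le> sum (eigenvalue_mult (H \<epsilon>)) (eigenvalues (H \<epsilon>) \<inter> {..<\<mu>})"
proof -
  have "\<forall>\<^sub>F \<epsilon> in at_right 0. positive_on (rescale \<epsilon> ` U) (\<lambda>G F. of_real (- 1) * boundary_form (half \<epsilon>) \<mu> G F)"
    by (rule eventually_positive_boundary_form[OF U(1)]) (use neg in simp)
  then show ?thesis
    using eventually_window[of \<mu>] eventually_at_right_less[of 0]
  proof eventually_elim
    case (elim \<epsilon>)
    note im = rescale_image[OF elim(3) U]
    show ?case
      using graph_eigenvalue_counts(3)[OF elim(2) H_eq im(1,2)] elim(1) im(3) by simp
  qed
qed

end

section \<open>Existence and absence of exotic eigenvalues\<close>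

context scaled_splitting
begin

text \<open>
  This is $\sum_e |F_{e^+} - F_{e^-}|^2/\ell_e$, the Dirichlet energy of the
  edgewise linear interpolation at unit scale.
\<close>
definition stiffness :: "complex ^ 'e endpoint \<Rightarrow> real" where
  "stiffness F = Re (edge_form (\<lambda>_. 0) (\<lambda>e. 1 / (len e / 2)) F F)"

text \<open>
  For $F \in D_0$ this is the squared $L_2$ norm, at unit scale, of the edgewise constant function with
  values $F$.
\<close>
definition mass :: "complex ^ 'e endpoint \<Rightarrow> real" where
  "mass F = Re (edge_form (\<lambda>e. len e / 2) (\<lambda>_. 0) F F)"

text \<open>
  The second-order energy of a null vector \<open>n\<close> under a correction \<open>x\<close> of size $\epsilon$. Its
  infimum relative to the mass of \<open>n\<close> is the limit of the lowest exotic eigenvalue.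
\<close>
definition energy :: "complex ^ 'e endpoint \<Rightarrow> complex ^ 'e endpoint \<Rightarrow> real" where
  "energy n x = 2 * Re (q n x) + stiffness x"

definition "X = {x \<in> V. \<pi> x = 0}"

lemma vec_subspace_X: "vec.subspace X"
  using vec_subspace_V by (auto simp: X_def vec.subspace_def \<pi>.add \<pi>.scale \<pi>.zero)

lemma mass_pos: "n \<in> F0 PD \<Longrightarrow> n \<noteq> 0 \<Longrightarrow> 0 < mass n"
proof -
  assume n: "n \<in> F0 PD" "n \<noteq> 0"
  have "Re (edge_form (\<lambda>_. 0) (\<lambda>_. - 1) n n) < Re (edge_form (\<lambda>e. len e / 2) (\<lambda>_. 0) n n)"
    by (rule edge_form_strict_mono[OF n(2)]) (use len in auto)
  then show ?thesis by (simp add: mass_def Re_edge_form odd_part_F0[OF n(1)])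
qed

text \<open>
  Equal end values on all edges would put \<open>x\<close> into $\mathcal{F}_0$, which meets its complement $X$ only in zero.
\<close>
lemma stiffness_pos: "x \<in> X \<Longrightarrow> x \<noteq> 0 \<Longrightarrow> 0 < stiffness x"
proof (rule ccontr)
  assume x: "x \<in> X" "x \<noteq> 0" and "\<not> 0 < stiffness x"
  then have "(\<Sum>e\<in>UNIV. 2 * (1 / (len e / 2)) * (cmod (odd_part x e))\<^sup>2) \<le> 0"
    by (simp add: stiffness_def Re_edge_form)
  moreover have nn: "0 \<le> 2 * (1 / (len e / 2)) * (cmod (odd_part x e))\<^sup>2" for e
    using len[of e] by simp
  ultimately have "(\<Sum>e\<in>UNIV. 2 * (1 / (len e / 2)) * (cmod (odd_part x e))\<^sup>2) = 0"
    by (intro antisym sum_nonneg) auto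
  then have "\<forall>e. 2 * (1 / (len e / 2)) * (cmod (odd_part x e))\<^sup>2 = 0"
    using nn by (subst (asm) sum_nonneg_eq_0_iff) auto
  then have "odd_part x e = 0" for e using len[of e] by (auto dest!: spec[of _ e])
  then have "x \<in> F0 PD" using x(1) by (auto simp: odd_part_def F0_def D0_def X_def)
  then have "\<pi> x = x" by (rule \<pi>(3))
  then show False using x by (simp add: X_def)
qed

text \<open>
  The core part decouples, and \<open>\<mu>\<close> acts on the slow part only.
\<close>
lemma Re_limit_form:
  "Re (limit_form \<mu> F F) = Re (q (core F) (core F)) + energy (slow F) (rest F) - \<mu> * mass (slow F)"
proof -
  have "Re (q (rest F) (slow F)) = Re (q (slow F) (rest F))"
    using hermitian_form_cnj[OF hermitian_form_q, of "rest F" "slow F"] by simp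
  moreover have "Re (edge_form (\<lambda>e. - \<mu> * (len e / 2)) (\<lambda>_. 0) (slow F) (slow F)) = - \<mu> * mass (slow F)"
    by (simp add: mass_def Re_edge_form sum_distrib_left sum_negf[symmetric] mult_ac)
  ultimately show ?thesis by (simp add: limit_form_def energy_def stiffness_def)
qed

lemma rest_X: "F \<in> V \<Longrightarrow> rest F \<in> X"
  by (simp add: X_def \<pi>_parts rest_V[unfolded mem_Collect_eq])

lemma parts_unique:
  assumes w: "w \<in> F0 PD" "\<kappa> w = 0" and n: "n \<in> K" and x: "x \<in> X"
  shows "core (w + n + x) = w" "slow (w + n + x) = n" "rest (w + n + x) = x"
proof -
  have p: "\<pi> (w + n + x) = w + n"
    using w n x \<pi>(3) K_F0 by (auto simp: \<pi>.add X_def)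
  have k: "\<kappa> (w + n) = n" using w n \<kappa>(3) by (simp add: \<kappa>.add)
  show "core (w + n + x) = w" "slow (w + n + x) = n" "rest (w + n + x) = x"
    by (simp_all add: core_def slow_def rest_def p k)
qed

text \<open>
  The coupling term is indefinite, but multiplied by a small \<open>t\<close> it is dominated by
  stiffness and mass. Replacing \<open>n\<close> by \<open>n\<close> divided by \<open>t\<close> restores the coupling at the price of
  the factor $t^{-2}$ in front of the mass.
\<close>
lemma energy_bounded_below:
  obtains c where "\<And>n x. n \<in> K \<Longrightarrow> n \<noteq> 0 \<Longrightarrow> x \<in> X \<Longrightarrow> c * mass n < energy n x"
proof -
  define P where "P G F = edge_form (\<lambda>_. 0) (\<lambda>e. 1 / (len e / 2)) (rest G) (rest F) +
    edge_form (\<lambda>e. len e / 2) (\<lambda>_. 0) (slow G) (slow F)" for G F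
  define C where "C G F = q (slow G) (rest F) + q (rest G) (slow F)" for G F
  have hC: "hermitian_form C"
    unfolding C_def[abs_def] by (rule hermitian_form_cross[OF hermitian_form_q linear_parts(2,3)])
  have hP: "hermitian_form P"
    unfolding P_def[abs_def]
    by (rule hermitian_form_add hermitian_form_compose[OF hermitian_form_edge_form linear_parts(2)]
      hermitian_form_compose[OF hermitian_form_edge_form linear_parts(3)])+
  have hCP: "hermitian_form (\<lambda>G F. of_real t * C G F + P G F)" for t
    by (rule hermitian_form_add[OF hermitian_form_scale[OF hC] hP])
  define S where "S = {v \<in> V. core v = 0}"
  have S: "vec.subspace S"
    using vec_subspace_V by (auto simp: S_def vec.subspace_def core.add core.scale core.zero)
  have pos: "positive_on S P"
    unfolding positive_on_def
  proof (intro ballI impI)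
    fix F assume F: "F \<in> S" "F \<noteq> 0"
    have "F = slow F + rest F" using parts_sum[of F] F(1) by (simp add: S_def)
    then have "slow F \<noteq> 0 \<or> rest F \<noteq> 0" using F(2) by auto
    moreover have "rest F \<noteq> 0 \<Longrightarrow> 0 < stiffness (rest F)"
      using stiffness_pos[OF rest_X, of F] F(1) by (simp add: S_def)
    moreover have "slow F \<noteq> 0 \<Longrightarrow> 0 < mass (slow F)"
      using mass_pos[of "slow F"] slow_K K_F0 by blast
    moreover have "0 \<le> stiffness (rest F)" "0 \<le> mass (slow F)" using less_imp_le[OF len]
      by (simp_all add: stiffness_def mass_def Re_edge_form sum_nonneg)
    ultimately show "0 < Re (P F F)"
      by (fastforce simp: P_def stiffness_def mass_def)
  qed
  have lim: "((\<lambda>t. of_real t * C G F + P G F) \<longlongrightarrow> P G F) (at_right 0)" for G F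
    by (rule tendsto_eq_intros refl)+ auto
  have "\<forall>\<^sub>F t in at_right 0. positive_on S (\<lambda>G F. of_real t * C G F + P G F)"
    by (rule positive_on_stable[OF always_eventually hP lim S pos]) (simp add: hCP)
  then have "\<forall>\<^sub>F t in at_right 0. 0 < t \<and> positive_on S (\<lambda>G F. of_real t * C G F + P G F)"
    using eventually_at_right_less[of 0] by eventually_elim simp
  then obtain t :: real where t: "0 < t" "positive_on S (\<lambda>G F. of_real t * C G F + P G F)"
    using eventually_happens trivial_limit_at_right_real by blast
  show thesis
  proof (rule that[of "- (1 / t\<^sup>2)"])
    fix n x assume n: "n \<in> K" "n \<noteq> 0" and x: "x \<in> X"
    define n' where "n' = of_real (1 / t) *s n"
    have n': "n' \<in> K" unfolding n'_def using n vec_subspace_K by (simp add: vec.subspace_scale)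
    define v where "v = 0 + n' + x"
    have parts: "core v = 0" "slow v = n'" "rest v = x"
      unfolding v_def using parts_unique[OF vec.subspace_0[OF vec_subspace_F0] \<kappa>.zero n' x] by auto
    have "v \<noteq> 0" using parts(2) n t(1) by (auto simp: n'_def slow.zero)
    moreover have "v \<in> S"
      unfolding S_def using parts n' x K_F0 F0_V vec.subspace_add[OF vec_subspace_V, of n' x]
      by (auto simp: v_def X_def)
    ultimately have "0 < Re (of_real t * C v v + P v v)" using t(2) unfolding positive_on_def by blast
    also have "C v v = of_real (1 / t) * (q n x + cnj (q n x))"
      unfolding C_def parts n'_def hermitian_form_cnj[OF hermitian_form_q, of x]
      by (simp add: hermitian_form_simps[OF hermitian_form_q] distrib_left)
    also have "Re (of_real t * (of_real (1 / t) * (q n x + cnj (q n x))) + P v v) = 2 * Re (q n x) + Re (P v v)"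
      using t(1) by (simp flip: mult.assoc)
    also have "Re (P v v) = stiffness x + (1 / t\<^sup>2) * mass n"
      unfolding P_def parts stiffness_def mass_def n'_def
      by (simp add: hermitian_form_simps[OF hermitian_form_edge_form] power2_eq_square)
    finally show "- (1 / t\<^sup>2) * mass n < energy n x" by (simp add: energy_def)
  qed
qed

lemma energy_scale: "energy (c *s n) (c *s x) = (cmod c)\<^sup>2 * energy n x" and mass_scale: "mass (c *s n) = (cmod c)\<^sup>2 * mass n"
proof -
  have *: "Re (c * (cnj c * z)) = (cmod c)\<^sup>2 * Re z" for z
    by (simp add: cmod_power2) (simp add: power2_eq_square algebra_simps)
  have scale: "Re (p (c *s F) (c *s F')) = (cmod c)\<^sup>2 * Re (p F F')" if "hermitian_form p" for p F F'
    by (simp only: hermitian_form_simps[OF that] *)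
  then show "energy (c *s n) (c *s x) = (cmod c)\<^sup>2 * energy n x" "mass (c *s n) = (cmod c)\<^sup>2 * mass n"
    by (simp_all add: energy_def stiffness_def mass_def distrib_left
        scale[OF hermitian_form_q] scale[OF hermitian_form_edge_form])
qed

text \<open>
  The form $q$ is nondegenerate on the core, since a null vector there would be one on all of
  $\mathcal{F}_0$. So the semidefinite part of Sylvester's splitting is definite.
\<close>
lemma core_splitting:
  obtains W Y where "vec.subspace W" "vec.subspace Y" "W \<inter> Y = {0}" "subspace_sum W Y = {F \<in> F0 PD. \<kappa> F = 0}"
    "positive_on W (\<lambda>G F. - q G F)" "positive_on Y q"
proof -
  let ?C = "{F \<in> F0 PD. \<kappa> F = 0}"
  have C: "vec.subspace ?C"
    using vec_subspace_F0 by (auto simp: vec.subspace_def \<kappa>.add \<kappa>.scale \<kappa>.zero)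
  obtain W Y where WY: "vec.subspace W" "vec.subspace Y" "W \<inter> Y = {0}" "subspace_sum W Y = ?C"
    "positive_on W (\<lambda>G F. - q G F)" "\<forall>F\<in>Y. 0 \<le> Re (q F F)" "\<forall>w\<in>W. \<forall>z\<in>Y. q w z = 0"
    using sylvester_splitting[OF hermitian_form_q C] by blast
  have YC: "Y \<subseteq> ?C" using WY(4) vec.subspace_0[OF WY(1)] unfolding subspace_sum_def by force
  have "positive_on Y q"
    unfolding positive_on_def
  proof (intro ballI impI, rule ccontr)
    fix F assume F: "F \<in> Y" "F \<noteq> 0" "\<not> 0 < Re (q F F)"
    then have 0: "Re (q F F) = 0" using WY(6) by force
    have F0: "F \<in> F0 PD" "\<kappa> F = 0" using F(1) YC by auto
    have "q G F = 0" if G: "G \<in> F0 PD" for G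
    proof -
      have "G - \<kappa> G \<in> ?C"
        using G \<kappa>(2)[of G] \<kappa>(3) K_F0 vec.subspace_diff[OF vec_subspace_F0] by (auto simp: \<kappa>.diff)
      then obtain w y where wy: "G - \<kappa> G = w + y" "w \<in> W" "y \<in> Y"
        unfolding WY(4)[symmetric] subspace_sum_def by blast
      have "q y F = 0" using semidefinite_null[OF hermitian_form_q WY(2), of F y] WY(6) F(1) 0 wy by blast
      moreover have "q w F = 0" using WY(7) wy F(1) by blast
      moreover have "q (\<kappa> G) F = 0" by (rule q_K_F0(2)[OF F0(1) \<kappa>(2)])
      moreover have "G = w + y + \<kappa> G" using wy(1) by (simp add: algebra_simps)
      ultimately show ?thesis
        by (metis hermitian_form_simps(2)[OF hermitian_form_q] add_0)
    qed
    then have "F \<in> K" using F0 by (simp add: null_space_def)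
    then show False using \<kappa>(3) F0(2) F(2) by force
  qed
  then show thesis using that WY by blast
qed

context
  fixes W Y
  assumes WY: "vec.subspace W" "vec.subspace Y" "W \<inter> Y = {0}" "subspace_sum W Y = {F \<in> F0 PD. \<kappa> F = 0}"
    "positive_on W (\<lambda>G F. - q G F)" "positive_on Y q"
begin

lemma W_core: "W \<subseteq> {F \<in> F0 PD. \<kappa> F = 0}" and Y_core: "Y \<subseteq> {F \<in> F0 PD. \<kappa> F = 0}"
  unfolding WY(4)[symmetric] subspace_sum_def using vec.subspace_0[OF WY(1)] vec.subspace_0[OF WY(2)] by force+

lemma core_WY: "\<exists>w\<in>W. \<exists>y\<in>Y. core F = w + y"
proof -
  have "core F \<in> subspace_sum W Y" unfolding WY(4) using core_F0 \<kappa>_parts by simp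
  then show ?thesis unfolding subspace_sum_def by blast
qed

text \<open>
  Under the hypothesis the limit form is positive on everything whose core component lies in \<open>Y\<close>, a subspace
  of codimension \<open>dim W\<close>.
\<close>
lemma eventually_count_le_dim_W:
  assumes low: "\<And>n x. n \<in> K \<Longrightarrow> n \<noteq> 0 \<Longrightarrow> x \<in> X \<Longrightarrow> \<mu> * mass n < energy n x"
  shows "\<forall>\<^sub>F \<epsilon> in at_right 0. sum (eigenvalue_mult (H \<epsilon>)) (eigenvalues (H \<epsilon>) \<inter> {..\<mu>}) \<le> vec.dim W"
proof -
  define Z where "Z = {v \<in> V. core v \<in> Y}"
  have Z: "vec.subspace Z"
    using vec_subspace_V WY(2) by (auto simp: Z_def vec.subspace_def core.add core.scale core.zero)
  have ZV: "Z \<subseteq> V" by (auto simp: Z_def)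
  have core_W: "core w = w" if "w \<in> W" for w
    using parts_unique(1)[of w 0 0] that W_core vec.subspace_0[OF vec_subspace_K] vec.subspace_0[OF vec_subspace_X] by auto
  have "W \<inter> Z = {0}"
    using WY(3) core_W vec.subspace_0[OF WY(1)] vec.subspace_0[OF Z] by (auto simp: Z_def)
  moreover have "subspace_sum W Z = V"
  proof (intro equalityI subsetI)
    fix F assume "F \<in> subspace_sum W Z"
    then show "F \<in> V" unfolding subspace_sum_def
      using W_core F0_V ZV vec.subspace_add[OF vec_subspace_V] by blast
  next
    fix F assume F: "F \<in> V"
    obtain w y where wy: "w \<in> W" "y \<in> Y" "core F = w + y" using core_WY by blast
    have "w \<in> V" using wy(1) W_core F0_V by blast
    then have "F - w \<in> V" using F vec.subspace_diff[OF vec_subspace_V] by blast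
    then have "F - w \<in> Z" using wy core_W by (simp add: Z_def core.diff)
    then show "F \<in> subspace_sum W Z"
      unfolding subspace_sum_def using wy(1) by (intro CollectI exI[of _ w] exI[of _ "F - w"]) simp
  qed
  ultimately have dim: "vec.dim V = vec.dim W + vec.dim Z" using dim_subspace_sum[OF WY(1) Z] by simp
  have "positive_on Z (limit_form \<mu>)"
    unfolding positive_on_def
  proof (intro ballI impI)
    fix F assume F: "F \<in> Z" "F \<noteq> 0"
    have x: "rest F \<in> X" using rest_X F(1) ZV by blast
    have 1: "core F \<noteq> 0 \<Longrightarrow> 0 < Re (q (core F) (core F))"
      using WY(6) F(1) by (simp add: Z_def positive_on_def)
    have 2: "slow F \<noteq> 0 \<Longrightarrow> \<mu> * mass (slow F) < energy (slow F) (rest F)"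
      using low[OF slow_K _ x] .
    have 3: "slow F = 0 \<Longrightarrow> energy (slow F) (rest F) - \<mu> * mass (slow F) = stiffness (rest F)"
      by (simp add: energy_def mass_def hermitian_form_simps[OF hermitian_form_q]
          hermitian_form_simps[OF hermitian_form_edge_form])
    have 4: "core F = 0 \<Longrightarrow> q (core F) (core F) = 0"
      by (simp add: hermitian_form_simps[OF hermitian_form_q])
    have 5: "rest F = 0 \<Longrightarrow> stiffness (rest F) = 0"
      by (simp add: stiffness_def hermitian_form_simps[OF hermitian_form_edge_form])
    have "core F \<noteq> 0 \<or> slow F \<noteq> 0 \<or> rest F \<noteq> 0" using F(2) parts_sum[of F] by auto
    then show "0 < Re (limit_form \<mu> F F)"
      unfolding Re_limit_form using 1 2 3 4 5 stiffness_pos[OF x]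
      by (cases "core F = 0"; cases "slow F = 0"; cases "rest F = 0") auto
  qed
  from eventually_count_le[OF Z ZV this] show ?thesis unfolding dim by simp
qed

lemma eventually_count_ge_dim_W:
  "\<forall>\<^sub>F \<epsilon> in at_right 0. vec.dim W \<le> sum (eigenvalue_mult (H \<epsilon>)) (eigenvalues (H \<epsilon>) \<inter> {..<\<mu>})"
proof (rule eventually_count_ge[OF WY(1)])
  show "W \<subseteq> V" using W_core F0_V by blast
  show "positive_on W (\<lambda>G F. - limit_form \<mu> G F)"
    unfolding positive_on_def
  proof (intro ballI impI)
    fix F assume F: "F \<in> W" "F \<noteq> 0"
    have "core F = F" "slow F = 0" "rest F = 0"
      using parts_unique[of F 0 0] F W_core vec.subspace_0[OF vec_subspace_K] vec.subspace_0[OF vec_subspace_X] by auto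
    then show "0 < Re (- limit_form \<mu> F F)"
      using WY(5) F unfolding positive_on_def
      by (simp add: Re_limit_form energy_def mass_def stiffness_def hermitian_form_simps[OF hermitian_form_q]
          hermitian_form_simps[OF hermitian_form_edge_form])
  qed
qed

text \<open>
  The vector \<open>n + x\<close> adds one negative direction to \<open>W\<close>, as the limit form does not couple it to the core.
\<close>
lemma eventually_count_gt_dim_W:
  assumes n: "n \<in> K" "n \<noteq> 0" and x: "x \<in> X" and high: "energy n x < \<mu> * mass n"
  shows "\<forall>\<^sub>F \<epsilon> in at_right 0. vec.dim W + 1 \<le> sum (eigenvalue_mult (H \<epsilon>)) (eigenvalues (H \<epsilon>) \<inter> {..<\<mu>})"
proof -
  define L where "L = range (\<lambda>c. c *s (n + x))"
  have L: "vec.subspace L" unfolding L_def using vec.subspace_span[of "{n + x}"] by (simp add: vec.span_singleton)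
  have nx: "core (w + c *s (n + x)) = w" "slow (w + c *s (n + x)) = c *s n" "rest (w + c *s (n + x)) = c *s x"
    if "w \<in> W" for w c
  proof -
    have "c *s n \<in> K" "c *s x \<in> X"
      using n x vec_subspace_K vec_subspace_X by (auto intro: vec.subspace_scale)
    then show "core (w + c *s (n + x)) = w" "slow (w + c *s (n + x)) = c *s n" "rest (w + c *s (n + x)) = c *s x"
      using parts_unique[of w "c *s n" "c *s x"] that W_core by (auto simp: vec.scale_right_distrib add.assoc)
  qed
  have nx0: "n + x \<noteq> 0" using nx(2)[OF vec.subspace_0[OF WY(1)], of 1] n(2) slow.zero by auto
  have dimL: "vec.dim L = 1"
  proof -
    have "vec.dim L = vec.dim {n + x}" unfolding L_def vec.span_singleton[symmetric] by (rule vec.dim_span)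
    then show ?thesis using nx0 by simp
  qed
  define U where "U = subspace_sum W L"
  have U: "vec.subspace U" unfolding U_def by (rule vec_subspace_sum[OF WY(1) L])
  have "n \<in> V" using n(1) K_F0 F0_V by blast
  moreover have "x \<in> V" using x by (simp add: X_def)
  ultimately have "n + x \<in> V" by (rule vec.subspace_add[OF vec_subspace_V])
  then have UV: "U \<subseteq> V"
    unfolding U_def subspace_sum_def L_def using W_core F0_V
      vec.subspace_add[OF vec_subspace_V] vec.subspace_scale[OF vec_subspace_V] by blast
  have "F = 0" if F: "F \<in> W" "F \<in> L" for F
  proof -
    obtain c where c: "F = c *s (n + x)" using F(2) by (auto simp: L_def)
    have "core F = 0" using nx(1)[OF vec.subspace_0[OF WY(1)], of c] c by simp
    moreover have "core F = F" using nx(1)[OF F(1), of 0] by simp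
    ultimately show ?thesis by simp
  qed
  then have "W \<inter> L = {0}" using WY(1) L by (auto simp: vec.subspace_0)
  then have dimU: "vec.dim U = vec.dim W + 1" unfolding U_def using dim_subspace_sum[OF WY(1) L] dimL by simp
  have "positive_on U (\<lambda>G F. - limit_form \<mu> G F)"
    unfolding positive_on_def
  proof (intro ballI impI)
    fix F assume F: "F \<in> U" "F \<noteq> 0"
    obtain w c where wc: "w \<in> W" "F = w + c *s (n + x)"
      using F(1) by (auto simp: U_def subspace_sum_def L_def)
    have val: "Re (limit_form \<mu> F F) = Re (q w w) + (cmod c)\<^sup>2 * (energy n x - \<mu> * mass n)"
      unfolding Re_limit_form wc(2) nx[OF wc(1)] energy_scale mass_scale by (simp add: algebra_simps)
    have 1: "w \<noteq> 0 \<Longrightarrow> Re (q w w) < 0" using WY(5) wc(1) by (simp add: positive_on_def)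
    have 2: "w = 0 \<Longrightarrow> Re (q w w) = 0" by (simp add: hermitian_form_simps[OF hermitian_form_q])
    have 3: "c \<noteq> 0 \<Longrightarrow> (cmod c)\<^sup>2 * (energy n x - \<mu> * mass n) < 0" using high by (simp add: mult_pos_neg)
    have "w \<noteq> 0 \<or> c \<noteq> 0" using F(2) wc(2) by auto
    then show "0 < Re (- limit_form \<mu> F F)"
      unfolding uminus_complex.simps val using 1 2 3 by (cases "w = 0"; cases "c = 0") auto
  qed
  from eventually_count_ge[OF U UV this] show ?thesis unfolding dimU .
qed

text \<open>
  The limit $l$ is the infimum of the quotients of energy by mass. The set \<open>M\<close> below is the upward closed set of
  levels above some such quotient.
\<close>
lemma exotic_first:
  assumes K: "K \<noteq> {0}"
  shows "exotic H (vec.dim W + 1)"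
proof -
  define M where "M = {\<mu>. \<exists>n\<in>K. \<exists>x\<in>X. n \<noteq> 0 \<and> energy n x < \<mu> * mass n}"
  define l where "l = Inf M"
  obtain n where n: "n \<in> K" "n \<noteq> 0" using K vec.subspace_0[OF vec_subspace_K] by blast
  have mass: "0 < mass m" if "m \<in> K" "m \<noteq> 0" for m using mass_pos that K_F0 by blast
  have "energy n 0 < (energy n 0 / mass n + 1) * mass n" using mass[OF n] by (simp add: field_simps)
  then have ne: "M \<noteq> {}" unfolding M_def using n vec.subspace_0[OF vec_subspace_X] by blast
  obtain c where c: "\<And>n x. n \<in> K \<Longrightarrow> n \<noteq> 0 \<Longrightarrow> x \<in> X \<Longrightarrow> c * mass n < energy n x"
    using energy_bounded_below by blast
  have "c \<le> \<mu>" if \<mu>: "\<mu> \<in> M" for \<mu>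
  proof -
    obtain m x where m: "m \<in> K" "x \<in> X" "m \<noteq> 0" "energy m x < \<mu> * mass m" using \<mu> by (auto simp: M_def)
    then have "c * mass m < \<mu> * mass m" using c[of m x] by simp
    then show ?thesis using mass[OF m(1,3)] by simp
  qed
  then have bdd: "bdd_below M" by (rule bdd_belowI)
  show ?thesis
  proof (rule exotic_if_counts)
    show "\<forall>\<^sub>F \<epsilon> in at_right 0. finite (eigenvalues (H \<epsilon>) \<inter> {..a})" for a
      by (rule eventually_finite_eigenvalues)
  next
    fix \<mu> assume "\<mu> < l"
    then obtain \<nu> where \<nu>: "\<mu> < \<nu>" "\<nu> < l" using dense by blast
    have "\<nu> \<notin> M" using cInf_lower[OF _ bdd, of \<nu>] \<nu>(2) by (auto simp: l_def)
    have low: "\<mu> * mass m < energy m x" if m: "m \<in> K" "m \<noteq> 0" and x: "x \<in> X" for m x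
    proof -
      have "\<nu> * mass m \<le> energy m x" using \<open>\<nu> \<notin> M\<close> m x by (force simp: M_def)
      moreover have "\<mu> * mass m < \<nu> * mass m" using \<nu>(1) mass[OF m] by simp
      ultimately show ?thesis by simp
    qed
    have "\<forall>\<^sub>F \<epsilon> in at_right 0. sum (eigenvalue_mult (H \<epsilon>)) (eigenvalues (H \<epsilon>) \<inter> {..\<mu>}) \<le> vec.dim W"
      by (rule eventually_count_le_dim_W) (rule low)
    then show "\<forall>\<^sub>F \<epsilon> in at_right 0. sum (eigenvalue_mult (H \<epsilon>)) (eigenvalues (H \<epsilon>) \<inter> {..\<mu>}) < vec.dim W + 1"
      by eventually_elim simp
  next
    fix \<mu> assume "l < \<mu>"
    then obtain \<nu> where \<nu>: "\<nu> \<in> M" "\<nu> < \<mu>" using cInf_lessD[OF ne] unfolding l_def by blast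
    obtain m x where m: "m \<in> K" "m \<noteq> 0" "x \<in> X" "energy m x < \<nu> * mass m" using \<nu>(1) by (auto simp: M_def)
    have "\<nu> * mass m < \<mu> * mass m" using \<nu>(2) mass[OF m(1,2)] by simp
    then show "\<forall>\<^sub>F \<epsilon> in at_right 0.
        vec.dim W + 1 \<le> sum (eigenvalue_mult (H \<epsilon>)) (eigenvalues (H \<epsilon>) \<inter> {..<\<mu>})"
      using m by (intro eventually_count_gt_dim_W[of m x]) auto
  qed
qed

end

lemma no_exotic_iff: "(\<nexists>n. exotic H n) \<longleftrightarrow> K = {0}"
proof -
  obtain W Y where WY: "vec.subspace W" "vec.subspace Y" "W \<inter> Y = {0}" "subspace_sum W Y = {F \<in> F0 PD. \<kappa> F = 0}"
    "positive_on W (\<lambda>G F. - q G F)" "positive_on Y q"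
    by (rule core_splitting)
  show ?thesis
  proof
    assume "\<nexists>n. exotic H n"
    then show "K = {0}" using exotic_first[OF WY] by blast
  next
    assume K: "K = {0}"
    have "\<not> exotic H n" for n
      by (rule not_exotic_if_counts[OF eventually_finite_eigenvalues
            eventually_count_le_dim_W[OF WY] eventually_count_ge_dim_W[OF WY]])
        (simp add: K)
    then show "\<nexists>n. exotic H n" by blast
  qed
qed

end

theorem proposition2p2:
  fixes len :: "'e::finite \<Rightarrow> real"
    and PD PN PR :: "complex ^ 'e endpoint ^ 'e endpoint"
    and \<Lambda> :: "complex ^ 'e endpoint \<Rightarrow> complex ^ 'e endpoint"
  assumes "\<And>e. len e > 0"
    and "orth_projector PD" and "orth_projector PN" and "orth_projector PR"
    and "PD + PN + PR = mat 1"
    and "invertible_selfadjoint_on (range ((*v) PR)) \<Lambda>"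
  shows "ProjE (vertex_conditions PD PN PR \<Lambda> \<inter> (D0 \<times> N0)) =
           {F \<in> F0 PD. \<forall>G \<in> F0 PD. qform PR \<Lambda> G F = 0} \<and>
         ((\<nexists>n. exotic (shrinking_graph_operator len PD PN PR \<Lambda>) n) \<longleftrightarrow>
           vec.dim (ProjE (vertex_conditions PD PN PR \<Lambda> \<inter> (D0 \<times> N0))) = 0)"
proof -
  interpret graph_vertex_data PD PN PR \<Lambda>
    by unfold_locales (use assms in auto)
  have F0: "vec.subspace (F0 PD)"
    using vec_subspace_V by (auto simp: F0_def D0_def vec.subspace_def)
  let ?K = "null_space (F0 PD) (qform PR \<Lambda>)"
  have K: "vec.subspace ?K" by (rule vec_subspace_null_space[OF hermitian_form_q F0])
  obtain \<pi> where \<pi>: "Vector_Spaces.linear (*s) (*s) \<pi>" "\<And>x. \<pi> x \<in> F0 PD" "\<And>x. x \<in> F0 PD \<Longrightarrow> \<pi> x = x"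
    using vec_projection_exists[OF F0] by metis
  obtain \<kappa> where \<kappa>: "Vector_Spaces.linear (*s) (*s) \<kappa>" "\<And>x. \<kappa> x \<in> ?K" "\<And>x. x \<in> ?K \<Longrightarrow> \<kappa> x = x"
    using vec_projection_exists[OF K] by metis
  have "scaled_splitting PD PN PR \<Lambda> len \<pi> \<kappa>"
    by (intro scaled_splitting.intro scaled_splitting_axioms.intro graph_vertex_data_axioms assms(1) \<pi> \<kappa>)
  then have "(\<nexists>n. exotic (shrinking_graph_operator len PD PN PR \<Lambda>) n) \<longleftrightarrow> ?K = {0}"
    by (rule scaled_splitting.no_exotic_iff)
  also have "\<dots> \<longleftrightarrow> vec.dim ?K = 0"
    using vec.subspace_0[OF K] by auto
  finally show ?thesis
    unfolding ProjE_eq by (simp only: null_space_def simp_thms)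
qed

end
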